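(* Let $\mathbf{k}$ be a field of characteristic $p>0$, $d\in\mathbb{Z}$, and let $\mathrm{A}$ with the automorphism $\Sigma$ be a $d$-Calabi-Yau ($\mathbf{k}$-linear, small) category. Then, for every $r\ge0$, $K_r(\mathrm{A}/\Sigma)=K_{r,d}(\mathrm{A}/\Sigma)=T_r(\mathrm{A}/\Sigma)^{\perp}$.
   Context: All categories are small and $\mathbf{k}$-linear; $\mathrm{A}_x^y=\mathrm{Hom}_{\mathrm{A}}(x,y)$; $fg$ means $f$ after $g$. $\mathrm{A}$ with automorphism $\Sigma$ is $d$-Calabi-Yau if all $\mathrm{A}_x^y$ are finite dimensional and there are (fixed) linear maps $tr_x:\mathrm{A}_x^{\Sigma^dx}\to\mathbf{k}$ ($x\in\mathrm{A}$) such that (1) the pairing $\mathrm{A}_y^{\Sigma^dx}\times\mathrm{A}_x^y\to\mathbf{k}$, $(f,g)\mapsto tr_x(fg)$ is nondegenerate for all $x,y$; (2) for all $m\in\mathbb{Z}$, $g\in\mathrm{A}_x^{\Sigma^my}$, $f\in\mathrm{A}_y^{\Sigma^{d-m}x}$ one has $tr_x(\Sigma^m(f)g)=(-1)^{m(d-m)}tr_y(\Sigma^{d-m}(g)f)$. Orbit category $\mathrm{B}=\mathrm{A}/\Sigma$: graded category with the objects of $\mathrm{A}$, $(\mathrm{B}_x^y)_n=\mathrm{A}_x^{\Sigma^ny}$, composition $g\circ f=\Sigma^n(g)f$ for $f$ of degree $n$. Its center $\mathrm{B}^{\mathrm{B}}$ has $i$-th component the families $(m_x)_x\in\prod_x(\mathrm{B}_x^x)_i$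 with $f\circ m_x=(-1)^{ij}m_y\circ f$ for all $f\in(\mathrm{B}_x^y)_j$; it is identified with the graded center $\mathrm{Z}^*(\mathrm{A})$, whose degree $n$ part is the set of natural transformations $\eta:\mathrm{Id}_{\mathrm{A}}\to\Sigma^n$ with $\eta_{\Sigma x}=(-1)^n\Sigma(\eta_x)$. Its abelianization is $\mathrm{B}_{\mathrm{B}}=\oplus_x\mathrm{B}_x^x/[\mathrm{B},\mathrm{B}]$, where $[\mathrm{B},\mathrm{B}]$ is spanned by $f\circ u-(-1)^{ij}u\circ f$ for $u\in(\mathrm{B}_x^y)_i$, $f\in(\mathrm{B}_y^x)_j$; it is a graded $\mathrm{B}^{\mathrm{B}}$-bimodule and is also denoted $\mathrm{Ab}_*(\mathrm{A})$. The map $\xi_p(\sum_nf_n)=\sum_nf_n^p$ ($f_n$ homogeneous of degree $n$, powers in $\oplus_x\mathrm{B}_x^x$) induces a well-defined map $\xi_p:\mathrm{B}_{\mathrm{B}}\to\mathrm{B}_{\mathrm{B}}$; $T_r\mathrm{B}=\ker\xi_p^r$; $(K_{r,s}\mathrm{B})_n=\{a\in\mathrm{B}^{\mathrm{B}}_n\mid a(T_r\mathrm{B})_{s-n}=(T_r\mathrm{B})_{s-n}a=0\}$, $K_{r,s}\mathrm{B}=\oplus_n(K_{r,s}\mathrm{B})_n$; $K_r\mathrm{B}=\cap_{s\in\mathbb{Z}}K_{r,s}\mathrm{B}$. Pairing: let $tr_{\mathrm{A}}:\mathrm{B}_{\mathrm{B}}\to\mathbf{k}$ be the map induced by $tr_x$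 on $\mathrm{A}_x^{\Sigma^dx}$ and $0$ on $\mathrm{A}_x^{\Sigma^nx}$ for $n\neq d$ (well defined for a $d$-Calabi-Yau category). For $\eta\in\mathrm{Z}^i(\mathrm{A})$ and $g\in\mathrm{Ab}_*(\mathrm{A})$ represented by $u\in(\mathrm{B}_x^x)_j$, put $(\eta,g)=tr_{\mathrm{A}}(u\circ\eta_x)=tr_{\mathrm{A}}(\Sigma^i(u)\eta_x)$, extended bilinearly. This pairing induces an isomorphism of graded spaces from $\mathrm{Z}^*(\mathrm{A})$ to the graded dual of $\mathrm{Ab}_*(\mathrm{A})$ shifted so that $\mathrm{Z}^i(\mathrm{A})\cong(\mathrm{Ab}_{d-i}(\mathrm{A}))^*$. For $\mathrm{U}\subseteq\mathrm{Ab}_*(\mathrm{A})$, $\mathrm{U}^\perp=\{\eta\in\mathrm{Z}^*(\mathrm{A})\mid(\eta,g)=0\text{ for all }g\in\mathrm{U}\}$. *)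

theory Defs
  imports "HOL-Computational_Algebra.Computational_Algebra" "HOL-Library.Poly_Mapping"
begin

text \<open>
  The category has object set \<open>Obj A\<close>; \<open>Hom A x y\<close> is the space of morphisms from \<open>x\<close> to \<open>y\<close>, and
  \<open>Comp A x y z g f\<close> is \<open>g\<close> after \<open>f\<close> for \<open>f\<close> from \<open>x\<close> to \<open>y\<close> and \<open>g\<close> from \<open>y\<close> to \<open>z\<close>.  All Hom
  spaces are subspaces of one vector space \<open>'m\<close>.  This loses no generality: a family of vector
  spaces embeds into its direct sum.  The Hom spaces are not assumed to be disjoint, which is why
  composition and functors take the objects as arguments.
\<close>

record ('k, 'o, 'm) lin_cat =
  Obj :: "'o set"
  Hom :: "'o \<Rightarrow> 'o \<Rightarrow> 'm set"
  Ident :: "'o \<Rightarrow> 'm"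
  Comp :: "'o \<Rightarrow> 'o \<Rightarrow> 'o \<Rightarrow> 'm \<Rightarrow> 'm \<Rightarrow> 'm"
  smul :: "'k \<Rightarrow> 'm \<Rightarrow> 'm"

definition linear_between ::
    "('k \<Rightarrow> 'v::ab_group_add \<Rightarrow> 'v) \<Rightarrow> ('k \<Rightarrow> 'w::ab_group_add \<Rightarrow> 'w) \<Rightarrow> 'v set \<Rightarrow> ('v \<Rightarrow> 'w) \<Rightarrow> bool" where
  "linear_between s1 s2 V F \<longleftrightarrow>
     (\<forall>u\<in>V. \<forall>v\<in>V. F (u + v) = F u + F v) \<and> (\<forall>c. \<forall>v\<in>V. F (s1 c v) = s2 c (F v))"

locale linear_category =
  fixes A :: "('k::field, 'o, 'm::ab_group_add) lin_cat"
  assumes vector_space_smul: "vector_space (smul A)"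
    and subspace_Hom:
      "\<lbrakk>x \<in> Obj A; y \<in> Obj A\<rbrakk> \<Longrightarrow> module.subspace (smul A) (Hom A x y)"
    and Ident_in_Hom: "x \<in> Obj A \<Longrightarrow> Ident A x \<in> Hom A x x"
    and Comp_in_Hom:
      "\<lbrakk>x \<in> Obj A; y \<in> Obj A; z \<in> Obj A; f \<in> Hom A x y; g \<in> Hom A y z\<rbrakk>
        \<Longrightarrow> Comp A x y z g f \<in> Hom A x z"
    and Comp_Ident_left:
      "\<lbrakk>x \<in> Obj A; y \<in> Obj A; f \<in> Hom A x y\<rbrakk> \<Longrightarrow> Comp A x y y (Ident A y) f = f"
    and Comp_Ident_right:
      "\<lbrakk>x \<in> Obj A; y \<in> Obj A; f \<in> Hom A x y\<rbrakk> \<Longrightarrow> Comp A x x y f (Ident A x) = f"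
    and Comp_assoc:
      "\<lbrakk>w \<in> Obj A; x \<in> Obj A; y \<in> Obj A; z \<in> Obj A;
        f \<in> Hom A w x; g \<in> Hom A x y; h \<in> Hom A y z\<rbrakk>
        \<Longrightarrow> Comp A w x z (Comp A x y z h g) f = Comp A w y z h (Comp A w x y g f)"
    and Comp_linear_left:
      "\<lbrakk>x \<in> Obj A; y \<in> Obj A; z \<in> Obj A; f \<in> Hom A x y\<rbrakk>
        \<Longrightarrow> linear_between (smul A) (smul A) (Hom A y z) (\<lambda>g. Comp A x y z g f)"
    and Comp_linear_right:
      "\<lbrakk>x \<in> Obj A; y \<in> Obj A; z \<in> Obj A; g \<in> Hom A y z\<rbrakk>
        \<Longrightarrow> linear_between (smul A) (smul A) (Hom A x y) (\<lambda>f. Comp A x y z g f)"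

record ('o, 'm) endofun =
  omap :: "'o \<Rightarrow> 'o"
  mmap :: "'o \<Rightarrow> 'o \<Rightarrow> 'm \<Rightarrow> 'm"

locale linear_automorphism = linear_category A
  for A :: "('k::field, 'o, 'm::ab_group_add) lin_cat" +
  fixes S :: "('o, 'm) endofun"
  assumes bij_omap: "bij_betw (omap S) (Obj A) (Obj A)"
    and bij_mmap:
      "\<lbrakk>x \<in> Obj A; y \<in> Obj A\<rbrakk>
        \<Longrightarrow> bij_betw (mmap S x y) (Hom A x y) (Hom A (omap S x) (omap S y))"
    and mmap_linear:
      "\<lbrakk>x \<in> Obj A; y \<in> Obj A\<rbrakk> \<Longrightarrow> linear_between (smul A) (smul A) (Hom A x y) (mmap S x y)"
    and mmap_Ident: "x \<in> Obj A \<Longrightarrow> mmap S x x (Ident A x) = Ident A (omap S x)"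
    and mmap_Comp:
      "\<lbrakk>x \<in> Obj A; y \<in> Obj A; z \<in> Obj A; f \<in> Hom A x y; g \<in> Hom A y z\<rbrakk>
        \<Longrightarrow> mmap S x z (Comp A x y z g f) =
            Comp A (omap S x) (omap S y) (omap S z) (mmap S y z g) (mmap S x y f)"

definition id_endofun :: "('o, 'm) endofun" where
  "id_endofun = \<lparr>omap = (\<lambda>x. x), mmap = (\<lambda>x y f. f)\<rparr>"

definition comp_endofun :: "('o, 'm) endofun \<Rightarrow> ('o, 'm) endofun \<Rightarrow> ('o, 'm) endofun" where
  "comp_endofun S T =
     \<lparr>omap = (\<lambda>x. omap S (omap T x)),
      mmap = (\<lambda>x y f. mmap S (omap T x) (omap T y) (mmap T x y f))\<rparr>"

definition inv_endofun ::
    "('k, 'o, 'm) lin_cat \<Rightarrow> ('o, 'm) endofun \<Rightarrow> ('o, 'm) endofun" where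
  "inv_endofun A S = (let h = inv_into (Obj A) (omap S) in
     \<lparr>omap = h, mmap = (\<lambda>x y. inv_into (Hom A (h x) (h y)) (mmap S (h x) (h y)))\<rparr>)"

definition aut_power ::
    "('k, 'o, 'm) lin_cat \<Rightarrow> ('o, 'm) endofun \<Rightarrow> int \<Rightarrow> ('o, 'm) endofun" where
  "aut_power A S n =
     (if n \<ge> 0 then (comp_endofun S ^^ nat n) id_endofun
      else (comp_endofun (inv_endofun A S) ^^ nat (- n)) id_endofun)"

abbreviation shift_obj ::
    "('k, 'o, 'm) lin_cat \<Rightarrow> ('o, 'm) endofun \<Rightarrow> int \<Rightarrow> 'o \<Rightarrow> 'o" where
  "shift_obj A S n \<equiv> omap (aut_power A S n)"

abbreviation shift_mor ::
    "('k, 'o, 'm) lin_cat \<Rightarrow> ('o, 'm) endofun \<Rightarrow> int \<Rightarrow> 'o \<Rightarrow> 'o \<Rightarrow> 'm \<Rightarrow> 'm" where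
  "shift_mor A S n \<equiv> mmap (aut_power A S n)"

locale calabi_yau_category = linear_automorphism A S
  for A :: "('k::field, 'o, 'm::ab_group_add) lin_cat" and S :: "('o, 'm) endofun" +
  fixes d :: int and tr :: "'o \<Rightarrow> 'm \<Rightarrow> 'k"
  assumes finite_dim_Hom:
      "\<lbrakk>x \<in> Obj A; y \<in> Obj A\<rbrakk> \<Longrightarrow> \<exists>X. finite X \<and> Hom A x y = module.span (smul A) X"
    and tr_linear:
      "x \<in> Obj A \<Longrightarrow> linear_between (smul A) (*) (Hom A x (shift_obj A S d x)) (tr x)"
    and nondegenerate_left:
      "\<lbrakk>x \<in> Obj A; y \<in> Obj A; f \<in> Hom A y (shift_obj A S d x);
        \<And>g. g \<in> Hom A x y \<Longrightarrow> tr x (Comp A x y (shift_obj A S d x) f g) = 0\<rbrakk> \<Longrightarrow> f = 0"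
    and nondegenerate_right:
      "\<lbrakk>x \<in> Obj A; y \<in> Obj A; g \<in> Hom A x y;
        \<And>f. f \<in> Hom A y (shift_obj A S d x)
          \<Longrightarrow> tr x (Comp A x y (shift_obj A S d x) f g) = 0\<rbrakk> \<Longrightarrow> g = 0"
    and tr_symmetric:
      "\<lbrakk>x \<in> Obj A; y \<in> Obj A; g \<in> Hom A x (shift_obj A S m y);
        f \<in> Hom A y (shift_obj A S (d - m) x)\<rbrakk> \<Longrightarrow>
        tr x (Comp A x (shift_obj A S m y) (shift_obj A S d x)
               (shift_mor A S m y (shift_obj A S (d - m) x) f) g)
        = (- 1) powi (m * (d - m)) *
          tr y (Comp A y (shift_obj A S (d - m) x) (shift_obj A S d y)
                 (shift_mor A S (d - m) x (shift_obj A S m y) g) f)"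

text \<open>
  \<open>gHom B n x y\<close> is the degree \<open>n\<close> part of the space of morphisms from \<open>x\<close> to \<open>y\<close>;
  \<open>gComp B x y z m n g f\<close> is \<open>g\<close> after \<open>f\<close> for \<open>g\<close> of degree \<open>m\<close> and \<open>f\<close> of degree \<open>n\<close>.
\<close>

record ('k, 'o, 'm) gr_cat =
  gObj :: "'o set"
  gHom :: "int \<Rightarrow> 'o \<Rightarrow> 'o \<Rightarrow> 'm set"
  gIdent :: "'o \<Rightarrow> 'm"
  gComp :: "'o \<Rightarrow> 'o \<Rightarrow> 'o \<Rightarrow> int \<Rightarrow> int \<Rightarrow> 'm \<Rightarrow> 'm \<Rightarrow> 'm"
  gsmul :: "'k \<Rightarrow> 'm \<Rightarrow> 'm"

definition orbit_category ::
    "('k, 'o, 'm) lin_cat \<Rightarrow> ('o, 'm) endofun \<Rightarrow> ('k, 'o, 'm) gr_cat" where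
  "orbit_category A S =
     \<lparr>gObj = Obj A,
      gHom = (\<lambda>n x y. Hom A x (shift_obj A S n y)),
      gIdent = Ident A,
      gComp = (\<lambda>x y z m n g f.
        Comp A x (shift_obj A S n y) (shift_obj A S (n + m) z)
          (shift_mor A S n y (shift_obj A S m z) g) f),
      gsmul = smul A\<rparr>"

text \<open>
  Families indexed by the objects are functions that vanish outside the object set.
\<close>

definition families :: "'o set \<Rightarrow> ('o \<Rightarrow> 'm set) \<Rightarrow> ('o \<Rightarrow> 'm::zero) set" where
  "families X F = {e. (\<forall>x\<in>X. e x \<in> F x) \<and> (\<forall>x. x \<notin> X \<longrightarrow> e x = 0)}"

definition graded_sum :: "(int \<Rightarrow> ('o \<Rightarrow> 'm::zero) set) \<Rightarrow> (int \<Rightarrow> 'o \<Rightarrow> 'm) set" where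
  "graded_sum F = {a. (\<forall>n. a n \<in> F n) \<and> finite {n. a n \<noteq> (\<lambda>_. 0)}}"

definition center_deg ::
    "('k::field, 'o, 'm::ab_group_add) gr_cat \<Rightarrow> int \<Rightarrow> ('o \<Rightarrow> 'm) set" where
  "center_deg B i =
     {e \<in> families (gObj B) (\<lambda>x. gHom B i x x).
        \<forall>x\<in>gObj B. \<forall>y\<in>gObj B. \<forall>j. \<forall>f\<in>gHom B j x y.
          gComp B x x y j i f (e x) = gsmul B ((- 1) powi (i * j)) (gComp B x y y i j (e y) f)}"

definition natural_deg ::
    "('k::field, 'o, 'm::ab_group_add) lin_cat \<Rightarrow> ('o, 'm) endofun \<Rightarrow> int \<Rightarrow> ('o \<Rightarrow> 'm) set" where
  "natural_deg A S n =
     {e \<in> families (Obj A) (\<lambda>x. Hom A x (shift_obj A S n x)).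
        (\<forall>x\<in>Obj A. \<forall>y\<in>Obj A. \<forall>f\<in>Hom A x y.
          Comp A x (shift_obj A S n x) (shift_obj A S n y) (shift_mor A S n x y f) (e x)
          = Comp A x y (shift_obj A S n y) (e y) f) \<and>
        (\<forall>x\<in>Obj A.
          e (omap S x) = smul A ((- 1) powi n) (mmap S x (shift_obj A S n x) (e x)))}"

definition graded_center ::
    "('k::field, 'o, 'm::ab_group_add) lin_cat \<Rightarrow> ('o, 'm) endofun \<Rightarrow> (int \<Rightarrow> 'o \<Rightarrow> 'm) set" where
  "graded_center A S = graded_sum (natural_deg A S)"

text \<open>
  An element of the direct sum of the \<open>gHom B n x x\<close> over all \<open>x\<close> and \<open>n\<close> is a finitely supported
  function on pairs \<open>(x, n)\<close>.
\<close>

definition gEnd :: "('k, 'o, 'm::ab_group_add) gr_cat \<Rightarrow> ('o \<times> int \<Rightarrow>\<^sub>0 'm) set" where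
  "gEnd B = {u. \<forall>x n.
     if x \<in> gObj B then Poly_Mapping.lookup u (x, n) \<in> gHom B n x x
     else Poly_Mapping.lookup u (x, n) = 0}"

definition homogeneous :: "int \<Rightarrow> ('o \<times> int \<Rightarrow>\<^sub>0 'm::zero) \<Rightarrow> bool" where
  "homogeneous n u \<longleftrightarrow> (\<forall>(x, m)\<in>Poly_Mapping.keys u. m = n)"

definition component :: "int \<Rightarrow> ('o \<times> int \<Rightarrow>\<^sub>0 'm::ab_group_add) \<Rightarrow> ('o \<times> int \<Rightarrow>\<^sub>0 'm)" where
  "component n u = (\<Sum>(x, m)\<in>{k \<in> Poly_Mapping.keys u. snd k = n}.
     Poly_Mapping.single (x, m) (Poly_Mapping.lookup u (x, m)))"

definition gEnd_mult ::
    "('k, 'o, 'm::ab_group_add) gr_cat \<Rightarrow> ('o \<times> int \<Rightarrow>\<^sub>0 'm) \<Rightarrow> ('o \<times> int \<Rightarrow>\<^sub>0 'm) \<Rightarrow> ('o \<times> int \<Rightarrow>\<^sub>0 'm)" where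
  "gEnd_mult B u v =
     (\<Sum>(x, m)\<in>Poly_Mapping.keys u. \<Sum>(y, n)\<in>Poly_Mapping.keys v.
        if x = y
        then Poly_Mapping.single (x, m + n)
               (gComp B x x x m n (Poly_Mapping.lookup u (x, m)) (Poly_Mapping.lookup v (x, n)))
        else 0)"

definition commutators ::
    "('k::field, 'o, 'm::ab_group_add) gr_cat \<Rightarrow> ('o \<times> int \<Rightarrow>\<^sub>0 'm) set" where
  "commutators B =
     module.span (\<lambda>c. Poly_Mapping.map (gsmul B c))
       {Poly_Mapping.single (x, i + j) (gComp B x y x j i f u)
        - Poly_Mapping.single (y, i + j)
            (gsmul B ((- 1) powi (i * j)) (gComp B y x y i j u f)) | x y i j u f.
        x \<in> gObj B \<and> y \<in> gObj B \<and> u \<in> gHom B i x y \<and> f \<in> gHom B j y x}"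

definition ab_rel ::
    "('k::field, 'o, 'm::ab_group_add) gr_cat \<Rightarrow> (('o \<times> int \<Rightarrow>\<^sub>0 'm) \<times> ('o \<times> int \<Rightarrow>\<^sub>0 'm)) set" where
  "ab_rel B = {(u, v). u \<in> gEnd B \<and> v \<in> gEnd B \<and> u - v \<in> commutators B}"

abbreviation ab_class ::
    "('k::field, 'o, 'm::ab_group_add) gr_cat \<Rightarrow> ('o \<times> int \<Rightarrow>\<^sub>0 'm) \<Rightarrow> ('o \<times> int \<Rightarrow>\<^sub>0 'm) set" where
  "ab_class B u \<equiv> ab_rel B `` {u}"

definition abelianization ::
    "('k::field, 'o, 'm::ab_group_add) gr_cat \<Rightarrow> ('o \<times> int \<Rightarrow>\<^sub>0 'm) set set" where
  "abelianization B = gEnd B // ab_rel B"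

definition abelianization_deg ::
    "('k::field, 'o, 'm::ab_group_add) gr_cat \<Rightarrow> int \<Rightarrow> ('o \<times> int \<Rightarrow>\<^sub>0 'm) set set" where
  "abelianization_deg B n = {ab_class B u | u. u \<in> gEnd B \<and> homogeneous n u}"

text \<open>The map on classes induced by a map on representatives.  It is used only for
  maps that respect \<^const>\<open>ab_rel\<close>, where all the classes in the union coincide.\<close>

definition ab_induced ::
    "('k::field, 'o, 'm::ab_group_add) gr_cat \<Rightarrow> (('o \<times> int \<Rightarrow>\<^sub>0 'm) \<Rightarrow> ('o \<times> int \<Rightarrow>\<^sub>0 'm))
      \<Rightarrow> ('o \<times> int \<Rightarrow>\<^sub>0 'm) set \<Rightarrow> ('o \<times> int \<Rightarrow>\<^sub>0 'm) set" where
  "ab_induced B F X = (\<Union>u\<in>X. ab_class B (F u))"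

text \<open>
  The powers in \<open>xi_rep\<close> are written without a unit: \<^const>\<open>gEnd\<close> has none if there are infinitely
  many objects.
\<close>

definition xi_rep ::
    "('k, 'o, 'm::ab_group_add) gr_cat \<Rightarrow> nat \<Rightarrow> ('o \<times> int \<Rightarrow>\<^sub>0 'm) \<Rightarrow> ('o \<times> int \<Rightarrow>\<^sub>0 'm)" where
  "xi_rep B p u =
     (\<Sum>n\<in>snd ` Poly_Mapping.keys u. (gEnd_mult B (component n u) ^^ (p - 1)) (component n u))"

definition xi ::
    "('k::field, 'o, 'm::ab_group_add) gr_cat \<Rightarrow> nat \<Rightarrow> ('o \<times> int \<Rightarrow>\<^sub>0 'm) set \<Rightarrow> ('o \<times> int \<Rightarrow>\<^sub>0 'm) set" where
  "xi B p = ab_induced B (xi_rep B p)"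

definition T_space ::
    "('k::field, 'o, 'm::ab_group_add) gr_cat \<Rightarrow> nat \<Rightarrow> nat \<Rightarrow> ('o \<times> int \<Rightarrow>\<^sub>0 'm) set set" where
  "T_space B p r = {X \<in> abelianization B. (xi B p ^^ r) X = ab_class B 0}"

definition left_act ::
    "('k, 'o, 'm::ab_group_add) gr_cat \<Rightarrow> int \<Rightarrow> ('o \<Rightarrow> 'm) \<Rightarrow> ('o \<times> int \<Rightarrow>\<^sub>0 'm) \<Rightarrow> ('o \<times> int \<Rightarrow>\<^sub>0 'm)" where
  "left_act B i e u =
     (\<Sum>(x, j)\<in>Poly_Mapping.keys u. Poly_Mapping.single (x, i + j)
        (gComp B x x x i j (e x) (Poly_Mapping.lookup u (x, j))))"

definition right_act ::
    "('k, 'o, 'm::ab_group_add) gr_cat \<Rightarrow> int \<Rightarrow> ('o \<Rightarrow> 'm) \<Rightarrow> ('o \<times> int \<Rightarrow>\<^sub>0 'm) \<Rightarrow> ('o \<times> int \<Rightarrow>\<^sub>0 'm)" where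
  "right_act B i e u =
     (\<Sum>(x, j)\<in>Poly_Mapping.keys u. Poly_Mapping.single (x, i + j)
        (gComp B x x x j i (Poly_Mapping.lookup u (x, j)) (e x)))"

definition K_deg ::
    "('k::field, 'o, 'm::ab_group_add) gr_cat \<Rightarrow> nat \<Rightarrow> nat \<Rightarrow> int \<Rightarrow> int \<Rightarrow> ('o \<Rightarrow> 'm) set" where
  "K_deg B p r s n =
     {e \<in> center_deg B n. \<forall>X \<in> T_space B p r \<inter> abelianization_deg B (s - n).
        ab_induced B (left_act B n e) X = ab_class B 0 \<and>
        ab_induced B (right_act B n e) X = ab_class B 0}"

definition K_rs ::
    "('k::field, 'o, 'm::ab_group_add) gr_cat \<Rightarrow> nat \<Rightarrow> nat \<Rightarrow> int \<Rightarrow> (int \<Rightarrow> 'o \<Rightarrow> 'm) set" where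
  "K_rs B p r s = graded_sum (K_deg B p r s)"

definition K_r ::
    "('k::field, 'o, 'm::ab_group_add) gr_cat \<Rightarrow> nat \<Rightarrow> nat \<Rightarrow> (int \<Rightarrow> 'o \<Rightarrow> 'm) set" where
  "K_r B p r = (\<Inter>s. K_rs B p r s)"

definition tr_rep :: "int \<Rightarrow> ('o \<Rightarrow> 'm \<Rightarrow> 'k) \<Rightarrow> ('o \<times> int \<Rightarrow>\<^sub>0 'm::zero) \<Rightarrow> 'k::field" where
  "tr_rep d tr u = (\<Sum>(x, n)\<in>Poly_Mapping.keys u. if n = d then tr x (Poly_Mapping.lookup u (x, n)) else 0)"

definition tr_ab :: "int \<Rightarrow> ('o \<Rightarrow> 'm \<Rightarrow> 'k) \<Rightarrow> ('o \<times> int \<Rightarrow>\<^sub>0 'm::zero) set \<Rightarrow> 'k::field" where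
  "tr_ab d tr X = the_elem (tr_rep d tr ` X)"

definition pairing ::
    "('k::field, 'o, 'm::ab_group_add) lin_cat \<Rightarrow> ('o, 'm) endofun \<Rightarrow> int \<Rightarrow> ('o \<Rightarrow> 'm \<Rightarrow> 'k)
      \<Rightarrow> (int \<Rightarrow> 'o \<Rightarrow> 'm) \<Rightarrow> ('o \<times> int \<Rightarrow>\<^sub>0 'm) set \<Rightarrow> 'k" where
  "pairing A S d tr h X =
     (\<Sum>i | h i \<noteq> (\<lambda>_. 0).
        tr_ab d tr (ab_induced (orbit_category A S) (right_act (orbit_category A S) i (h i)) X))"

definition perp ::
    "('k::field, 'o, 'm::ab_group_add) lin_cat \<Rightarrow> ('o, 'm) endofun \<Rightarrow> int \<Rightarrow> ('o \<Rightarrow> 'm \<Rightarrow> 'k)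
      \<Rightarrow> ('o \<times> int \<Rightarrow>\<^sub>0 'm) set set \<Rightarrow> (int \<Rightarrow> 'o \<Rightarrow> 'm) set" where
  "perp A S d tr U = {h \<in> graded_center A S. \<forall>X\<in>U. pairing A S d tr h X = 0}"

end

theory Submission
  imports Defs
begin

text \<open>
  Modulo graded commutators, \<open>(u + v)^p\<close> equals \<open>u^p + v^p\<close> in characteristic \<open>p\<close>: the mixed words
  of length \<open>p\<close> are permuted by rotation, and rotation has sign \<open>+1\<close>.  Hence \<open>\<xi>\<close> is well defined
  on the abelianization, and as \<open>(u \<circ> \<eta>)^p = \<plusminus> u^p \<circ> \<eta>^p\<close> for \<open>\<eta>\<close> in the center, \<open>T_r\<close> is a graded
  submodule over the center.

  A functional on the abelianization is represented, object by object, by the nondegenerate trace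
  pairing, and its vanishing on commutators says that the representing family is central.  So an
  element \<open>a\<close> of the abelianization is zero as soon as \<open>tr (a \<zeta>) = 0\<close> for all central \<open>\<zeta>\<close>.  If
  \<open>tr (u \<eta>) = 0\<close> for all \<open>u \<in> T_r\<close>, then \<open>tr ((u \<eta>) \<zeta>) = \<plusminus> tr ((u \<zeta>) \<eta>) = 0\<close> because \<open>u \<zeta> \<in> T_r\<close>,
  so \<open>u \<eta> = 0\<close> in every degree.
\<close>

subsection \<open>Linear algebra and words\<close>

text \<open>Computation in the quotient is replaced by evaluation: \<open>commutators B\<close> is
  the common kernel of the linear functionals with the graded trace symmetry, so congruences modulo
  commutators are checked in the field. The same functionals are later represented by central
  elements.

  When \<open>p\<close>-th powers are rotated or commuted, the sign exponents differ from the wanted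
  ones by multiples of \<open>p - 1\<close>. This number is even unless \<open>p = 2\<close>, and
  then \<open>- 1 = 1\<close>.

  Finite dimension is available only for single Hom spaces, and with infinitely many objects the
  abelianization may be infinite dimensional in one degree. This is why functionals are represented
  object by object; the resulting family needs no finite support because the center lies in a
  product.

  The trace sees only degree \<open>d\<close>, while \<open>K_rs\<close> for a general
  \<open>s\<close> concerns degree \<open>s\<close>; the auxiliary central factor has degree
  \<open>d - s\<close> and moves the test to degree \<open>d\<close>. Since \<open>\<xi>\<close>
  multiplies degrees by \<open>p\<close>, its kernels are graded, and the pairing can be tested one
  degree at a time.\<close>

lemma lookup_sum_single_inj:
  assumes "finite K" "inj g" "k \<in> K"
  shows "Poly_Mapping.lookup (\<Sum>k\<in>K. Poly_Mapping.single (g k) (v k)) (g k) = v k"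
proof -
  have "Poly_Mapping.lookup (\<Sum>k\<in>K. Poly_Mapping.single (g k) (v k)) (g k)
      = (\<Sum>l\<in>K. if l = k then v l else 0)"
    unfolding lookup_sum lookup_single
    by (rule sum.cong) (use \<open>inj g\<close> in \<open>auto simp: when_def inj_eq\<close>)
  then show ?thesis using assms by simp
qed

lemma lookup_sum_single_notin:
  assumes "q \<notin> g ` K"
  shows "Poly_Mapping.lookup (\<Sum>k\<in>K. Poly_Mapping.single (g k) (v k)) q = 0"
  unfolding lookup_sum lookup_single
  by (rule sum.neutral) (use assms in \<open>auto simp: when_def\<close>)

text \<open>Adding \<open>u\<close> to a basis of \<open>U\<close> keeps it independent, so the
  values 0 on the basis and 1 at \<open>u\<close> extend to a linear functional on the whole space,
  whatever its dimension.\<close>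

lemma (in vector_space) separating_functional:
  assumes "subspace U" "u \<notin> U"
  shows "\<exists>\<phi>. Vector_Spaces.linear scale (*) \<phi> \<and> (\<forall>v\<in>U. \<phi> v = 0) \<and> \<phi> u = 1"
proof -
  interpret F: vector_space "(*) :: 'a \<Rightarrow> 'a \<Rightarrow> 'a"
    by unfold_locales (auto simp: algebra_simps)
  interpret P: vector_space_pair scale "(*) :: 'a \<Rightarrow> 'a \<Rightarrow> 'a" ..
  obtain X where X: "X \<subseteq> U" "independent X" "U \<subseteq> span X"
    using basis_exists[of U] by metis
  have "span X = U" using X assms(1) by (metis span_eq_iff span_mono subset_antisym)
  with assms have "independent (insert u X)" and "u \<notin> X"
    using X independent_insertI[of u X] by auto
  then obtain \<phi> where \<phi>: "Vector_Spaces.linear scale (*) \<phi>"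
      and val: "\<forall>x\<in>insert u X. \<phi> x = (if x = u then 1 else 0)"
    using P.linear_independent_extend[of _ "\<lambda>x. if x = u then 1 else 0"] by blast
  interpret \<phi>: Vector_Spaces.linear scale "(*) :: 'a \<Rightarrow> 'a \<Rightarrow> 'a" \<phi> by (rule \<phi>)
  have "\<phi> v = 0" if "v \<in> span X" for v
    using that by (rule span_induct) (use val \<open>u \<notin> X\<close> in \<open>auto simp: subspace_def \<phi>.zero \<phi>.add \<phi>.scale\<close>)
  with val \<phi> \<open>span X = U\<close> show ?thesis by auto
qed

text \<open>Induction on \<open>X\<close>: an element of \<open>W\<close> that kills
  \<open>X\<close> but not the new \<open>v\<close> corrects the value at \<open>v\<close> without
  disturbing the others. If there were none, subtracting from \<open>v\<close> its expansion along a
  family dual to \<open>X\<close> would leave a vector orthogonal to \<open>W\<close>, and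
  \<open>v\<close> would lie in \<open>span X\<close>. Linearity is asked on \<open>V\<close> and
  \<open>W\<close> only, as composition is linear only on Hom spaces.\<close>

lemma (in vector_space) pairing_interpolation:
  fixes b :: "'b \<Rightarrow> 'b \<Rightarrow> 'a"
  assumes V: "subspace V" and W: "subspace W"
    and left: "\<And>w. w \<in> W \<Longrightarrow> linear_between scale (*) V (\<lambda>v. b v w)"
    and right: "\<And>v. v \<in> V \<Longrightarrow> linear_between scale (*) W (b v)"
    and nondeg: "\<And>v. \<lbrakk>v \<in> V; \<And>w. w \<in> W \<Longrightarrow> b v w = 0\<rbrakk> \<Longrightarrow> v = 0"
    and "finite X" "independent X" "X \<subseteq> V"
  shows "\<exists>w\<in>W. \<forall>v\<in>X. b v w = c v"
  using \<open>finite X\<close> \<open>independent X\<close> \<open>X \<subseteq> V\<close>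
proof (induction X arbitrary: c rule: finite_induct)
  case empty
  then show ?case using subspace_0[OF W] by blast
next
  case (insert v X)
  then have X: "independent X" "X \<subseteq> V" "v \<in> V" "v \<notin> span X"
    by (auto simp: independent_insert)
  have sumL: "b (\<Sum>x\<in>Y. scale (a x) x) w = (\<Sum>x\<in>Y. a x * b x w)"
    if "finite Y" "Y \<subseteq> V" "w \<in> W" for Y a w
    using that
  proof (induction Y rule: finite_induct)
    case empty
    have "b (scale 0 0) w = 0 * b 0 w"
      using left[OF \<open>w \<in> W\<close>] subspace_0[OF V] unfolding linear_between_def by blast
    then show ?case by simp
  next
    case (insert y Y)
    then have "scale (a y) y \<in> V" "(\<Sum>x\<in>Y. scale (a x) x) \<in> V" "y \<in> V"
      by (auto intro!: subspace_sum[OF V] subspace_scale[OF V])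
    with insert left[OF \<open>w \<in> W\<close>] show ?case by (simp add: linear_between_def)
  qed
  have sumR: "b x (\<Sum>y\<in>Y. scale (a y) (f y)) = (\<Sum>y\<in>Y. a y * b x (f y))"
    if "finite Y" "f ` Y \<subseteq> W" "x \<in> V" for Y a x and f :: "'b \<Rightarrow> 'b"
    using that
  proof (induction Y rule: finite_induct)
    case empty
    have "b x (scale 0 0) = 0 * b x 0"
      using right[OF \<open>x \<in> V\<close>] subspace_0[OF W] unfolding linear_between_def by blast
    then show ?case by simp
  next
    case (insert y Y)
    then have "scale (a y) (f y) \<in> W" "(\<Sum>x\<in>Y. scale (a x) (f x)) \<in> W" "f y \<in> W"
      by (auto intro!: subspace_sum[OF W] subspace_scale[OF W])
    with insert right[OF \<open>x \<in> V\<close>] show ?case by (simp add: linear_between_def)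
  qed
  \<comment> \<open>The induction hypothesis for indicator values yields a family \<open>D\<close>
    dual to \<open>X\<close>.\<close>
  have "\<forall>x\<in>X. \<exists>w\<in>W. \<forall>y\<in>X. b y w = (if y = x then 1 else 0)"
  proof
    fix x assume "x \<in> X"
    show "\<exists>w\<in>W. \<forall>y\<in>X. b y w = (if y = x then 1 else 0)" by (rule insert.IH[OF X(1,2)])
  qed
  then obtain D where D: "\<And>x. x \<in> X \<Longrightarrow> D x \<in> W"
      "\<And>x y. x \<in> X \<Longrightarrow> y \<in> X \<Longrightarrow> b y (D x) = (if y = x then 1 else 0)"
    by metis
  have "\<exists>w\<in>W. (\<forall>y\<in>X. b y w = 0) \<and> b v w \<noteq> 0"
  proof (rule ccontr)
    assume neg: "\<not> ?thesis"
    \<comment> \<open>\<open>v'\<close> is \<open>v\<close> made orthogonal to every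
      \<open>D x\<close>.\<close>
    define v' where "v' = v - (\<Sum>x\<in>X. scale (b v (D x)) x)"
    have mem: "(\<Sum>x\<in>X. scale (b v (D x)) x) \<in> V" "v' \<in> V"
      using X unfolding v'_def by (auto intro!: subspace_diff[OF V] subspace_sum[OF V] subspace_scale[OF V])
    have "b v' w = 0" if w: "w \<in> W" for w
    proof -
      \<comment> \<open>\<open>w'\<close> is \<open>w\<close> made orthogonal to \<open>X\<close>,
        so \<open>neg\<close> gives \<open>b v w' = 0\<close>. The two expansions of
        \<open>b v w\<close> then have the same sum, which leaves \<open>b v' w = 0\<close>.\<close>
      define w' where "w' = w - (\<Sum>x\<in>X. scale (b x w) (D x))"
      have sW: "(\<Sum>x\<in>X. scale (b x w) (D x)) \<in> W" "w' \<in> W"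
        using D(1) w unfolding w'_def by (auto intro!: subspace_diff[OF W] subspace_sum[OF W] subspace_scale[OF W])
      have eq: "b y w = b y w' + (\<Sum>x\<in>X. b x w * b y (D x))" if "y \<in> V" for y
      proof -
        have "b y w = b y (w' + (\<Sum>x\<in>X. scale (b x w) (D x)))" by (simp add: w'_def)
        also have "\<dots> = b y w' + b y (\<Sum>x\<in>X. scale (b x w) (D x))"
          using right[OF that] sW unfolding linear_between_def by blast
        finally show ?thesis using sumR[of X D y] that insert(1) D(1) by (simp add: image_subset_iff)
      qed
      have "b y w' = 0" if "y \<in> X" for y
      proof -
        have "(\<Sum>x\<in>X. b x w * b y (D x)) = (\<Sum>x\<in>X. if y = x then b x w else 0)"
          by (rule sum.cong) (use D(2) that in auto)
        with eq[of y] that X(2) insert(1) show ?thesis by auto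
      qed
      then have "b v w' = 0" using neg sW by blast
      then have "b v w = (\<Sum>x\<in>X. b x w * b v (D x))" using eq[OF X(3)] by simp
      moreover have "b v w = b v' w + (\<Sum>x\<in>X. b v (D x) * b x w)"
      proof -
        have "b v w = b (v' + (\<Sum>x\<in>X. scale (b v (D x)) x)) w" by (simp add: v'_def)
        also have "\<dots> = b v' w + b (\<Sum>x\<in>X. scale (b v (D x)) x) w"
          using left[OF w] mem unfolding linear_between_def by blast
        finally show ?thesis using sumL[of X w] X(2) insert(1) w by simp
      qed
      ultimately show ?thesis by (simp add: mult.commute)
    qed
    then have "v' = 0" using nondeg mem(2) by blast
    then have "v = (\<Sum>x\<in>X. scale (b v (D x)) x)" by (simp add: v'_def)
    then have "v \<in> span X" by (metis (no_types, lifting) span_sum span_scale span_base)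
    then show False using X(4) by simp
  qed
  then obtain w0 where w0: "w0 \<in> W" "\<And>y. y \<in> X \<Longrightarrow> b y w0 = 0" "b v w0 \<noteq> 0" by blast
  obtain w1 where w1: "w1 \<in> W" "\<forall>y\<in>X. b y w1 = c y" using insert.IH X by blast
  define a where "a = (c v - b v w1) / b v w0"
  have "scale a w0 \<in> W" using w0 subspace_scale[OF W] by blast
  then have b2: "b y (w1 + scale a w0) = b y w1 + a * b y w0" if "y \<in> V" for y
    using right[OF that] w0(1) w1(1) by (simp add: linear_between_def)
  have "w1 + scale a w0 \<in> W" using \<open>scale a w0 \<in> W\<close> w1 subspace_add[OF W] by blast
  moreover have "\<forall>y\<in>insert v X. b y (w1 + scale a w0) = c y"
    using b2 w0 w1 X by (auto simp: a_def)
  ultimately show ?case by blast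
qed

text \<open>Surjectivity of the map from \<open>W\<close> to the dual of a finite-dimensional
  \<open>V\<close>: the values of \<open>\<phi>\<close> on a basis are interpolated, and two linear
  maps that agree on a basis agree on its span.\<close>

lemma (in vector_space) pairing_represents:
  fixes b :: "'b \<Rightarrow> 'b \<Rightarrow> 'a"
  assumes V: "subspace V" and W: "subspace W"
    and left: "\<And>w. w \<in> W \<Longrightarrow> linear_between scale (*) V (\<lambda>v. b v w)"
    and right: "\<And>v. v \<in> V \<Longrightarrow> linear_between scale (*) W (b v)"
    and nondeg: "\<And>v. \<lbrakk>v \<in> V; \<And>w. w \<in> W \<Longrightarrow> b v w = 0\<rbrakk> \<Longrightarrow> v = 0"
    and "finite X" "V = span X"
    and \<phi>: "linear_between scale (*) V \<phi>"
  shows "\<exists>w\<in>W. \<forall>v\<in>V. \<phi> v = b v w"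
proof -
  obtain Y where Y: "Y \<subseteq> V" "independent Y" "V \<subseteq> span Y"
    using basis_exists[of V] by metis
  have "finite Y" using independent_span_bound[OF \<open>finite X\<close> Y(2)] Y(1) \<open>V = span X\<close> by simp
  then obtain w where w: "w \<in> W" "\<forall>v\<in>Y. b v w = \<phi> v"
    using pairing_interpolation[OF V W left right nondeg _ Y(2,1)] by metis
  have "subspace {v \<in> V. \<phi> v = b v w}"
  proof (rule subspaceI)
    have "\<phi> (scale 0 0) = 0 * \<phi> 0" "b (scale 0 0) w = 0 * b 0 w"
      using left[OF w(1)] \<phi> subspace_0[OF V] unfolding linear_between_def by blast+
    then show "0 \<in> {v \<in> V. \<phi> v = b v w}" using subspace_0[OF V] by simp
  qed (use left[OF w(1)] \<phi> V in \<open>auto simp: linear_between_def subspace_add subspace_scale\<close>)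
  then have "span Y \<subseteq> {v \<in> V. \<phi> v = b v w}"
    using Y(1) w(2) by (intro span_minimal) auto
  with Y w(1) show ?thesis by blast
qed

text \<open>Counting the letters of the words with exactly \<open>k\<close> letters \<open>True\<close> position by position shows
  that \<open>k\<close> times the sum over these words is a multiple of \<open>p\<close>.\<close>
lemma sum_rotation_invariant_words:
  fixes f :: "bool list \<Rightarrow> 'k::field"
  assumes p: "CHAR('k) = p" "p > 0"
    and rot: "\<And>w. length w = p \<Longrightarrow> f (rotate1 w) = f w"
  shows "(\<Sum>w | length w = p. f w) = f (replicate p True) + f (replicate p False)"
proof -
  have fin: "finite {w :: bool list. length w = p}"
    using finite_lists_length_eq[of "UNIV :: bool set" p] by simp
  define W where "W k = {w :: bool list. length w = p \<and> count_list w True = k}" for k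
  have finW: "finite (W k)" for k using fin by (rule rev_finite_subset) (auto simp: W_def)
  have rotn: "f (rotate n w) = f w" if "length w = p" for n w
    by (induction n) (use that rot in auto)
  have zero: "(\<Sum>w\<in>W k. f w) = 0" if "k < p" "k > 0" for k
  proof -
    \<comment> \<open>Rotation by \<open>i\<close> permutes \<open>W k\<close>, carries position
      \<open>i\<close> to position 0 and leaves \<open>f\<close> unchanged, so all positions
      contribute equally.\<close>
    have shift: "(\<Sum>w\<in>W k. if w ! i then f w else 0) = (\<Sum>w\<in>W k. if w ! 0 then f w else 0)"
      if i: "i < p" for i
    proof (rule sum.reindex_bij_witness[where i = "rotate (p - i)" and j = "rotate i"])
      show "rotate (p - i) (rotate i w) = w" "rotate i (rotate (p - i) w) = w" if "w \<in> W k" for w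
        using that i by (simp_all add: rotate_rotate W_def)
      have cnt: "count_list (rotate n w) True = count_list w True" for n and w :: "bool list"
      proof (induction n)
        case (Suc n)
        have "count_list (rotate1 v) True = count_list v True" for v :: "bool list"
          by (cases v) auto
        with Suc show ?case by simp
      qed simp
      then show "rotate i w \<in> W k" "rotate (p - i) w \<in> W k" if "w \<in> W k" for w
        using that by (simp_all add: W_def)
      show "(if rotate i w ! 0 then f (rotate i w) else 0) = (if w ! i then f w else 0)"
        if "w \<in> W k" for w
        using that i p(2) by (simp add: W_def rotn nth_rotate)
    qed
    have "of_nat k * (\<Sum>w\<in>W k. f w) = (\<Sum>w\<in>W k. \<Sum>i<p. if w ! i then f w else 0)"
    proof (unfold sum_distrib_left, rule sum.cong)
      fix w assume w: "w \<in> W k"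
      have "k = card {i. i < p \<and> w ! i}"
        using w by (auto simp: W_def count_list_eq_length_filter length_filter_conv_card intro: arg_cong[where f = card])
      moreover have "(\<Sum>i<p. if w ! i then f w else 0) = of_nat (card {i. i < p \<and> w ! i}) * f w"
        by (simp add: sum.If_cases Int_def)
      ultimately show "of_nat k * f w = (\<Sum>i<p. if w ! i then f w else 0)" by simp
    qed simp
    also have "\<dots> = (\<Sum>i<p. \<Sum>w\<in>W k. if w ! i then f w else 0)" by (rule sum.swap)
    also have "\<dots> = (\<Sum>i<p. \<Sum>w\<in>W k. if w ! 0 then f w else 0)"
      by (intro sum.cong refl shift) simp
    also have "\<dots> = of_nat p * (\<Sum>w\<in>W k. if w ! 0 then f w else 0)" by simp
    also have "\<dots> = 0" using p(1) of_nat_CHAR[where ?'a = 'k] by simp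
    finally have "of_nat k * (\<Sum>w\<in>W k. f w) = 0" .
    \<comment> \<open>As \<open>0 < k < p\<close>, the characteristic does not divide
      \<open>k\<close>, and \<open>k\<close> can be cancelled in the field.\<close>
    moreover have "of_nat k \<noteq> (0 :: 'k)"
      unfolding of_nat_eq_0_iff_char_dvd p(1) by (rule nat_dvd_not_less[OF that(2,1)])
    ultimately show ?thesis by simp
  qed
  have "(\<Sum>w | length w = p. f w) = (\<Sum>k\<le>p. \<Sum>w\<in>W k. f w)"
  proof (subst sum.group[symmetric, OF fin])
    show "(\<lambda>w. count_list w True) ` {w. length w = p} \<subseteq> {..p}"
      by (auto simp: count_le_length)
    show "(\<Sum>k\<le>p. \<Sum>w | w \<in> {w. length w = p} \<and> count_list w True = k. f w) = (\<Sum>k\<le>p. \<Sum>w\<in>W k. f w)"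
      by (simp add: W_def)
  qed simp
  also have "\<dots> = (\<Sum>k\<in>{0, p}. \<Sum>w\<in>W k. f w)"
    by (rule sum.mono_neutral_right) (use zero in \<open>auto simp: le_less\<close>)
  also have "\<dots> = (\<Sum>w\<in>W p. f w) + (\<Sum>w\<in>W 0. f w)" using p(2) by simp
  also have "W p = {replicate p True}"
  proof -
    have "w = replicate p True" if "count_list w True = length w" "length w = p" for w
    proof (rule replicate_eqI)
      fix t assume "t \<in> set w"
      then show "t = True"
        using that(1) length_filter_less[of t w "(=) True"] by (auto simp: count_list_eq_length_filter)
    qed (rule that(2))
    moreover have "count_list (replicate n True) True = n" for n by (induction n) auto
    ultimately show ?thesis by (auto simp: W_def)
  qed
  also have "W 0 = {replicate p False}"
  proof -
    have "w = replicate p False" if "count_list w True = 0" "length w = p" for w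
      using that by (auto simp: count_list_0_iff intro!: replicate_eqI)
    moreover have "count_list (replicate n False) True = 0" for n by (induction n) auto
    ultimately show ?thesis by (auto simp: W_def)
  qed
  finally show ?thesis by simp
qed

subsection \<open>Graded categories and trace functionals\<close>

text \<open>In characteristic 2 the sign is trivial and parity does not matter. Both cases share one
  hypothesis because \<open>p = 2\<close> produces exponents of different parity.\<close>

lemma powi_minus_one_cong:
  assumes "even (a - b) \<or> CHAR('k) = 2"
  shows "(- 1 :: 'k::field) powi a = (- 1) powi b"
proof (cases "CHAR('k) = 2")
  case True
  then have "- 1 = (1 :: 'k)" by (rule uminus_CHAR_2)
  then show ?thesis by (simp only: power_int_1_left)
next
  case False
  with assms have "even a \<longleftrightarrow> even b" by auto
  then show ?thesis by (simp add: power_int_minus_left)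
qed

lemma powi_minus_one_square: "(- 1 :: 'k::field) powi a * (- 1) powi a = 1"
  by (simp add: power_int_minus_left)

lemma sum_words_Suc:
  fixes F :: "bool list \<Rightarrow> 'a::comm_monoid_add"
  shows "(\<Sum>w | length w = Suc k. F w) = (\<Sum>w | length w = k. F (True # w)) + (\<Sum>w | length w = k. F (False # w))"
proof -
  have fin: "finite {w :: bool list. length w = k}"
    using finite_lists_length_eq[of "UNIV :: bool set" k] by simp
  have "{w :: bool list. length w = Suc k} = (#) True ` {w. length w = k} \<union> (#) False ` {w. length w = k}"
    by (auto simp: length_Suc_conv image_iff)
  moreover have "(\<Sum>w\<in>(#) True ` {w. length w = k} \<union> (#) False ` {w. length w = k}. F w)
      = (\<Sum>w\<in>(#) True ` {w. length w = k}. F w) + (\<Sum>w\<in>(#) False ` {w. length w = k}. F w)"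
    by (rule sum.union_disjoint) (use fin in auto)
  ultimately show ?thesis by (simp add: sum.reindex)
qed

text \<open>Isolates bilinear associative composition with additive degrees from the shift functors.
  Words, commutators and central actions are treated at this level; the orbit category becomes an
  instance at the end.\<close>

locale graded_semicategory =
  fixes B :: "('k::field, 'o, 'm::ab_group_add) gr_cat"
  assumes vector_space_gsmul: "vector_space (gsmul B)"
    and subspace_gHom: "\<lbrakk>x \<in> gObj B; y \<in> gObj B\<rbrakk> \<Longrightarrow> module.subspace (gsmul B) (gHom B n x y)"
    and gComp_in_gHom:
      "\<lbrakk>x \<in> gObj B; y \<in> gObj B; z \<in> gObj B; f \<in> gHom B n x y; g \<in> gHom B m y z\<rbrakk>
        \<Longrightarrow> gComp B x y z m n g f \<in> gHom B (m + n) x z"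
    and gComp_assoc:
      "\<lbrakk>w \<in> gObj B; x \<in> gObj B; y \<in> gObj B; z \<in> gObj B;
        f \<in> gHom B n w x; g \<in> gHom B m x y; h \<in> gHom B l y z\<rbrakk>
        \<Longrightarrow> gComp B w x z (l + m) n (gComp B x y z l m h g) f
          = gComp B w y z l (m + n) h (gComp B w x y m n g f)"
    and gComp_linear_left:
      "\<lbrakk>x \<in> gObj B; y \<in> gObj B; z \<in> gObj B; f \<in> gHom B n x y\<rbrakk>
        \<Longrightarrow> linear_between (gsmul B) (gsmul B) (gHom B m y z) (\<lambda>g. gComp B x y z m n g f)"
    and gComp_linear_right:
      "\<lbrakk>x \<in> gObj B; y \<in> gObj B; z \<in> gObj B; g \<in> gHom B m y z\<rbrakk>
        \<Longrightarrow> linear_between (gsmul B) (gsmul B) (gHom B n x y) (\<lambda>f. gComp B x y z m n g f)"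
begin

abbreviation "C \<equiv> gComp B"
abbreviation "H \<equiv> gHom B"
abbreviation "Ob \<equiv> gObj B"
abbreviation "pscale c \<equiv> Poly_Mapping.map (gsmul B c)"

sublocale V: vector_space "gsmul B" by (rule vector_space_gsmul)

lemma lookup_pscale [simp]: "Poly_Mapping.lookup (pscale c u) k = gsmul B c (Poly_Mapping.lookup u k)"
  by (auto simp: Poly_Mapping.map.rep_eq when_def)

sublocale P: vector_space pscale
  by unfold_locales
    (auto intro!: poly_mapping_eqI simp: lookup_add V.scale_right_distrib V.scale_left_distrib)

lemma gHom_0: "\<lbrakk>x \<in> Ob; y \<in> Ob\<rbrakk> \<Longrightarrow> 0 \<in> H n x y"
  by (rule V.subspace_0[OF subspace_gHom])

lemma gHom_add: "\<lbrakk>x \<in> Ob; y \<in> Ob; f \<in> H n x y; g \<in> H n x y\<rbrakk> \<Longrightarrow> f + g \<in> H n x y"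
  by (rule V.subspace_add[OF subspace_gHom])

lemma gHom_diff: "\<lbrakk>x \<in> Ob; y \<in> Ob; f \<in> H n x y; g \<in> H n x y\<rbrakk> \<Longrightarrow> f - g \<in> H n x y"
  by (rule V.subspace_diff[OF subspace_gHom])

lemma gHom_scale: "\<lbrakk>x \<in> Ob; y \<in> Ob; f \<in> H n x y\<rbrakk> \<Longrightarrow> gsmul B c f \<in> H n x y"
  by (rule V.subspace_scale[OF subspace_gHom])

lemma gHom_sum:
  "\<lbrakk>x \<in> Ob; y \<in> Ob; \<And>i. i \<in> I \<Longrightarrow> f i \<in> H n x y\<rbrakk> \<Longrightarrow> (\<Sum>i\<in>I. f i) \<in> H n x y"
  by (rule V.subspace_sum[OF subspace_gHom])

lemma gComp_in:
  "\<lbrakk>x \<in> Ob; y \<in> Ob; z \<in> Ob; g \<in> H m y z; f \<in> H n x y; k = m + n\<rbrakk> \<Longrightarrow> C x y z m n g f \<in> H k x z"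
  using gComp_in_gHom by simp

text \<open>Degrees are explicit arguments of \<open>gComp\<close>, so the sums of integers on the
  two sides of associativity rarely match syntactically. The equations for \<open>lm\<close> and
  \<open>mn\<close> turn this into arithmetic side goals.\<close>

lemma gComp_assoc':
  assumes "w \<in> Ob" "x \<in> Ob" "y \<in> Ob" "z \<in> Ob" "h \<in> H l y z" "g \<in> H m x y" "f \<in> H n w x"
    "lm = l + m" "mn = m + n"
  shows "C w x z lm n (C x y z l m h g) f = C w y z l mn h (C w x y m n g f)"
  using gComp_assoc[of w x y z f n g m h l] assms by simp

lemma gComp_add_left:
  "\<lbrakk>x \<in> Ob; y \<in> Ob; z \<in> Ob; g \<in> H m y z; g' \<in> H m y z; f \<in> H n x y\<rbrakk>
    \<Longrightarrow> C x y z m n (g + g') f = C x y z m n g f + C x y z m n g' f"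
  using gComp_linear_left[of x y z f n m] by (simp add: linear_between_def)

lemma gComp_scale_left:
  "\<lbrakk>x \<in> Ob; y \<in> Ob; z \<in> Ob; g \<in> H m y z; f \<in> H n x y\<rbrakk>
    \<Longrightarrow> C x y z m n (gsmul B c g) f = gsmul B c (C x y z m n g f)"
  using gComp_linear_left[of x y z f n m] by (simp add: linear_between_def)

lemma gComp_add_right:
  "\<lbrakk>x \<in> Ob; y \<in> Ob; z \<in> Ob; g \<in> H m y z; f \<in> H n x y; f' \<in> H n x y\<rbrakk>
    \<Longrightarrow> C x y z m n g (f + f') = C x y z m n g f + C x y z m n g f'"
  using gComp_linear_right[of x y z g m n] by (simp add: linear_between_def)

lemma gComp_scale_right:
  "\<lbrakk>x \<in> Ob; y \<in> Ob; z \<in> Ob; g \<in> H m y z; f \<in> H n x y\<rbrakk>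
    \<Longrightarrow> C x y z m n g (gsmul B c f) = gsmul B c (C x y z m n g f)"
  using gComp_linear_right[of x y z g m n] by (simp add: linear_between_def)

lemma gComp_0_left [simp]:
  "\<lbrakk>x \<in> Ob; y \<in> Ob; z \<in> Ob; f \<in> H n x y\<rbrakk> \<Longrightarrow> C x y z m n 0 f = 0"
  using gComp_scale_left[of x y z 0 m f n 0] gHom_0[of y z m] by simp

lemma gComp_0_right [simp]:
  "\<lbrakk>x \<in> Ob; y \<in> Ob; z \<in> Ob; g \<in> H m y z\<rbrakk> \<Longrightarrow> C x y z m n g 0 = 0"
  using gComp_scale_right[of x y z g m 0 n 0] gHom_0[of x y n] by simp

lemma gComp_sum_right:
  assumes "x \<in> Ob" "y \<in> Ob" "z \<in> Ob" "g \<in> H m y z" "finite I" "\<And>i. i \<in> I \<Longrightarrow> f i \<in> H n x y"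
  shows "C x y z m n g (\<Sum>i\<in>I. f i) = (\<Sum>i\<in>I. C x y z m n g (f i))"
  using assms(5,6)
  by (induction I rule: finite_induct) (use assms(1-4) in \<open>simp_all add: gComp_add_right gHom_sum\<close>)

section \<open>Endomorphisms, graded commutators and classes modulo them\<close>

lemma lookup_gEnd:
  "u \<in> gEnd B \<Longrightarrow> x \<in> Ob \<Longrightarrow> Poly_Mapping.lookup u (x, n) \<in> H n x x"
  by (auto simp: gEnd_def)

lemma lookup_gEnd_notin:
  "u \<in> gEnd B \<Longrightarrow> x \<notin> Ob \<Longrightarrow> Poly_Mapping.lookup u (x, n) = 0"
  by (auto simp: gEnd_def)

lemma keys_gEnd: "u \<in> gEnd B \<Longrightarrow> (x, n) \<in> Poly_Mapping.keys u \<Longrightarrow> x \<in> Ob"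
  by (metis lookup_gEnd_notin in_keys_iff)

lemma subspace_gEnd: "P.subspace (gEnd B)"
proof (rule P.subspaceI)
  show "u + v \<in> gEnd B" if "u \<in> gEnd B" "v \<in> gEnd B" for u v
    using that by (auto simp: gEnd_def lookup_add gHom_add)
  show "pscale c u \<in> gEnd B" if "u \<in> gEnd B" for c u
    using that by (auto simp: gEnd_def gHom_scale)
qed (auto simp: gEnd_def gHom_0)

lemma single_in_gEnd: "x \<in> Ob \<Longrightarrow> a \<in> H n x x \<Longrightarrow> Poly_Mapping.single (x, n) a \<in> gEnd B"
  by (auto simp: gEnd_def lookup_single when_def gHom_0)

lemma subspace_commutators: "P.subspace (commutators B)"
  unfolding commutators_def by (rule P.subspace_span)

lemma commutator_in_commutators:
  "\<lbrakk>x \<in> Ob; y \<in> Ob; u \<in> H i x y; f \<in> H j y x\<rbrakk> \<Longrightarrow>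
    Poly_Mapping.single (x, i + j) (C x y x j i f u)
      - Poly_Mapping.single (y, i + j) (gsmul B ((- 1) powi (i * j)) (C y x y i j u f)) \<in> commutators B"
  unfolding commutators_def by (rule P.span_base) blast

text \<open>Induction over the span: to show that a map respects commutators, \<open>U\<close> is
  taken as the set of elements where it does, and only generators are checked.\<close>

lemma commutators_minimal:
  assumes "P.subspace U"
    and "\<And>x y i j u f. \<lbrakk>x \<in> Ob; y \<in> Ob; u \<in> H i x y; f \<in> H j y x\<rbrakk> \<Longrightarrow>
      Poly_Mapping.single (x, i + j) (C x y x j i f u)
        - Poly_Mapping.single (y, i + j) (gsmul B ((- 1) powi (i * j)) (C y x y i j u f)) \<in> U"
  shows "commutators B \<subseteq> U"
  unfolding commutators_def using assms by (intro P.span_minimal) auto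

lemma commutators_subset_gEnd: "commutators B \<subseteq> gEnd B"
  by (rule commutators_minimal[OF subspace_gEnd])
    (auto intro!: P.subspace_diff[OF subspace_gEnd] single_in_gEnd gHom_scale gComp_in)

lemma ab_class_eq_iff:
  assumes "u \<in> gEnd B" "v \<in> gEnd B"
  shows "ab_class B u = ab_class B v \<longleftrightarrow> u - v \<in> commutators B"
proof -
  note C = subspace_commutators
  have "equiv (gEnd B) (ab_rel B)"
  proof (rule equivI)
    show "ab_rel B \<subseteq> gEnd B \<times> gEnd B" by (auto simp: ab_rel_def)
    show "refl_on (gEnd B) (ab_rel B)" by (auto simp: refl_on_def ab_rel_def P.subspace_0[OF C])
    show "sym (ab_rel B)"
    proof (rule symI)
      show "(v, u) \<in> ab_rel B" if "(u, v) \<in> ab_rel B" for u v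
        using that P.subspace_neg[OF C, of "u - v"] by (auto simp: ab_rel_def)
    qed
    show "trans (ab_rel B)"
    proof (rule transI)
      show "(u, w) \<in> ab_rel B" if "(u, v) \<in> ab_rel B" "(v, w) \<in> ab_rel B" for u v w
        using that P.subspace_add[OF C, of "u - v" "v - w"] by (auto simp: ab_rel_def)
    qed
  qed
  from eq_equiv_class_iff[OF this assms] assms show ?thesis by (simp add: ab_rel_def)
qed

lemma ab_class_eq_0_iff:
  "u \<in> gEnd B \<Longrightarrow> ab_class B u = ab_class B 0 \<longleftrightarrow> u \<in> commutators B"
  using ab_class_eq_iff[of u 0] P.subspace_0[OF subspace_gEnd] by simp

lemma ab_induced_class:
  assumes "u \<in> gEnd B"
    and "\<And>u. u \<in> gEnd B \<Longrightarrow> F u \<in> gEnd B"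
    and "\<And>u v. \<lbrakk>u \<in> gEnd B; v \<in> gEnd B; u - v \<in> commutators B\<rbrakk> \<Longrightarrow> F u - F v \<in> commutators B"
  shows "ab_induced B F (ab_class B u) = ab_class B (F u)"
proof -
  have "ab_class B (F v) = ab_class B (F u)" if "v \<in> ab_class B u" for v
  proof -
    have v: "v \<in> gEnd B" "u - v \<in> commutators B" using that by (auto simp: ab_rel_def)
    have "ab_class B (F u) = ab_class B (F v)"
      using assms(2)[OF assms(1)] assms(2)[OF v(1)] assms(3)[OF assms(1) v]
      by (simp only: ab_class_eq_iff)
    then show ?thesis by (rule sym)
  qed
  moreover have "u \<in> ab_class B u"
    using assms(1) P.subspace_0[OF subspace_commutators] by (auto simp: ab_rel_def)
  ultimately show ?thesis unfolding ab_induced_def by blast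
qed

section \<open>Linear functionals with the graded trace symmetry\<close>

text \<open>Restricted to \<open>gEnd B\<close>, these vanish on commutators and act as functionals
  on the abelianization. They live on all finitely supported functions because that is the vector
  space on which a separating functional is found.\<close>

definition trace_functional :: "(('o \<times> int \<Rightarrow>\<^sub>0 'm) \<Rightarrow> 'k) \<Rightarrow> bool" where
  "trace_functional \<phi> \<longleftrightarrow> Vector_Spaces.linear pscale (*) \<phi> \<and>
     (\<forall>x\<in>Ob. \<forall>y\<in>Ob. \<forall>i j. \<forall>u\<in>H i x y. \<forall>f\<in>H j y x.
        \<phi> (Poly_Mapping.single (x, i + j) (C x y x j i f u))
          = (- 1) powi (i * j) * \<phi> (Poly_Mapping.single (y, i + j) (C y x y i j u f)))"

lemma trace_functional_linear: "trace_functional \<phi> \<Longrightarrow> Vector_Spaces.linear pscale (*) \<phi>"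
  by (simp add: trace_functional_def)

lemma trace_functional_comm:
  assumes "trace_functional \<phi>" "x \<in> Ob" "y \<in> Ob" "u \<in> H i x y" "f \<in> H j y x" "n = i + j"
  shows "\<phi> (Poly_Mapping.single (x, n) (C x y x j i f u))
    = (- 1) powi (i * j) * \<phi> (Poly_Mapping.single (y, n) (C y x y i j u f))"
  using assms by (simp add: trace_functional_def)

lemma single_gsmul: "Poly_Mapping.single k (gsmul B c a) = pscale c (Poly_Mapping.single k a)"
  by (rule poly_mapping_eqI) (auto simp: lookup_single when_def)

lemma trace_functional_add: "trace_functional \<phi> \<Longrightarrow> \<phi> (u + v) = \<phi> u + \<phi> v"
  and trace_functional_diff: "trace_functional \<phi> \<Longrightarrow> \<phi> (u - v) = \<phi> u - \<phi> v"
  and trace_functional_0: "trace_functional \<phi> \<Longrightarrow> \<phi> 0 = 0"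
  and trace_functional_scale: "trace_functional \<phi> \<Longrightarrow> \<phi> (pscale c u) = c * \<phi> u"
  and trace_functional_sum: "trace_functional \<phi> \<Longrightarrow> \<phi> (\<Sum>i\<in>I. g i) = (\<Sum>i\<in>I. \<phi> (g i))"
proof -
  assume "trace_functional \<phi>"
  then interpret \<phi>: Vector_Spaces.linear pscale "(*) :: 'k \<Rightarrow> 'k \<Rightarrow> 'k" \<phi>
    by (rule trace_functional_linear)
  show "\<phi> (u + v) = \<phi> u + \<phi> v" "\<phi> (u - v) = \<phi> u - \<phi> v" "\<phi> 0 = 0" "\<phi> (pscale c u) = c * \<phi> u"
    "\<phi> (\<Sum>i\<in>I. g i) = (\<Sum>i\<in>I. \<phi> (g i))"
    by (fact \<phi>.add \<phi>.diff \<phi>.zero \<phi>.scale \<phi>.sum)+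
qed

lemma trace_functional_commutators:
  assumes \<phi>: "trace_functional \<phi>" and "u \<in> commutators B"
  shows "\<phi> u = 0"
proof -
  have "commutators B \<subseteq> {u. \<phi> u = 0}"
  proof (rule commutators_minimal, goal_cases)
    case 1
    show ?case
      by (rule P.subspaceI)
        (simp_all add: trace_functional_0[OF \<phi>] trace_functional_add[OF \<phi>] trace_functional_scale[OF \<phi>])
  next
    case 2
    from trace_functional_comm[OF \<phi> this refl] show ?case
      by (simp only: mem_Collect_eq trace_functional_diff[OF \<phi>] single_gsmul trace_functional_scale[OF \<phi>] right_minus_eq)
  qed
  with assms(2) show ?thesis by blast
qed

text \<open>An element outside the subspace \<open>commutators B\<close> is separated from it by a
  functional, and for a linear functional, vanishing on the generators is exactly the trace
  symmetry.\<close>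

lemma in_commutators_iff:
  "u \<in> commutators B \<longleftrightarrow> (\<forall>\<phi>. trace_functional \<phi> \<longrightarrow> \<phi> u = 0)"
proof (intro iffI allI impI)
  assume zero: "\<forall>\<phi>. trace_functional \<phi> \<longrightarrow> \<phi> u = 0"
  show "u \<in> commutators B"
  proof (rule ccontr)
    assume "u \<notin> commutators B"
    then obtain \<phi> where \<phi>: "Vector_Spaces.linear pscale (*) \<phi>"
        "\<forall>v\<in>commutators B. \<phi> v = 0" "\<phi> u = 1"
      using P.separating_functional[OF subspace_commutators] by blast
    interpret \<phi>: Vector_Spaces.linear pscale "(*) :: 'k \<Rightarrow> 'k \<Rightarrow> 'k" \<phi> by (rule \<phi>)
    have "trace_functional \<phi>"
      unfolding trace_functional_def
    proof (intro conjI ballI allI)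
      fix x y i j u f
      assume *: "x \<in> Ob" "y \<in> Ob" "u \<in> H i x y" "f \<in> H j y x"
      from \<phi>(2) commutator_in_commutators[OF *] have "\<phi> (Poly_Mapping.single (x, i + j) (C x y x j i f u)
        - Poly_Mapping.single (y, i + j) (gsmul B ((- 1) powi (i * j)) (C y x y i j u f))) = 0"
        by (rule bspec)
      then show "\<phi> (Poly_Mapping.single (x, i + j) (C x y x j i f u))
          = (- 1) powi (i * j) * \<phi> (Poly_Mapping.single (y, i + j) (C y x y i j u f))"
        by (simp only: \<phi>.diff single_gsmul \<phi>.scale right_minus_eq)
    qed (rule \<phi>)
    with zero have "\<phi> u = 0" by blast
    with \<phi>(3) show False by simp
  qed
qed (rule trace_functional_commutators)

section \<open>Powers as words in endomorphisms of one degree\<close>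

text \<open>A product of letters of degree \<open>n\<close>, nested to the right. The locale
  supplies no unit, so a single letter is treated apart and the empty word gets the default value
  0.\<close>

primrec word :: "'o \<Rightarrow> int \<Rightarrow> 'm list \<Rightarrow> 'm" where
  "word x n [] = 0"
| "word x n (a # w) = (if w = [] then a else C x x x n (int (length w) * n) a (word x n w))"

lemma word_in_gHom:
  "x \<in> Ob \<Longrightarrow> set w \<subseteq> H n x x \<Longrightarrow> word x n w \<in> H (int (length w) * n) x x"
proof (induction w)
  case (Cons a w)
  then have "C x x x n (int (length w) * n) a (word x n w) \<in> H (int (length (a # w)) * n) x x"
    by (intro gComp_in) (simp_all add: algebra_simps)
  with Cons.prems show ?case by simp
qed (simp add: gHom_0)

text \<open>Both words must be nonempty, since the empty word stands for 0 and not for a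
  unit.\<close>

lemma word_append:
  assumes x: "x \<in> Ob" and "v \<noteq> []" "w \<noteq> []" "set v \<subseteq> H n x x" and w: "set w \<subseteq> H n x x"
  shows "word x n (v @ w)
    = C x x x (int (length v) * n) (int (length w) * n) (word x n v) (word x n w)"
  using assms(2,4)
proof (induction v)
  case (Cons a v)
  show ?case
  proof (cases "v = []")
    case False
    then show ?thesis
      using Cons \<open>w \<noteq> []\<close> x w word_in_gHom[OF x, of v n] word_in_gHom[OF x w]
      by (auto simp: algebra_simps intro!: gComp_assoc'[symmetric])
  qed (use \<open>w \<noteq> []\<close> in simp)
qed simp

lemma word_replicate_scale:
  assumes "x \<in> Ob" "a \<in> H n x x"
  shows "word x n (replicate k (gsmul B c a)) = gsmul B (c ^ k) (word x n (replicate k a))"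
proof (induction k)
  case (Suc k)
  have mem: "word x n (replicate k b) \<in> H (int k * n) x x" if "b \<in> H n x x" for b
    using word_in_gHom[of x "replicate k b" n] assms(1) that by (auto simp: set_replicate_conv_if)
  show ?case
    using Suc assms mem[OF assms(2)]
    by (auto simp: gComp_scale_left gComp_scale_right gHom_scale)
qed simp

lemma word_replicate_0 [simp]: "x \<in> Ob \<Longrightarrow> word x n (replicate k 0) = 0"
proof (cases k)
  case (Suc l)
  assume "x \<in> Ob"
  \<comment> \<open>The letter 0 is written as \<open>gsmul B 0 0\<close>, so that homogeneity pulls
    out the factor \<open>0 ^ k\<close>.\<close>
  then have "word x n (replicate k (gsmul B 0 0)) = gsmul B (0 ^ k) (word x n (replicate k 0))"
    by (intro word_replicate_scale gHom_0)
  then show ?thesis unfolding Suc power_0_Suc V.scale_zero_left V.scale_zero_right .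
qed simp

text \<open>The noncommutative binomial expansion. Boolean words index the summands,
  \<open>True\<close> for \<open>a\<close> and \<open>False\<close> for \<open>b\<close>, which is
  the form that \<open>sum_rotation_invariant_words\<close> handles.\<close>

lemma word_replicate_add:
  assumes x: "x \<in> Ob" and ab: "a \<in> H n x x" "b \<in> H n x x" and "k > 0"
  shows "word x n (replicate k (a + b))
    = (\<Sum>w | length w = k. word x n (map (\<lambda>t. if t then a else b) w))"
  using \<open>k > 0\<close>
proof (induction k rule: nat_induct_non_zero)
  case 1
  show ?case
    using sum_words_Suc[of "\<lambda>w. word x n (map (\<lambda>t. if t then a else b) w)" 0] by simp
next
  case (Suc k)
  have fin: "finite {w :: bool list. length w = k}"
    using finite_lists_length_eq[of "UNIV :: bool set" k] by simp
  have mem: "word x n (map (\<lambda>t. if t then a else b) w) \<in> H (int k * n) x x" if "length w = k" for w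
    using word_in_gHom[of x "map (\<lambda>t. if t then a else b) w" n] x ab that by auto
  have "word x n (replicate (Suc k) (a + b)) = C x x x n (int k * n) (a + b) (word x n (replicate k (a + b)))"
    using Suc.hyps by simp
  also have "\<dots> = C x x x n (int k * n) a (\<Sum>w | length w = k. word x n (map (\<lambda>t. if t then a else b) w))
      + C x x x n (int k * n) b (\<Sum>w | length w = k. word x n (map (\<lambda>t. if t then a else b) w))"
    unfolding Suc.IH using x ab mem by (intro gComp_add_left gHom_sum) auto
  also have "\<dots> = (\<Sum>w | length w = k. C x x x n (int k * n) a (word x n (map (\<lambda>t. if t then a else b) w)))
      + (\<Sum>w | length w = k. C x x x n (int k * n) b (word x n (map (\<lambda>t. if t then a else b) w)))"
    using x ab mem fin by (intro arg_cong2[where f = "(+)"] gComp_sum_right) auto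
  also have "\<dots> = (\<Sum>w | length w = Suc k. word x n (map (\<lambda>t. if t then a else b) w))"
    unfolding sum_words_Suc using Suc.hyps by (intro arg_cong2[where f = "(+)"] sum.cong) auto
  finally show ?case .
qed

end

subsection \<open>The powers of endomorphisms\<close>

lemma lookup_component:
  "Poly_Mapping.lookup (component n u) (x, m) = (if m = n then Poly_Mapping.lookup u (x, m) else 0)"
proof -
  define K where "K = {k \<in> Poly_Mapping.keys u. snd k = n}"
  have eq: "component n u = (\<Sum>k\<in>K. Poly_Mapping.single (id k) (Poly_Mapping.lookup u k))"
    unfolding component_def K_def by (rule sum.cong) auto
  show ?thesis
  proof (cases "(x, m) \<in> K")
    case True
    with lookup_sum_single_inj[of K id "(x, m)"] show ?thesis
      by (simp add: eq) (auto simp: K_def)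
  next
    case False
    with lookup_sum_single_notin[of "(x, m)" id K] show ?thesis
      by (simp add: eq) (auto simp: K_def in_keys_iff)
  qed
qed

lemma homogeneous_component: "homogeneous n (component n u)"
  by (auto simp: homogeneous_def in_keys_iff lookup_component split: if_splits)

lemma homogeneous_lookup: "homogeneous n u \<Longrightarrow> m \<noteq> n \<Longrightarrow> Poly_Mapping.lookup u (x, m) = 0"
  by (metis (mono_tags, lifting) case_prodD homogeneous_def in_keys_iff)

lemma component_eq_sum_single:
  assumes "finite X" "fst ` Poly_Mapping.keys u \<subseteq> X"
  shows "component n u = (\<Sum>x\<in>X. Poly_Mapping.single (x, n) (Poly_Mapping.lookup u (x, n)))"
proof (rule poly_mapping_eqI, clarify)
  fix x m
  have "Poly_Mapping.lookup (\<Sum>x\<in>X. Poly_Mapping.single (x, n) (Poly_Mapping.lookup u (x, n))) (x, m)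
      = (\<Sum>y\<in>X. if y = x then (if m = n then Poly_Mapping.lookup u (x, m) else 0) else 0)"
    unfolding lookup_sum lookup_single by (rule sum.cong) (auto simp: when_def)
  also have "\<dots> = (if m = n then Poly_Mapping.lookup u (x, m) else 0)"
    using assms by (force simp: in_keys_iff)
  finally show "Poly_Mapping.lookup (component n u) (x, m)
      = Poly_Mapping.lookup (\<Sum>x\<in>X. Poly_Mapping.single (x, n) (Poly_Mapping.lookup u (x, n))) (x, m)"
    by (simp add: lookup_component)
qed

context graded_semicategory
begin

lemma component_in_gEnd: "u \<in> gEnd B \<Longrightarrow> component n u \<in> gEnd B"
  by (auto simp: gEnd_def lookup_component gHom_0)

text \<open>Endomorphisms at different objects have product 0, so multiplication is objectwise.
  Objects with a zero coefficient lie outside the support but may be summed over, since composing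
  with 0 gives 0.\<close>

lemma gEnd_mult_sum_single:
  assumes X: "finite X" "X \<subseteq> Ob"
    and a: "\<And>x. x \<in> X \<Longrightarrow> a x \<in> H m x x" and b: "\<And>x. x \<in> X \<Longrightarrow> b x \<in> H n x x"
  shows "gEnd_mult B (\<Sum>x\<in>X. Poly_Mapping.single (x, m) (a x)) (\<Sum>x\<in>X. Poly_Mapping.single (x, n) (b x))
    = (\<Sum>x\<in>X. Poly_Mapping.single (x, m + n) (C x x x m n (a x) (b x)))"
proof -
  define u where "u = (\<Sum>x\<in>X. Poly_Mapping.single (x, m) (a x))"
  define v where "v = (\<Sum>x\<in>X. Poly_Mapping.single (x, n) (b x))"
  have lu: "Poly_Mapping.lookup u (x, i) = (if x \<in> X \<and> i = m then a x else 0)" for x i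
    using X(1) lookup_sum_single_inj[of X "\<lambda>x. (x, m)" x a] lookup_sum_single_notin[of "(x, i)" "\<lambda>x. (x, m)" X a]
    by (auto simp: u_def inj_on_def)
  have lv: "Poly_Mapping.lookup v (x, i) = (if x \<in> X \<and> i = n then b x else 0)" for x i
    using X(1) lookup_sum_single_inj[of X "\<lambda>x. (x, n)" x b] lookup_sum_single_notin[of "(x, i)" "\<lambda>x. (x, n)" X b]
    by (auto simp: v_def inj_on_def)
  have ku: "Poly_Mapping.keys u = (\<lambda>x. (x, m)) ` {x \<in> X. a x \<noteq> 0}"
    by (auto simp: in_keys_iff lu split: if_splits)
  have kv: "Poly_Mapping.keys v = (\<lambda>x. (x, n)) ` {x \<in> X. b x \<noteq> 0}"
    by (auto simp: in_keys_iff lv split: if_splits)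
  have "gEnd_mult B u v = (\<Sum>x | x \<in> X \<and> a x \<noteq> 0. \<Sum>y | y \<in> X \<and> b y \<noteq> 0.
      if x = y then Poly_Mapping.single (x, m + n) (C x x x m n (a x) (b x)) else 0)"
    unfolding gEnd_mult_def ku kv
    by (subst sum.reindex, simp add: inj_on_def, subst sum.reindex, simp add: inj_on_def)
      (auto simp: lu lv intro!: sum.cong)
  also have "\<dots> = (\<Sum>x | x \<in> X \<and> a x \<noteq> 0. Poly_Mapping.single (x, m + n) (C x x x m n (a x) (b x)))"
  proof (rule sum.cong[OF refl])
    fix x assume x: "x \<in> {x \<in> X. a x \<noteq> 0}"
    then have "x \<in> Ob" "a x \<in> H m x x" using a X by auto
    then show "(\<Sum>y | y \<in> X \<and> b y \<noteq> 0. if x = y then Poly_Mapping.single (x, m + n) (C x x x m n (a x) (b x)) else 0)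
      = Poly_Mapping.single (x, m + n) (C x x x m n (a x) (b x))"
      using X(1) x b by auto
  qed
  also have "\<dots> = (\<Sum>x\<in>X. Poly_Mapping.single (x, m + n) (C x x x m n (a x) (b x)))"
  proof (rule sum.mono_neutral_left)
    show "\<forall>x\<in>X - {x \<in> X. a x \<noteq> 0}. Poly_Mapping.single (x, m + n) (C x x x m n (a x) (b x)) = 0"
      using b X(2) by auto
  qed (use X in auto)
  finally show ?thesis by (simp add: u_def v_def)
qed

lemma word_replicate_in:
  "x \<in> Ob \<Longrightarrow> a \<in> H n x x \<Longrightarrow> word x n (replicate k a) \<in> H (int k * n) x x"
  using word_in_gHom[of x "replicate k a" n] by (auto simp: set_replicate_conv_if)

text \<open>The iteration starts from one factor, hence \<open>k\<close> multiplications give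
  \<open>Suc k\<close> letters; this matches the \<open>p - 1\<close> iterations in
  \<open>xi_rep\<close>.\<close>

lemma gEnd_mult_power:
  assumes X: "finite X" "X \<subseteq> Ob" and a: "\<And>x. x \<in> X \<Longrightarrow> a x \<in> H n x x"
  shows "(gEnd_mult B (\<Sum>x\<in>X. Poly_Mapping.single (x, n) (a x)) ^^ k) (\<Sum>x\<in>X. Poly_Mapping.single (x, n) (a x))
    = (\<Sum>x\<in>X. Poly_Mapping.single (x, int (Suc k) * n) (word x n (replicate (Suc k) (a x))))"
proof (induction k)
  case (Suc k)
  have "x \<in> X \<Longrightarrow> word x n (replicate (Suc k) (a x)) \<in> H (int (Suc k) * n) x x" for x
    using X(2) a by (intro word_replicate_in) auto
  from gEnd_mult_sum_single[OF X a this]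
  have "gEnd_mult B (\<Sum>x\<in>X. Poly_Mapping.single (x, n) (a x))
       (\<Sum>x\<in>X. Poly_Mapping.single (x, int (Suc k) * n) (word x n (replicate (Suc k) (a x))))
    = (\<Sum>x\<in>X. Poly_Mapping.single (x, n + int (Suc k) * n)
         (C x x x n (int (Suc k) * n) (a x) (word x n (replicate (Suc k) (a x)))))"
    by blast
  moreover have "n + int (Suc k) * n = int (Suc (Suc k)) * n" by (simp add: algebra_simps)
  moreover have "C x x x n (int (Suc k) * n) (a x) (word x n (replicate (Suc k) (a x)))
    = word x n (replicate (Suc (Suc k)) (a x))" for x
    unfolding replicate_Suc[of "Suc k"] word.simps(2)[of x n "a x" "replicate (Suc k) (a x)"] by simp
  ultimately show ?case using Suc.IH by (simp only: funpow.simps o_apply)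
qed simp

text \<open>The sum may run over any finite box containing the support, so \<open>u\<close>,
  \<open>v\<close> and \<open>u + v\<close> can be expanded over the same index set.\<close>

lemma xi_rep_eq:
  assumes u: "u \<in> gEnd B" and fin: "finite X" "finite N" and "X \<subseteq> Ob"
    and keys: "Poly_Mapping.keys u \<subseteq> X \<times> N" and "p > 0"
  shows "xi_rep B p u
    = (\<Sum>n\<in>N. \<Sum>x\<in>X. Poly_Mapping.single (x, int p * n) (word x n (replicate p (Poly_Mapping.lookup u (x, n)))))"
proof -
  have "(gEnd_mult B (component n u) ^^ (p - 1)) (component n u)
    = (\<Sum>x\<in>X. Poly_Mapping.single (x, int p * n) (word x n (replicate p (Poly_Mapping.lookup u (x, n)))))" for n
  proof -
    have "component n u = (\<Sum>x\<in>X. Poly_Mapping.single (x, n) (Poly_Mapping.lookup u (x, n)))"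
      by (rule component_eq_sum_single) (use fin keys in auto)
    then show ?thesis
      using gEnd_mult_power[OF fin(1) \<open>X \<subseteq> Ob\<close>, of "\<lambda>x. Poly_Mapping.lookup u (x, n)" n "p - 1"]
        lookup_gEnd[OF u] \<open>X \<subseteq> Ob\<close> \<open>p > 0\<close> by auto
  qed
  then have "xi_rep B p u = (\<Sum>n\<in>snd ` Poly_Mapping.keys u. \<Sum>x\<in>X.
      Poly_Mapping.single (x, int p * n) (word x n (replicate p (Poly_Mapping.lookup u (x, n)))))"
    by (simp add: xi_rep_def)
  also have "\<dots> = (\<Sum>n\<in>N. \<Sum>x\<in>X. Poly_Mapping.single (x, int p * n) (word x n (replicate p (Poly_Mapping.lookup u (x, n)))))"
  proof (rule sum.mono_neutral_left[OF fin(2)], use keys in force, rule ballI)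
    fix n assume "n \<in> N - snd ` Poly_Mapping.keys u"
    then have "Poly_Mapping.lookup u (x, n) = 0" for x by (force simp: in_keys_iff)
    then show "(\<Sum>x\<in>X. Poly_Mapping.single (x, int p * n) (word x n (replicate p (Poly_Mapping.lookup u (x, n))))) = 0"
      using \<open>X \<subseteq> Ob\<close> by (auto intro!: sum.neutral)
  qed
  finally show ?thesis .
qed

lemma gEnd_support:
  assumes "u \<in> gEnd B" "v \<in> gEnd B"
  obtains X N where "finite X" "finite N" "X \<subseteq> Ob"
    "Poly_Mapping.keys u \<subseteq> X \<times> N" "Poly_Mapping.keys v \<subseteq> X \<times> N"
    "Poly_Mapping.keys (u + v) \<subseteq> X \<times> N"
proof
  let ?K = "Poly_Mapping.keys u \<union> Poly_Mapping.keys v"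
  show "finite (fst ` ?K)" "finite (snd ` ?K)" by auto
  show "fst ` ?K \<subseteq> Ob" using keys_gEnd assms by auto
  have "Poly_Mapping.keys (u + v) \<subseteq> ?K" by (rule Poly_Mapping.keys_add)
  then show "Poly_Mapping.keys (u + v) \<subseteq> fst ` ?K \<times> snd ` ?K" by force
qed force+

text \<open>The \<open>p\<close>-th power sends degree \<open>n\<close> to \<open>p * n\<close>, and
  distinct degrees stay distinct; each coefficient of the result therefore comes from a single
  coefficient of \<open>u\<close>.\<close>

lemma lookup_xi_rep:
  assumes u: "u \<in> gEnd B" and "p > 0"
  shows "Poly_Mapping.lookup (xi_rep B p u) (x, m)
    = (if x \<in> Ob \<and> int p dvd m
       then word x (m div int p) (replicate p (Poly_Mapping.lookup u (x, m div int p))) else 0)"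
proof -
  obtain X N where XN: "finite X" "finite N" "X \<subseteq> Ob" "Poly_Mapping.keys u \<subseteq> X \<times> N"
    using gEnd_support[OF u u] by metis
  define g :: "int \<times> 'o \<Rightarrow> 'o \<times> int" where "g = (\<lambda>(n, x). (x, int p * n))"
  define w where "w = (\<lambda>(n, x). word x n (replicate p (Poly_Mapping.lookup u (x, n))))"
  have eq: "xi_rep B p u = (\<Sum>k\<in>N \<times> X. Poly_Mapping.single (g k) (w k))"
    unfolding xi_rep_eq[OF u XN \<open>p > 0\<close>] sum.cartesian_product by (auto simp: g_def w_def intro: sum.cong)
  have "inj g" using \<open>p > 0\<close> by (auto simp: g_def inj_def)
  show ?thesis
  proof (cases "(x, m) \<in> g ` (N \<times> X)")
    case True
    then obtain n where n: "n \<in> N" "x \<in> X" "m = int p * n" by (auto simp: g_def)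
    have "Poly_Mapping.lookup (xi_rep B p u) (g (n, x)) = w (n, x)"
      unfolding eq by (rule lookup_sum_single_inj[OF _ \<open>inj g\<close>]) (use XN n in auto)
    then show ?thesis using n XN(3) \<open>p > 0\<close> by (auto simp: g_def w_def)
  next
    case False
    have "Poly_Mapping.lookup u (x, m div int p) = 0" if "int p dvd m"
    proof (rule ccontr)
      assume "Poly_Mapping.lookup u (x, m div int p) \<noteq> 0"
      with XN(4) have "(m div int p, x) \<in> N \<times> X" by (auto simp: in_keys_iff)
      moreover have "(x, m) = g (m div int p, x)" using that by (simp add: g_def)
      ultimately show False using False by blast
    qed
    with False show ?thesis unfolding eq using lookup_sum_single_notin[of "(x, m)" g "N \<times> X" w] by simp
  qed
qed

lemma xi_rep_in_gEnd:
  assumes "u \<in> gEnd B" "p > 0"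
  shows "xi_rep B p u \<in> gEnd B"
  unfolding gEnd_def
proof (clarsimp, intro conjI impI)
  fix x n assume x: "x \<in> Ob"
  show "Poly_Mapping.lookup (xi_rep B p u) (x, n) \<in> H n x x"
  proof (cases "int p dvd n")
    case True
    with word_replicate_in[OF x lookup_gEnd[OF assms(1) x, of "n div int p"], of p] x assms
    show ?thesis by (simp add: lookup_xi_rep)
  qed (use x assms gHom_0 in \<open>simp add: lookup_xi_rep\<close>)
qed (use assms in \<open>simp add: lookup_xi_rep\<close>)

lemma xi_rep_single:
  assumes "x \<in> Ob" "a \<in> H n x x" "p > 0"
  shows "xi_rep B p (Poly_Mapping.single (x, n) a)
    = Poly_Mapping.single (x, int p * n) (word x n (replicate p a))"
  using xi_rep_eq[OF single_in_gEnd[OF assms(1,2)], of "{x}" "{n}" p] assms by auto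

text \<open>Multiplication of degrees by \<open>p > 0\<close> is injective, so \<open>xi_rep\<close>
  never mixes components. This is what makes the kernels of its iterates graded.\<close>

lemma component_xi_rep:
  assumes u: "u \<in> gEnd B" and p: "p > 0"
  shows "component (int p * n) (xi_rep B p u) = xi_rep B p (component n u)"
proof (rule poly_mapping_eqI, clarify)
  fix x m
  show "Poly_Mapping.lookup (component (int p * n) (xi_rep B p u)) (x, m)
      = Poly_Mapping.lookup (xi_rep B p (component n u)) (x, m)"
    using p by (auto simp: lookup_component lookup_xi_rep[OF u p] lookup_xi_rep[OF component_in_gEnd[OF u] p])
qed

lemma component_add: "component n (u + v) = component n u + component n v"
  by (rule poly_mapping_eqI) (auto simp: lookup_component lookup_add)

lemma component_pscale: "component n (pscale c u) = pscale c (component n u)"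
  by (rule poly_mapping_eqI) (auto simp: lookup_component)

lemma component_in_commutators:
  assumes "u \<in> commutators B"
  shows "component n u \<in> commutators B"
proof -
  have "commutators B \<subseteq> {u. component n u \<in> commutators B}"
  proof (rule commutators_minimal)
    have "component n 0 = (0 :: 'o \<times> int \<Rightarrow>\<^sub>0 'm)"
      by (rule poly_mapping_eqI) (auto simp: lookup_component)
    then show "P.subspace {u. component n u \<in> commutators B}"
      using subspace_commutators by (auto simp: P.subspace_def component_add component_pscale)
  next
    fix x y i j u f
    assume *: "x \<in> Ob" "y \<in> Ob" "u \<in> H i x y" "f \<in> H j y x"
    let ?g = "Poly_Mapping.single (x, i + j) (C x y x j i f u)
        - Poly_Mapping.single (y, i + j) (gsmul B ((- 1) powi (i * j)) (C y x y i j u f))"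
    have "component n ?g = (if n = i + j then ?g else 0)"
    proof (rule poly_mapping_eqI, clarify)
      fix z m
      show "Poly_Mapping.lookup (component n ?g) (z, m) = Poly_Mapping.lookup (if n = i + j then ?g else 0) (z, m)"
        by (auto simp: lookup_component lookup_minus lookup_single when_def)
    qed
    then show "?g \<in> {u. component n u \<in> commutators B}"
      using commutator_in_commutators[OF *] P.subspace_0[OF subspace_commutators] by auto
  qed
  with assms show ?thesis by blast
qed

end

subsection \<open>The action of the center\<close>

lemma single_sum: "Poly_Mapping.single k (\<Sum>i\<in>I. f i) = (\<Sum>i\<in>I. Poly_Mapping.single k (f i))"
  by (induction I rule: infinite_finite_induct) (simp_all add: single_add)

context graded_semicategory
begin

lemma xi_rep_pscale:
  assumes u: "u \<in> gEnd B" and p: "p > 0"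
  shows "xi_rep B p (pscale c u) = pscale (c ^ p) (xi_rep B p u)"
proof (rule poly_mapping_eqI, clarify)
  fix x m
  have "pscale c u \<in> gEnd B" using u P.subspace_scale[OF subspace_gEnd] by blast
  then show "Poly_Mapping.lookup (xi_rep B p (pscale c u)) (x, m)
      = Poly_Mapping.lookup (pscale (c ^ p) (xi_rep B p u)) (x, m)"
    using u p by (simp add: lookup_xi_rep word_replicate_scale lookup_gEnd)
qed

text \<open>With \<open>r = (u \<circ> f)^k \<circ> u\<close>, the two powers are \<open>f \<circ> r\<close> and \<open>r \<circ> f\<close>.\<close>
lemma word_replicate_gComp_commute:
  assumes xy: "x \<in> Ob" "y \<in> Ob" and u: "u \<in> H i x y" and f: "f \<in> H j y x"
  shows "\<exists>r\<in>H (i + int k * (i + j)) x y.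
    word x (i + j) (replicate (Suc k) (C x y x j i f u)) = C x y x j (i + int k * (i + j)) f r \<and>
    word y (i + j) (replicate (Suc k) (C y x y i j u f)) = C y x y (i + int k * (i + j)) j r f"
proof (induction k)
  case 0
  then show ?case using u by auto
next
  case (Suc k)
  define n where "n = i + int k * (i + j)"
  obtain r where r: "r \<in> H n x y"
    "word x (i + j) (replicate (Suc k) (C x y x j i f u)) = C x y x j n f r"
    "word y (i + j) (replicate (Suc k) (C y x y i j u f)) = C y x y n j r f"
    using Suc.IH unfolding n_def by blast
  define s where "s = C x y y (i + j) n (C y x y i j u f) r"
  have n': "i + int (Suc k) * (i + j) = (i + j) + n" "int (Suc k) * (i + j) = j + n"
    by (simp_all add: n_def algebra_simps)
  have s: "s \<in> H (i + int (Suc k) * (i + j)) x y"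
    unfolding s_def n' using xy u f r by (intro gComp_in) auto
  have wS: "word z (i + j) (replicate (Suc (Suc k)) a)
      = C z z z (i + j) (int (Suc k) * (i + j)) a (word z (i + j) (replicate (Suc k) a))" for z a
    unfolding replicate_Suc[of "Suc k"] word.simps(2)[of z _ a "replicate (Suc k) a"] by simp
  have "word x (i + j) (replicate (Suc (Suc k)) (C x y x j i f u))
      = C x x x (i + j) (j + n) (C x y x j i f u) (C x y x j n f r)"
    unfolding wS r n' ..
  also have "\<dots> = C x y x j (i + (j + n)) f (C x x y i (j + n) u (C x y x j n f r))"
    using xy u f r by (intro gComp_assoc' gComp_in) auto
  also have "C x x y i (j + n) u (C x y x j n f r) = s"
    unfolding s_def using xy u f r by (intro gComp_assoc'[symmetric]) auto
  finally have 1: "word x (i + j) (replicate (Suc (Suc k)) (C x y x j i f u))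
      = C x y x j (i + int (Suc k) * (i + j)) f s"
    by (simp only: n' add.assoc)
  have "word y (i + j) (replicate (Suc (Suc k)) (C y x y i j u f))
      = C y y y (i + j) (n + j) (C y x y i j u f) (C y x y n j r f)"
    unfolding wS r n' by (simp add: add.commute)
  also have "\<dots> = C y x y (i + j + n) j s f"
    unfolding s_def using xy u f r by (intro gComp_assoc'[symmetric] gComp_in) auto
  finally have 2: "word y (i + j) (replicate (Suc (Suc k)) (C y x y i j u f))
      = C y x y (i + int (Suc k) * (i + j)) j s f"
    by (simp only: n'(1))
  show ?case by (intro bexI[of _ s] conjI 1 2 s)
qed

lemma center_degD:
  assumes "e \<in> center_deg B i"
  shows "x \<in> Ob \<Longrightarrow> e x \<in> H i x x"
    and "x \<notin> Ob \<Longrightarrow> e x = 0"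
    and "\<lbrakk>x \<in> Ob; y \<in> Ob; f \<in> H j x y\<rbrakk> \<Longrightarrow>
      C x x y j i f (e x) = gsmul B ((- 1) powi (i * j)) (C x y y i j (e y) f)"
    and "\<lbrakk>x \<in> Ob; y \<in> Ob; f \<in> H j x y\<rbrakk> \<Longrightarrow>
      C x y y i j (e y) f = gsmul B ((- 1) powi (i * j)) (C x x y j i f (e x))"
  using assms by (auto simp: center_deg_def families_def powi_minus_one_square)

lemma lookup_right_act:
  assumes u: "u \<in> gEnd B" and e: "\<And>x. x \<in> Ob \<Longrightarrow> e x \<in> H i x x"
  shows "Poly_Mapping.lookup (right_act B i e u) (x, m)
    = (if x \<in> Ob then C x x x (m - i) i (Poly_Mapping.lookup u (x, m - i)) (e x) else 0)"
proof -
  define g :: "'o \<times> int \<Rightarrow> 'o \<times> int" where "g = (\<lambda>(x, j). (x, i + j))"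
  define w where "w = (\<lambda>(x, j). C x x x j i (Poly_Mapping.lookup u (x, j)) (e x))"
  have eq: "right_act B i e u = (\<Sum>k\<in>Poly_Mapping.keys u. Poly_Mapping.single (g k) (w k))"
    unfolding right_act_def by (rule sum.cong) (auto simp: g_def w_def)
  have g: "inj g" "g (x, m - i) = (x, m)" by (auto simp: g_def inj_def)
  show ?thesis
  proof (cases "(x, m - i) \<in> Poly_Mapping.keys u")
    case True
    from lookup_sum_single_inj[OF _ g(1) this, of w] keys_gEnd[OF u True] show ?thesis
      unfolding eq g(2) by (simp add: w_def)
  next
    case False
    then have "(x, m) \<notin> g ` Poly_Mapping.keys u" using g by (metis image_iff inj_eq)
    then show ?thesis
      unfolding eq lookup_sum_single_notin[OF \<open>(x, m) \<notin> _\<close>] using False e by (simp add: in_keys_iff)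
  qed
qed

lemma lookup_left_act:
  assumes u: "u \<in> gEnd B" and e: "\<And>x. x \<in> Ob \<Longrightarrow> e x \<in> H i x x"
  shows "Poly_Mapping.lookup (left_act B i e u) (x, m)
    = (if x \<in> Ob then C x x x i (m - i) (e x) (Poly_Mapping.lookup u (x, m - i)) else 0)"
proof -
  define g :: "'o \<times> int \<Rightarrow> 'o \<times> int" where "g = (\<lambda>(x, j). (x, i + j))"
  define w where "w = (\<lambda>(x, j). C x x x i j (e x) (Poly_Mapping.lookup u (x, j)))"
  have eq: "left_act B i e u = (\<Sum>k\<in>Poly_Mapping.keys u. Poly_Mapping.single (g k) (w k))"
    unfolding left_act_def by (rule sum.cong) (auto simp: g_def w_def)
  have g: "inj g" "g (x, m - i) = (x, m)" by (auto simp: g_def inj_def)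
  show ?thesis
  proof (cases "(x, m - i) \<in> Poly_Mapping.keys u")
    case True
    from lookup_sum_single_inj[OF _ g(1) this, of w] keys_gEnd[OF u True] show ?thesis
      unfolding eq g(2) by (simp add: w_def)
  next
    case False
    then have "(x, m) \<notin> g ` Poly_Mapping.keys u" using g by (metis image_iff inj_eq)
    then show ?thesis
      unfolding eq lookup_sum_single_notin[OF \<open>(x, m) \<notin> _\<close>] using False e by (simp add: in_keys_iff)
  qed
qed

section \<open>The action of one homogeneous central element on endomorphisms\<close>

context
  fixes e i assumes e: "e \<in> center_deg B i"
begin

lemma lookup_right_act_center:
  "u \<in> gEnd B \<Longrightarrow> Poly_Mapping.lookup (right_act B i e u) (x, m)
    = (if x \<in> Ob then C x x x (m - i) i (Poly_Mapping.lookup u (x, m - i)) (e x) else 0)"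
  by (rule lookup_right_act[OF _ center_degD(1)[OF e]])

lemma lookup_left_act_center:
  "u \<in> gEnd B \<Longrightarrow> Poly_Mapping.lookup (left_act B i e u) (x, m)
    = (if x \<in> Ob then C x x x i (m - i) (e x) (Poly_Mapping.lookup u (x, m - i)) else 0)"
  by (rule lookup_left_act[OF _ center_degD(1)[OF e]])

lemma right_act_in_gEnd:
  assumes "u \<in> gEnd B"
  shows "right_act B i e u \<in> gEnd B"
  unfolding gEnd_def
  using assms by (auto simp: lookup_right_act_center lookup_gEnd center_degD(1)[OF e] intro!: gComp_in)

lemma left_act_in_gEnd:
  assumes "u \<in> gEnd B"
  shows "left_act B i e u \<in> gEnd B"
  unfolding gEnd_def
  using assms by (auto simp: lookup_left_act_center lookup_gEnd center_degD(1)[OF e] intro!: gComp_in)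

text \<open>Centrality moves \<open>e x\<close> across a morphism of degree \<open>j\<close> at the
  cost of the sign \<open>(- 1) powi (i * j)\<close>. The sign depends on \<open>j\<close>, hence
  the restriction to homogeneous \<open>u\<close>.\<close>

lemma left_act_homogeneous:
  assumes u: "u \<in> gEnd B" and hom: "homogeneous j u"
  shows "left_act B i e u = pscale ((- 1) powi (i * j)) (right_act B i e u)"
proof (rule poly_mapping_eqI, clarify)
  fix x m
  show "Poly_Mapping.lookup (left_act B i e u) (x, m)
      = Poly_Mapping.lookup (pscale ((- 1) powi (i * j)) (right_act B i e u)) (x, m)"
  proof (cases "m - i = j")
    case True
    then show ?thesis
      using u lookup_gEnd[OF u, of x j] by (simp add: lookup_left_act_center lookup_right_act_center center_degD(4)[OF e])
  next
    case False
    then show ?thesis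
      using u homogeneous_lookup[OF hom False, of x] center_degD(1)[OF e]
      by (simp add: lookup_left_act_center lookup_right_act_center)
  qed
qed

lemma right_act_add:
  assumes "u \<in> gEnd B" "v \<in> gEnd B"
  shows "right_act B i e (u + v) = right_act B i e u + right_act B i e v"
proof (rule poly_mapping_eqI, clarify)
  fix x m
  show "Poly_Mapping.lookup (right_act B i e (u + v)) (x, m)
      = Poly_Mapping.lookup (right_act B i e u + right_act B i e v) (x, m)"
    using assms P.subspace_add[OF subspace_gEnd assms]
    by (simp add: lookup_right_act_center lookup_add gComp_add_left lookup_gEnd center_degD(1)[OF e])
qed

lemma left_act_add:
  assumes "u \<in> gEnd B" "v \<in> gEnd B"
  shows "left_act B i e (u + v) = left_act B i e u + left_act B i e v"
proof (rule poly_mapping_eqI, clarify)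
  fix x m
  show "Poly_Mapping.lookup (left_act B i e (u + v)) (x, m)
      = Poly_Mapping.lookup (left_act B i e u + left_act B i e v) (x, m)"
    using assms P.subspace_add[OF subspace_gEnd assms]
    by (simp add: lookup_left_act_center lookup_add gComp_add_right lookup_gEnd center_degD(1)[OF e])
qed

lemma right_act_pscale:
  assumes "u \<in> gEnd B"
  shows "right_act B i e (pscale c u) = pscale c (right_act B i e u)"
proof (rule poly_mapping_eqI, clarify)
  fix x m
  show "Poly_Mapping.lookup (right_act B i e (pscale c u)) (x, m)
      = Poly_Mapping.lookup (pscale c (right_act B i e u)) (x, m)"
    using assms P.subspace_scale[OF subspace_gEnd assms]
    by (simp add: lookup_right_act_center gComp_scale_left lookup_gEnd center_degD(1)[OF e])
qed

lemma left_act_pscale: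
  assumes "u \<in> gEnd B"
  shows "left_act B i e (pscale c u) = pscale c (left_act B i e u)"
proof (rule poly_mapping_eqI, clarify)
  fix x m
  show "Poly_Mapping.lookup (left_act B i e (pscale c u)) (x, m)
      = Poly_Mapping.lookup (pscale c (left_act B i e u)) (x, m)"
    using assms P.subspace_scale[OF subspace_gEnd assms]
    by (simp add: lookup_left_act_center gComp_scale_right lookup_gEnd center_degD(1)[OF e])
qed

lemma right_act_single:
  assumes "x \<in> Ob" "a \<in> H j x x"
  shows "right_act B i e (Poly_Mapping.single (x, j) a) = Poly_Mapping.single (x, i + j) (C x x x j i a (e x))"
  by (cases "a = 0") (simp_all add: right_act_def assms center_degD(1)[OF e])

text \<open>The right action turns the commutator of \<open>u\<close> and \<open>f\<close> into that
  of \<open>u \<circ> e\<close> and \<open>f\<close>: in \<open>(u \<circ> f) \<circ> e\<close> the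
  central factor is moved to the left of \<open>f\<close>, and the sign
  \<open>(- 1) powi (i * j)\<close> this costs is the ratio of the two commutator signs.\<close>

lemma right_act_commutators:
  assumes "u \<in> commutators B"
  shows "right_act B i e u \<in> commutators B"
proof -
  have "commutators B \<subseteq> {u \<in> gEnd B. right_act B i e u \<in> commutators B}"
  proof (rule commutators_minimal)
    have "right_act B i e 0 = 0" by (simp add: right_act_def)
    then show "P.subspace {u \<in> gEnd B. right_act B i e u \<in> commutators B}"
      using subspace_gEnd subspace_commutators
      by (auto simp: P.subspace_def right_act_add right_act_pscale)
  next
    fix x y k j u f
    assume *: "x \<in> Ob" "y \<in> Ob" "u \<in> H k x y" "f \<in> H j y x"
    let ?a = "Poly_Mapping.single (x, k + j) (C x y x j k f u)"
    let ?b = "Poly_Mapping.single (y, k + j) (gsmul B ((- 1) powi (k * j)) (C y x y k j u f))"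
    note ex = center_degD(1)[OF e *(1)] and ey = center_degD(1)[OF e *(2)]
    have fu: "C x y x j k f u \<in> H (k + j) x x" and uf: "C y x y k j u f \<in> H (k + j) y y"
      using * by (auto intro: gComp_in)
    have ue: "C x x y k i u (e x) \<in> H (k + i) x y" using * ex by (auto intro: gComp_in)
    have mem: "?a \<in> gEnd B" "?b \<in> gEnd B"
      using * fu uf by (auto intro: single_in_gEnd gHom_scale)
    have ab: "?a - ?b \<in> gEnd B" by (rule P.subspace_diff[OF subspace_gEnd mem])
    have "right_act B i e ?a = right_act B i e (?a - ?b) + right_act B i e ?b"
      using right_act_add[OF ab mem(2)] by simp
    then have split: "right_act B i e (?a - ?b) = right_act B i e ?a - right_act B i e ?b" by simp
    have A: "C x x x (k + j) i (C x y x j k f u) (e x) = C x y x j (k + i) f (C x x y k i u (e x))"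
      using * ex by (intro gComp_assoc') auto
    have "C y y y (k + j) i (C y x y k j u f) (e y) = C y x y k (j + i) u (C y y x j i f (e y))"
      using * ey by (intro gComp_assoc') auto
    also have "\<dots> = gsmul B ((- 1) powi (i * j)) (C y x y k (j + i) u (C y x x i j (e x) f))"
      unfolding center_degD(3)[OF e *(2,1,4)]
      using * ex by (intro gComp_scale_right gComp_in) auto
    also have "C y x y k (j + i) u (C y x x i j (e x) f) = C y x y (k + i) j (C x x y k i u (e x)) f"
      using * ex by (intro gComp_assoc'[symmetric]) auto
    finally have Bb: "C y y y (k + j) i (gsmul B ((- 1) powi (k * j)) (C y x y k j u f)) (e y)
      = gsmul B ((- 1) powi ((k + i) * j)) (C y x y (k + i) j (C x x y k i u (e x)) f)"
      using gComp_scale_left[OF *(2,2,2) uf ey] by (simp add: power_int_add distrib_right)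
    have deg: "i + (k + j) = (k + i) + j" by simp
    have "right_act B i e (?a - ?b)
      = Poly_Mapping.single (x, (k + i) + j) (C x y x j (k + i) f (C x x y k i u (e x)))
        - Poly_Mapping.single (y, (k + i) + j)
            (gsmul B ((- 1) powi ((k + i) * j)) (C y x y (k + i) j (C x x y k i u (e x)) f))"
      unfolding split right_act_single[OF *(1) fu] right_act_single[OF *(2) gHom_scale[OF *(2,2) uf]] A Bb deg ..
    also have "\<dots> \<in> commutators B" by (rule commutator_in_commutators[OF *(1,2) ue *(4)])
    finally show "?a - ?b \<in> {u \<in> gEnd B. right_act B i e u \<in> commutators B}" using ab by simp
  qed
  with assms show ?thesis by blast
qed

text \<open>The spanning commutators are homogeneous, and there the left action is the right action
  up to sign.\<close>

lemma left_act_commutators: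
  assumes "u \<in> commutators B"
  shows "left_act B i e u \<in> commutators B"
proof -
  have "commutators B \<subseteq> {u \<in> gEnd B. left_act B i e u \<in> commutators B}"
  proof (rule commutators_minimal)
    have "left_act B i e 0 = 0" by (simp add: left_act_def)
    then show "P.subspace {u \<in> gEnd B. left_act B i e u \<in> commutators B}"
      using subspace_gEnd subspace_commutators
      by (auto simp: P.subspace_def left_act_add left_act_pscale)
  next
    fix x y k j u f
    assume *: "x \<in> Ob" "y \<in> Ob" "u \<in> H k x y" "f \<in> H j y x"
    let ?g = "Poly_Mapping.single (x, k + j) (C x y x j k f u)
      - Poly_Mapping.single (y, k + j) (gsmul B ((- 1) powi (k * j)) (C y x y k j u f))"
    have g: "?g \<in> commutators B" by (rule commutator_in_commutators[OF *])
    then have "?g \<in> gEnd B" using commutators_subset_gEnd by blast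
    moreover have "homogeneous (k + j) ?g"
      by (auto simp: homogeneous_def in_keys_iff lookup_minus lookup_single when_def split: if_splits)
    ultimately show "?g \<in> {u \<in> gEnd B. left_act B i e u \<in> commutators B}"
      using right_act_commutators[OF g] P.subspace_scale[OF subspace_commutators]
      by (simp add: left_act_homogeneous)
  qed
  with assms show ?thesis by blast
qed

lemma ab_induced_right_act:
  assumes "u \<in> gEnd B"
  shows "ab_induced B (right_act B i e) (ab_class B u) = ab_class B (right_act B i e u)"
proof (rule ab_induced_class[OF assms right_act_in_gEnd])
  fix u v assume *: "u \<in> gEnd B" "v \<in> gEnd B" "u - v \<in> commutators B"
  have "right_act B i e u = right_act B i e (u - v) + right_act B i e v"
    using right_act_add[OF P.subspace_diff[OF subspace_gEnd *(1,2)] *(2)] by simp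
  with right_act_commutators[OF *(3)] show "right_act B i e u - right_act B i e v \<in> commutators B"
    by simp
qed

lemma ab_induced_left_act:
  assumes "u \<in> gEnd B"
  shows "ab_induced B (left_act B i e) (ab_class B u) = ab_class B (left_act B i e u)"
proof (rule ab_induced_class[OF assms left_act_in_gEnd])
  fix u v assume *: "u \<in> gEnd B" "v \<in> gEnd B" "u - v \<in> commutators B"
  have "left_act B i e u = left_act B i e (u - v) + left_act B i e v"
    using left_act_add[OF P.subspace_diff[OF subspace_gEnd *(1,2)] *(2)] by simp
  with left_act_commutators[OF *(3)] show "left_act B i e u - left_act B i e v \<in> commutators B"
    by simp
qed

end

end

subsection \<open>Characteristic \<open>p\<close>\<close>

locale graded_semicategory_char = graded_semicategory B
  for B :: "('k::field, 'o, 'm::ab_group_add) gr_cat" +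
  fixes p :: nat
  assumes CHAR_eq: "CHAR('k) = p" and p_pos: "p > 0"
begin

lemma prime_p: "prime p"
  using CHAR_eq p_pos prime_CHAR_semidom[where ?'a = 'k] by simp

text \<open>\<open>p - 1\<close> is even unless \<open>p = 2\<close>, and in characteristic 2 signs
  are trivial.\<close>

lemma powi_minus_one_p:
  assumes "a - b = (int p - 1) * c"
  shows "(- 1 :: 'k) powi a = (- 1) powi b"
proof (rule powi_minus_one_cong)
  have "even (int p - 1) \<or> p = 2"
    using prime_p prime_odd_nat[of p] prime_ge_2_nat[of p] by (cases "p = 2") auto
  then show "even (a - b) \<or> CHAR('k) = 2" using assms CHAR_eq by auto
qed

text \<open>Rotation commutes the first letter, of degree \<open>n\<close>, past the other
  \<open>p - 1\<close> letters; the sign exponent \<open>(p - 1) * n * n\<close> is a multiple of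
  \<open>p - 1\<close>.\<close>

lemma trace_functional_word_rotate1:
  assumes \<phi>: "trace_functional \<phi>" and x: "x \<in> Ob" and w: "set w \<subseteq> H n x x" "length w = p"
  shows "\<phi> (Poly_Mapping.single (x, int p * n) (word x n (rotate1 w)))
    = \<phi> (Poly_Mapping.single (x, int p * n) (word x n w))"
proof -
  obtain a v where av: "w = a # v" using w(2) p_pos by (cases w) auto
  show ?thesis
  proof (cases "v = []")
    case False
    have mem: "a \<in> H n x x" "word x n v \<in> H (int (length v) * n) x x"
      using w(1) av word_in_gHom[OF x, of v] by auto
    have deg: "int p * n = n + int (length v) * n" using w(2) av by (auto simp: algebra_simps)
    have "word x n (rotate1 w) = C x x x (int (length v) * n) n (word x n v) a"
      using word_append[OF x False, of "[a]" n] w(1) av by auto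
    moreover have "word x n w = C x x x n (int (length v) * n) a (word x n v)"
      using av False by simp
    moreover have "(- 1 :: 'k) powi (n * (int (length v) * n)) = (- 1) powi 0"
      by (rule powi_minus_one_p[where c = "n * n"]) (use w(2) av in auto)
    ultimately show ?thesis
      using trace_functional_comm[OF \<phi> x x mem deg] by simp
  qed (use av in simp)
qed

lemma trace_functional_power_add:
  assumes \<phi>: "trace_functional \<phi>" and x: "x \<in> Ob" and ab: "a \<in> H n x x" "b \<in> H n x x"
  shows "\<phi> (Poly_Mapping.single (x, int p * n) (word x n (replicate p (a + b))))
    = \<phi> (Poly_Mapping.single (x, int p * n) (word x n (replicate p a)))
      + \<phi> (Poly_Mapping.single (x, int p * n) (word x n (replicate p b)))"
proof -
  define F where "F w = \<phi> (Poly_Mapping.single (x, int p * n)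
      (word x n (map (\<lambda>t. if t then a else b) w)))" for w :: "bool list"
  have "\<phi> (Poly_Mapping.single (x, int p * n) (word x n (replicate p (a + b)))) = (\<Sum>w | length w = p. F w)"
    unfolding F_def word_replicate_add[OF x ab p_pos] single_sum trace_functional_sum[OF \<phi>] ..
  also have "\<dots> = F (replicate p True) + F (replicate p False)"
  proof (rule sum_rotation_invariant_words[OF CHAR_eq p_pos])
    show "F (rotate1 w) = F w" if "length w = p" for w
      unfolding F_def rotate1_map[symmetric]
      by (rule trace_functional_word_rotate1[OF \<phi> x]) (use ab that in auto)
  qed
  finally show ?thesis by (simp add: F_def map_replicate)
qed

lemma trace_functional_xi_rep:
  assumes "trace_functional \<phi>" "u \<in> gEnd B" "finite X" "finite N" "X \<subseteq> Ob" "Poly_Mapping.keys u \<subseteq> X \<times> N"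
  shows "\<phi> (xi_rep B p u) = (\<Sum>n\<in>N. \<Sum>x\<in>X.
    \<phi> (Poly_Mapping.single (x, int p * n) (word x n (replicate p (Poly_Mapping.lookup u (x, n))))))"
  unfolding xi_rep_eq[OF assms(2-6) p_pos] trace_functional_sum[OF assms(1)] ..

text \<open>Powers are taken in each degree and at each object separately, so mixed words have
  letters of one degree at one object, and \<open>trace_functional_power_add\<close> removes
  them.\<close>

lemma trace_functional_xi_rep_add:
  assumes \<phi>: "trace_functional \<phi>" and uv: "u \<in> gEnd B" "v \<in> gEnd B"
  shows "\<phi> (xi_rep B p (u + v)) = \<phi> (xi_rep B p u) + \<phi> (xi_rep B p v)"
proof -
  obtain X N where XN: "finite X" "finite N" "X \<subseteq> Ob"
    and keys: "Poly_Mapping.keys u \<subseteq> X \<times> N" "Poly_Mapping.keys v \<subseteq> X \<times> N"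
      "Poly_Mapping.keys (u + v) \<subseteq> X \<times> N"
    using gEnd_support[OF uv] by metis
  have "u + v \<in> gEnd B" by (rule P.subspace_add[OF subspace_gEnd uv])
  note eqs = this[THEN trace_functional_xi_rep[OF \<phi>, OF _ XN keys(3)]]
    trace_functional_xi_rep[OF \<phi> uv(1) XN keys(1)] trace_functional_xi_rep[OF \<phi> uv(2) XN keys(2)]
  show ?thesis
    unfolding eqs sum.distrib[symmetric] lookup_add
    using XN(3) by (intro sum.cong refl trace_functional_power_add[OF \<phi>] lookup_gEnd uv) auto
qed

lemma trace_functional_xi_rep_diff:
  assumes \<phi>: "trace_functional \<phi>" and uv: "u \<in> gEnd B" "v \<in> gEnd B"
  shows "\<phi> (xi_rep B p (u - v)) = \<phi> (xi_rep B p u) - \<phi> (xi_rep B p v)"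
  using trace_functional_xi_rep_add[OF \<phi> P.subspace_diff[OF subspace_gEnd uv] uv(2)] by simp

text \<open>The powers of \<open>f \<circ> u\<close> and \<open>u \<circ> f\<close> are themselves
  \<open>f \<circ> r\<close> and \<open>r \<circ> f\<close>, so a single commutation suffices. The
  degree of \<open>r\<close> exceeds \<open>i\<close> by \<open>(p - 1) * (i + j)\<close>, which
  leaves the sign unchanged.\<close>

lemma trace_functional_power_comm:
  assumes \<phi>: "trace_functional \<phi>" and xy: "x \<in> Ob" "y \<in> Ob" and uf: "u \<in> H i x y" "f \<in> H j y x"
  shows "\<phi> (Poly_Mapping.single (x, int p * (i + j)) (word x (i + j) (replicate p (C x y x j i f u))))
    = (- 1) powi (i * j)
      * \<phi> (Poly_Mapping.single (y, int p * (i + j)) (word y (i + j) (replicate p (C y x y i j u f))))"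
proof -
  define n where "n = i + int (p - 1) * (i + j)"
  have p: "Suc (p - 1) = p" "int (p - 1) = int p - 1" using p_pos by auto
  obtain r where r: "r \<in> H n x y"
    "word x (i + j) (replicate p (C x y x j i f u)) = C x y x j n f r"
    "word y (i + j) (replicate p (C y x y i j u f)) = C y x y n j r f"
    using word_replicate_gComp_commute[OF xy uf, of "p - 1"] unfolding p(1) n_def by blast
  have "int p * (i + j) = n + j" unfolding n_def p(2) by (simp add: algebra_simps)
  from trace_functional_comm[OF \<phi> xy r(1) uf(2) this]
  have "\<phi> (Poly_Mapping.single (x, int p * (i + j)) (C x y x j n f r))
    = (- 1) powi (n * j) * \<phi> (Poly_Mapping.single (y, int p * (i + j)) (C y x y n j r f))" .
  moreover have "(- 1 :: 'k) powi (n * j) = (- 1) powi (i * j)"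
    by (rule powi_minus_one_p[where c = "(i + j) * j"]) (unfold n_def p(2), simp add: algebra_simps)
  ultimately show ?thesis by (simp only: r)
qed

text \<open>\<open>xi_rep\<close> is in general not linear, but the elements whose image is killed
  by all trace functionals form a subspace, by additivity under these functionals and by
  \<open>xi_rep_pscale\<close>. Generators therefore suffice.\<close>

lemma xi_rep_commutators:
  assumes "u \<in> commutators B"
  shows "xi_rep B p u \<in> commutators B"
proof -
  have "commutators B \<subseteq> {u \<in> gEnd B. \<forall>\<phi>. trace_functional \<phi> \<longrightarrow> \<phi> (xi_rep B p u) = 0}"
  proof (rule commutators_minimal)
    have "xi_rep B p 0 = 0" by (simp add: xi_rep_def)
    then show "P.subspace {u \<in> gEnd B. \<forall>\<phi>. trace_functional \<phi> \<longrightarrow> \<phi> (xi_rep B p u) = 0}"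
      using subspace_gEnd
      by (auto simp: P.subspace_def trace_functional_0 trace_functional_xi_rep_add
          xi_rep_pscale[OF _ p_pos] trace_functional_scale)
  next
    fix x y i j u f
    assume *: "x \<in> Ob" "y \<in> Ob" "u \<in> H i x y" "f \<in> H j y x"
    let ?s = "(- 1 :: 'k) powi (i * j)"
    let ?b = "Poly_Mapping.single (y, i + j) (C y x y i j u f)"
    have fu: "C x y x j i f u \<in> H (i + j) x x" and uf: "C y x y i j u f \<in> H (i + j) y y"
      using * by (auto intro: gComp_in)
    have mem: "Poly_Mapping.single (x, i + j) (C x y x j i f u) \<in> gEnd B" "?b \<in> gEnd B"
      using * fu uf by (auto intro: single_in_gEnd)
    note mem = mem P.subspace_scale[OF subspace_gEnd mem(2), of ?s]
    \<comment> \<open>In characteristic \<open>p\<close> a sign equals its \<open>p\<close>-th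
      power, also for \<open>p = 2\<close>, so the sign of the generator survives
      \<open>xi_rep_pscale\<close>.\<close>
    have "?s ^ p = (- 1) powi (i * j * int p)" by (simp add: power_int_mult)
    also have "\<dots> = ?s"
      by (rule powi_minus_one_p[where c = "i * j"]) (simp add: algebra_simps)
    finally have s: "?s ^ p = ?s" .
    have "\<phi> (xi_rep B p (Poly_Mapping.single (x, i + j) (C x y x j i f u) - pscale ?s ?b)) = 0"
      if \<phi>: "trace_functional \<phi>" for \<phi>
      unfolding trace_functional_xi_rep_diff[OF \<phi> mem(1,3)] xi_rep_pscale[OF mem(2) p_pos] s
        trace_functional_scale[OF \<phi>] xi_rep_single[OF *(1) fu p_pos] xi_rep_single[OF *(2) uf p_pos]
        trace_functional_power_comm[OF \<phi> *]
      by simp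
    then show "Poly_Mapping.single (x, i + j) (C x y x j i f u)
      - Poly_Mapping.single (y, i + j) (gsmul B ?s (C y x y i j u f))
      \<in> {u \<in> gEnd B. \<forall>\<phi>. trace_functional \<phi> \<longrightarrow> \<phi> (xi_rep B p u) = 0}"
      unfolding single_gsmul using P.subspace_diff[OF subspace_gEnd mem(1,3)] by blast
  qed
  with assms show ?thesis by (auto simp: in_commutators_iff[of "xi_rep B p u"])
qed

section \<open>The map on classes, its iterates and their kernels\<close>

lemma xi_ab_class:
  assumes "u \<in> gEnd B"
  shows "xi B p (ab_class B u) = ab_class B (xi_rep B p u)"
  unfolding xi_def
proof (rule ab_induced_class[OF assms xi_rep_in_gEnd[OF _ p_pos]])
  fix u v assume *: "u \<in> gEnd B" "v \<in> gEnd B" "u - v \<in> commutators B"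
  from xi_rep_commutators[OF *(3)] show "xi_rep B p u - xi_rep B p v \<in> commutators B"
    unfolding in_commutators_iff
    by (auto simp: trace_functional_xi_rep_diff[OF _ *(1,2)] trace_functional_diff)
qed

lemma funpow_xi_rep_in_gEnd: "u \<in> gEnd B \<Longrightarrow> (xi_rep B p ^^ r) u \<in> gEnd B"
  by (induction r) (auto intro: xi_rep_in_gEnd p_pos)

lemma funpow_xi_ab_class:
  "u \<in> gEnd B \<Longrightarrow> (xi B p ^^ r) (ab_class B u) = ab_class B ((xi_rep B p ^^ r) u)"
  by (induction r) (auto simp: xi_ab_class funpow_xi_rep_in_gEnd)

lemma ab_class_in_T_space_iff:
  assumes "u \<in> gEnd B"
  shows "ab_class B u \<in> T_space B p r \<longleftrightarrow> (xi_rep B p ^^ r) u \<in> commutators B"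
proof -
  have "ab_class B u \<in> abelianization B"
    unfolding abelianization_def using assms by (rule quotientI)
  then show ?thesis
    using assms by (simp add: T_space_def funpow_xi_ab_class ab_class_eq_0_iff funpow_xi_rep_in_gEnd)
qed

lemma T_spaceE:
  assumes "X \<in> T_space B p r"
  obtains u where "u \<in> gEnd B" "X = ab_class B u" "(xi_rep B p ^^ r) u \<in> commutators B"
proof -
  from assms obtain u where u: "u \<in> gEnd B" "X = ab_class B u"
    by (auto simp: T_space_def abelianization_def elim: quotientE)
  with assms that show ?thesis by (simp add: ab_class_in_T_space_iff)
qed

lemma funpow_xi_rep_component:
  "u \<in> gEnd B \<Longrightarrow> (xi_rep B p ^^ r) (component n u) = component (int p ^ r * n) ((xi_rep B p ^^ r) u)"
  by (induction r) (simp_all add: component_xi_rep[symmetric] funpow_xi_rep_in_gEnd p_pos mult.assoc)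

text \<open>\<open>T_r\<close> is graded: commutators are closed under taking components, and the
  \<open>r\<close>-th iterate of \<open>xi_rep\<close> multiplies degrees by
  \<open>p ^ r\<close>.\<close>

lemma component_in_kernel:
  "\<lbrakk>u \<in> gEnd B; (xi_rep B p ^^ r) u \<in> commutators B\<rbrakk>
    \<Longrightarrow> (xi_rep B p ^^ r) (component n u) \<in> commutators B"
  by (simp add: funpow_xi_rep_component component_in_commutators)

section \<open>Powers of a product with a central element\<close>

text \<open>Each letter moved past \<open>f\<close> contributes \<open>(- 1) powi (i * j)\<close>,
  and the exponents add up to the product of the degrees. The value 0 outside the objects is what
  \<open>families\<close> demands.\<close>

lemma center_word:
  assumes e: "e \<in> center_deg B i"
  shows "(\<lambda>x. if x \<in> Ob then word x i (replicate (Suc k) (e x)) else 0) \<in> center_deg B (int (Suc k) * i)"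
proof -
  have comm: "C x x y j (int (Suc k) * i) f (word x i (replicate (Suc k) (e x)))
      = gsmul B ((- 1) powi (int (Suc k) * i * j)) (C x y y (int (Suc k) * i) j (word y i (replicate (Suc k) (e y))) f)"
    if xy: "x \<in> Ob" "y \<in> Ob" and f: "f \<in> H j x y" for x y j f
  proof (induction k)
    case 0
    then show ?case using center_degD(3)[OF e that] by simp
  next
    case (Suc k)
    define n where "n = int (Suc k) * i"
    define W where "W z = word z i (replicate (Suc k) (e z))" for z
    have n: "int (Suc (Suc k)) * i = i + n" by (simp add: n_def algebra_simps)
    have W: "W z \<in> H n z z" if "z \<in> Ob" for z
      unfolding W_def n_def by (rule word_replicate_in[OF that center_degD(1)[OF e that]])
    have wS: "word z i (replicate (Suc (Suc k)) (e z)) = C z z z i n (e z) (W z)" for z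
      unfolding replicate_Suc[of "Suc k"] word.simps(2)[of z _ _ "replicate (Suc k) (e z)"] n_def W_def by simp
    note ex = center_degD(1)[OF e xy(1)] and ey = center_degD(1)[OF e xy(2)]
    have "C x x y j (i + n) f (C x x x i n (e x) (W x)) = C x x y (j + i) n (C x x y j i f (e x)) (W x)"
      using xy f ex W by (intro gComp_assoc'[symmetric]) auto
    also have "\<dots> = gsmul B ((- 1) powi (i * j)) (C x x y (j + i) n (C x y y i j (e y) f) (W x))"
      unfolding center_degD(3)[OF e xy f] using xy f ey W by (intro gComp_scale_left gComp_in) auto
    also have "C x x y (j + i) n (C x y y i j (e y) f) (W x) = C x y y i (n + j) (e y) (C x x y j n f (W x))"
      using xy f ey W by (intro gComp_assoc') auto
    also have "\<dots> = gsmul B ((- 1) powi (n * j)) (C x y y i (n + j) (e y) (C x y y n j (W y) f))"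
      unfolding W_def n_def Suc.IH unfolding W_def[symmetric] n_def[symmetric]
      using xy f ey W by (intro gComp_scale_right gComp_in) auto
    also have "C x y y i (n + j) (e y) (C x y y n j (W y) f) = C x y y (i + n) j (C y y y i n (e y) (W y)) f"
      using xy f ey W by (intro gComp_assoc'[symmetric]) auto
    finally show ?case
      unfolding wS n by (simp add: power_int_add distrib_right)
  qed
  have mem: "word x i (replicate (Suc k) (e x)) \<in> H (int (Suc k) * i) x x" if "x \<in> Ob" for x
    by (rule word_replicate_in[OF that center_degD(1)[OF e that]])
  show ?thesis
    unfolding center_deg_def families_def using comm mem by simp
qed

text \<open>The sign is the same at all objects, since it only depends on the degrees.\<close>
lemma word_replicate_center:
  assumes e: "e \<in> center_deg B i"
  shows "\<exists>c. \<forall>x\<in>Ob. \<forall>a\<in>H j x x.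
    word x (j + i) (replicate (Suc k) (C x x x j i a (e x)))
      = gsmul B c (C x x x (int (Suc k) * j) (int (Suc k) * i)
          (word x j (replicate (Suc k) a)) (word x i (replicate (Suc k) (e x))))"
proof (induction k)
  case 0
  then show ?case by (auto intro!: exI[of _ 1])
next
  case (Suc k)
  then obtain c where IH: "\<And>x a. \<lbrakk>x \<in> Ob; a \<in> H j x x\<rbrakk> \<Longrightarrow>
    word x (j + i) (replicate (Suc k) (C x x x j i a (e x)))
      = gsmul B c (C x x x (int (Suc k) * j) (int (Suc k) * i)
          (word x j (replicate (Suc k) a)) (word x i (replicate (Suc k) (e x))))"
    by blast
  define m n where "m = int (Suc k) * j" and "n = int (Suc k) * i"
  have deg: "int (Suc (Suc k)) * j = j + m" "int (Suc (Suc k)) * i = i + n" "int (Suc k) * (j + i) = m + n"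
    by (simp_all add: m_def n_def algebra_simps)
  have wS: "word z l (replicate (Suc (Suc k)) b) = C z z z l (int (Suc k) * l) b (word z l (replicate (Suc k) b))"
    for z l b
    unfolding replicate_Suc[of "Suc k"] word.simps(2)[of z _ _ "replicate (Suc k) b"] by simp
  show ?case
  proof (intro exI ballI)
    fix x a assume x: "x \<in> Ob" and a: "a \<in> H j x x"
    define v where "v = word x j (replicate (Suc k) a)"
    define w where "w = word x i (replicate (Suc k) (e x))"
    note ex = center_degD(1)[OF e x]
    have v: "v \<in> H m x x" and w: "w \<in> H n x x"
      unfolding v_def w_def m_def n_def by (rule word_replicate_in[OF x] a ex)+
    have "word x (j + i) (replicate (Suc (Suc k)) (C x x x j i a (e x)))
        = C x x x (j + i) (m + n) (C x x x j i a (e x)) (gsmul B c (C x x x m n v w))"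
      unfolding wS IH[OF x a] deg v_def w_def m_def n_def ..
    also have "\<dots> = gsmul B c (C x x x (j + i) (m + n) (C x x x j i a (e x)) (C x x x m n v w))"
      using x a ex v w by (intro gComp_scale_right gComp_in) auto
    also have "C x x x (j + i) (m + n) (C x x x j i a (e x)) (C x x x m n v w)
        = C x x x j (i + (m + n)) a (C x x x i (m + n) (e x) (C x x x m n v w))"
      using x a ex v w by (intro gComp_assoc' gComp_in) auto
    also have "C x x x i (m + n) (e x) (C x x x m n v w) = C x x x (i + m) n (C x x x i m (e x) v) w"
      using x a ex v w by (intro gComp_assoc'[symmetric]) auto
    \<comment> \<open>The only new sign: \<open>e x\<close> is moved past \<open>v\<close>, which
      has degree \<open>m\<close>.\<close>
    also have "\<dots> = gsmul B ((- 1) powi (i * m)) (C x x x (i + m) n (C x x x m i v (e x)) w)"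
      unfolding center_degD(4)[OF e x x v] using x ex v w by (intro gComp_scale_left gComp_in) auto
    also have "C x x x (i + m) n (C x x x m i v (e x)) w = C x x x m (i + n) v (C x x x i n (e x) w)"
      using x ex v w by (intro gComp_assoc') auto
    also have "C x x x j (i + (m + n)) a (gsmul B ((- 1) powi (i * m)) (C x x x m (i + n) v (C x x x i n (e x) w)))
        = gsmul B ((- 1) powi (i * m)) (C x x x j (i + (m + n)) a (C x x x m (i + n) v (C x x x i n (e x) w)))"
      using x a ex v w by (intro gComp_scale_right gComp_in) auto
    also have "C x x x j (i + (m + n)) a (C x x x m (i + n) v (C x x x i n (e x) w))
        = C x x x (j + m) (i + n) (C x x x j m a v) (C x x x i n (e x) w)"
      using x a ex v w by (intro gComp_assoc'[symmetric] gComp_in) auto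
    also have "C x x x j m a v = word x j (replicate (Suc (Suc k)) a)"
      unfolding wS v_def m_def ..
    also have "C x x x i n (e x) w = word x i (replicate (Suc (Suc k)) (e x))"
      unfolding wS w_def n_def ..
    finally show "word x (j + i) (replicate (Suc (Suc k)) (C x x x j i a (e x)))
      = gsmul B (c * (- 1) powi (i * m)) (C x x x (int (Suc (Suc k)) * j) (int (Suc (Suc k)) * i)
          (word x j (replicate (Suc (Suc k)) a)) (word x i (replicate (Suc (Suc k)) (e x))))"
      unfolding deg V.scale_scale .
  qed
qed

text \<open>The witness \<open>e'\<close> is the \<open>p\<close>-th power of \<open>e\<close>, and
  \<open>c\<close> is the constant from \<open>word_replicate_center\<close>. It depends on
  \<open>j\<close>, so \<open>u\<close> is homogeneous; its value is irrelevant for kernels.\<close>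

lemma xi_rep_right_act:
  assumes e: "e \<in> center_deg B i" and u: "u \<in> gEnd B" and hom: "homogeneous j u"
  shows "\<exists>c. \<exists>e'\<in>center_deg B (int p * i).
    xi_rep B p (right_act B i e u) = pscale c (right_act B (int p * i) e' (xi_rep B p u))"
proof -
  define e' where "e' = (\<lambda>x. if x \<in> Ob then word x i (replicate p (e x)) else 0)"
  have p: "Suc (p - 1) = p" using p_pos by simp
  have e': "e' \<in> center_deg B (int p * i)"
    unfolding e'_def using center_word[OF e, of "p - 1"] unfolding p .
  obtain c where c: "\<And>x a. \<lbrakk>x \<in> Ob; a \<in> H j x x\<rbrakk> \<Longrightarrow>
    word x (j + i) (replicate p (C x x x j i a (e x)))
      = gsmul B c (C x x x (int p * j) (int p * i) (word x j (replicate p a)) (e' x))"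
    using word_replicate_center[OF e, of j "p - 1"] unfolding p e'_def by auto
  have "xi_rep B p (right_act B i e u) = pscale c (right_act B (int p * i) e' (xi_rep B p u))"
  proof (rule poly_mapping_eqI, clarify)
    fix x m
    note simps = lookup_xi_rep[OF right_act_in_gEnd[OF e u] p_pos] lookup_xi_rep[OF u p_pos]
      lookup_right_act_center[OF e u] lookup_right_act_center[OF e' xi_rep_in_gEnd[OF u p_pos]] lookup_pscale
    show "Poly_Mapping.lookup (xi_rep B p (right_act B i e u)) (x, m)
      = Poly_Mapping.lookup (pscale c (right_act B (int p * i) e' (xi_rep B p u))) (x, m)"
    proof (cases "x \<in> Ob \<and> int p dvd m")
      case False
      moreover have "int p dvd m - int p * i \<longleftrightarrow> int p dvd m"
        by (rule dvd_diff_left_iff[OF dvd_triv_left])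
      ultimately show ?thesis unfolding simps using center_degD(1)[OF e'] by auto
    next
      case True
      then obtain q where x: "x \<in> Ob" and m: "m = int p * q" by (auto elim: dvdE)
      have q: "m div int p = q" "int p dvd m - int p * i" "(m - int p * i) div int p = q - i"
          "m - int p * i = int p * (q - i)"
        using p_pos by (simp_all add: m right_diff_distrib[symmetric])
      show ?thesis
      proof (cases "q - i = j")
        case True
        then have "q = j + i" by simp
        then show ?thesis
          unfolding simps q using x c[OF x lookup_gEnd[OF u x, of j]] by (simp add: m)
      next
        case False
        have "Poly_Mapping.lookup u (x, q - i) = 0" by (rule homogeneous_lookup[OF hom False])
        then show ?thesis
          unfolding simps q using x p_pos center_degD(1)[OF e x] center_degD(1)[OF e' x] by simp
      qed
    qed
  qed
  with e' show ?thesis by blast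
qed

lemma homogeneous_xi_rep:
  assumes "u \<in> gEnd B" "homogeneous j u"
  shows "homogeneous (int p * j) (xi_rep B p u)"
proof -
  have "m = int p * j" if "Poly_Mapping.lookup (xi_rep B p u) (x, m) \<noteq> 0" for x m
  proof -
    from that have *: "x \<in> Ob" "int p dvd m"
        "word x (m div int p) (replicate p (Poly_Mapping.lookup u (x, m div int p))) \<noteq> 0"
      by (auto simp: lookup_xi_rep[OF assms(1) p_pos] split: if_splits)
    then have "Poly_Mapping.lookup u (x, m div int p) \<noteq> 0" by auto
    then have "m div int p = j" using homogeneous_lookup[OF assms(2)] by blast
    with *(2) show ?thesis by auto
  qed
  then show ?thesis by (auto simp: homogeneous_def in_keys_iff)
qed

text \<open>Stability of \<open>T_r\<close> under the center. One application of
  \<open>xi_rep\<close> replaces \<open>u\<close> and \<open>e\<close> by their \<open>p\<close>-th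
  powers and introduces a scalar, so the induction generalizes over both, their degrees and the
  scalar \<open>c\<close>.\<close>

lemma right_act_in_kernel:
  assumes "e \<in> center_deg B i" "u \<in> gEnd B" "homogeneous j u" "(xi_rep B p ^^ r) u \<in> commutators B"
  shows "(xi_rep B p ^^ r) (pscale c (right_act B i e u)) \<in> commutators B"
  using assms
proof (induction r arbitrary: e i u j c)
  case 0
  then show ?case by (simp add: right_act_commutators P.subspace_scale[OF subspace_commutators])
next
  case (Suc r)
  obtain c' e' where e': "e' \<in> center_deg B (int p * i)"
    "xi_rep B p (right_act B i e u) = pscale c' (right_act B (int p * i) e' (xi_rep B p u))"
    using xi_rep_right_act[OF Suc.prems(1-3)] by blast
  have "xi_rep B p (pscale c (right_act B i e u)) = pscale (c ^ p * c') (right_act B (int p * i) e' (xi_rep B p u))"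
    by (simp add: xi_rep_pscale[OF right_act_in_gEnd[OF Suc.prems(1,2)] p_pos] e'(2))
  moreover have "(xi_rep B p ^^ r) (xi_rep B p u) \<in> commutators B"
    using Suc.prems(4) by (simp add: funpow_swap1)
  ultimately show ?case
    using Suc.IH[OF e'(1) xi_rep_in_gEnd[OF Suc.prems(2) p_pos] homogeneous_xi_rep[OF Suc.prems(2,3)]]
    by (simp add: funpow_swap1)
qed

end

subsection \<open>Nondegenerate traces\<close>

lemma component_homogeneous: "homogeneous n u \<Longrightarrow> component n u = u"
  by (rule poly_mapping_eqI) (auto simp: lookup_component homogeneous_lookup)

text \<open>The Calabi-Yau conditions in the language of the orbit category: a graded trace of
  degree \<open>d\<close> pairs degrees \<open>i\<close> and \<open>j\<close> with
  \<open>i + j = d\<close>. Nondegeneracy is stated for the right factor, and \<open>tr_comm\<close>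
  carries it to the left one.\<close>

locale traced_graded_semicategory = graded_semicategory_char B p
  for B :: "('k::field, 'o, 'm::ab_group_add) gr_cat" and p +
  fixes d :: int and tr :: "'o \<Rightarrow> 'm \<Rightarrow> 'k"
  assumes finite_dim_gHom:
      "\<lbrakk>x \<in> gObj B; y \<in> gObj B\<rbrakk> \<Longrightarrow> \<exists>X. finite X \<and> gHom B n x y = module.span (gsmul B) X"
    and tr_linear: "x \<in> gObj B \<Longrightarrow> linear_between (gsmul B) (*) (gHom B d x x) (tr x)"
    and tr_comm:
      "\<lbrakk>x \<in> gObj B; y \<in> gObj B; u \<in> gHom B i x y; f \<in> gHom B j y x; i + j = d\<rbrakk>
        \<Longrightarrow> tr x (gComp B x y x j i f u) = (- 1) powi (i * j) * tr y (gComp B y x y i j u f)"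
    and tr_nondegenerate:
      "\<lbrakk>x \<in> gObj B; y \<in> gObj B; g \<in> gHom B i x y; i + j = d;
        \<And>f. f \<in> gHom B j y x \<Longrightarrow> tr x (gComp B x y x j i f g) = 0\<rbrakk> \<Longrightarrow> g = 0"
begin

section \<open>The trace on endomorphisms and on their classes\<close>

lemma tr_add: "\<lbrakk>x \<in> Ob; a \<in> H d x x; b \<in> H d x x\<rbrakk> \<Longrightarrow> tr x (a + b) = tr x a + tr x b"
  and tr_scale: "\<lbrakk>x \<in> Ob; a \<in> H d x x\<rbrakk> \<Longrightarrow> tr x (gsmul B c a) = c * tr x a"
  using tr_linear[of x] by (auto simp: linear_between_def)

lemma tr_0: "x \<in> Ob \<Longrightarrow> tr x 0 = 0"
  using tr_scale[of x 0 0] gHom_0[of x x d] by simp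

lemma tr_rep_eq:
  assumes u: "u \<in> gEnd B" and X: "finite X" "X \<subseteq> Ob" "fst ` Poly_Mapping.keys u \<subseteq> X"
  shows "tr_rep d tr u = (\<Sum>x\<in>X. tr x (Poly_Mapping.lookup u (x, d)))"
proof -
  \<comment> \<open>\<open>d\<close> is added so that the inner sum picks out degree
    \<open>d\<close> even if it does not occur in \<open>u\<close>.\<close>
  define N where "N = insert d (snd ` Poly_Mapping.keys u)"
  have "tr_rep d tr u = (\<Sum>(x, n)\<in>X \<times> N. if n = d then tr x (Poly_Mapping.lookup u (x, n)) else 0)"
    unfolding tr_rep_def
  proof (rule sum.mono_neutral_left)
    show "Poly_Mapping.keys u \<subseteq> X \<times> N" using X(3) by (force simp: N_def)
    show "\<forall>k\<in>X \<times> N - Poly_Mapping.keys u.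
        (case k of (x, n) \<Rightarrow> if n = d then tr x (Poly_Mapping.lookup u (x, n)) else 0) = 0"
      using X(2) by (auto simp: in_keys_iff subset_iff tr_0)
  qed (use X in \<open>auto simp: N_def\<close>)
  also have "\<dots> = (\<Sum>x\<in>X. \<Sum>n\<in>N. if n = d then tr x (Poly_Mapping.lookup u (x, n)) else 0)"
    by (rule sum.cartesian_product[symmetric])
  also have "\<dots> = (\<Sum>x\<in>X. tr x (Poly_Mapping.lookup u (x, d)))"
    by (rule sum.cong) (simp_all add: N_def)
  finally show ?thesis .
qed

lemma tr_rep_add:
  assumes uv: "u \<in> gEnd B" "v \<in> gEnd B"
  shows "tr_rep d tr (u + v) = tr_rep d tr u + tr_rep d tr v"
proof -
  obtain X N where XN: "finite X" "X \<subseteq> Ob" "Poly_Mapping.keys u \<subseteq> X \<times> N"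
    "Poly_Mapping.keys v \<subseteq> X \<times> N" "Poly_Mapping.keys (u + v) \<subseteq> X \<times> N"
    using gEnd_support[OF uv] by metis
  have fst: "fst ` K \<subseteq> X" if "K \<subseteq> X \<times> N" for K using that by auto
  show ?thesis
    unfolding tr_rep_eq[OF uv(1) XN(1,2) fst[OF XN(3)]] tr_rep_eq[OF uv(2) XN(1,2) fst[OF XN(4)]]
      tr_rep_eq[OF P.subspace_add[OF subspace_gEnd uv] XN(1,2) fst[OF XN(5)]] sum.distrib[symmetric] lookup_add
    using XN(2) by (intro sum.cong refl tr_add lookup_gEnd uv) auto
qed

lemma tr_rep_pscale:
  assumes u: "u \<in> gEnd B"
  shows "tr_rep d tr (pscale c u) = c * tr_rep d tr u"
proof -
  obtain X N where XN: "finite X" "X \<subseteq> Ob" "Poly_Mapping.keys u \<subseteq> X \<times> N"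
    using gEnd_support[OF u u] by metis
  have keys: "fst ` Poly_Mapping.keys u \<subseteq> X" "fst ` Poly_Mapping.keys (pscale c u) \<subseteq> X"
    using XN(3) by (auto simp: in_keys_iff)
  show ?thesis
    unfolding tr_rep_eq[OF u XN(1,2) keys(1)] tr_rep_eq[OF P.subspace_scale[OF subspace_gEnd u] XN(1,2) keys(2)]
      sum_distrib_left lookup_pscale
    using XN(2) by (intro sum.cong refl tr_scale lookup_gEnd u) auto
qed

lemma tr_rep_single:
  assumes "x \<in> Ob" "a \<in> H n x x"
  shows "tr_rep d tr (Poly_Mapping.single (x, n) a) = (if n = d then tr x a else 0)"
  using tr_rep_eq[OF single_in_gEnd[OF assms], of "{x}"] assms(1) by (auto simp: lookup_single when_def tr_0)

lemma tr_rep_commutators: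
  assumes "u \<in> commutators B"
  shows "tr_rep d tr u = 0"
proof -
  have "commutators B \<subseteq> {u \<in> gEnd B. tr_rep d tr u = 0}"
  proof (rule commutators_minimal)
    have "tr_rep d tr 0 = 0" by (simp add: tr_rep_def)
    then show "P.subspace {u \<in> gEnd B. tr_rep d tr u = 0}"
      using subspace_gEnd by (auto simp: P.subspace_def tr_rep_add tr_rep_pscale)
  next
    fix x y i j u f
    assume *: "x \<in> Ob" "y \<in> Ob" "u \<in> H i x y" "f \<in> H j y x"
    let ?s = "(- 1 :: 'k) powi (i * j)"
    let ?a = "Poly_Mapping.single (x, i + j) (C x y x j i f u)"
    let ?b = "Poly_Mapping.single (y, i + j) (C y x y i j u f)"
    have fu: "C x y x j i f u \<in> H (i + j) x x" and uf: "C y x y i j u f \<in> H (i + j) y y"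
      using * by (auto intro: gComp_in)
    have ab: "?a \<in> gEnd B" "?b \<in> gEnd B"
      using * fu uf by (auto intro: single_in_gEnd)
    have "?a - pscale ?s ?b = ?a + pscale (- ?s) ?b" by simp
    then have "tr_rep d tr (?a - pscale ?s ?b) = tr_rep d tr ?a - ?s * tr_rep d tr ?b"
      using ab P.subspace_scale[OF subspace_gEnd ab(2)] by (simp only: tr_rep_add tr_rep_pscale) simp
    also have "\<dots> = 0"
      unfolding tr_rep_single[OF *(1) fu] tr_rep_single[OF *(2) uf] using tr_comm[OF *] by simp
    finally show "?a - Poly_Mapping.single (y, i + j) (gsmul B ?s (C y x y i j u f))
        \<in> {u \<in> gEnd B. tr_rep d tr u = 0}"
      unfolding single_gsmul
      using P.subspace_diff[OF subspace_gEnd ab(1) P.subspace_scale[OF subspace_gEnd ab(2)]] by blast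
  qed
  with assms show ?thesis by blast
qed

lemma tr_ab_ab_class:
  assumes u: "u \<in> gEnd B"
  shows "tr_ab d tr (ab_class B u) = tr_rep d tr u"
proof -
  have "tr_rep d tr v = tr_rep d tr u" if "v \<in> ab_class B u" for v
  proof -
    from that have v: "v \<in> gEnd B" "u - v \<in> commutators B" by (auto simp: ab_rel_def)
    have "tr_rep d tr u = tr_rep d tr (u - v) + tr_rep d tr v"
      using tr_rep_add[OF P.subspace_diff[OF subspace_gEnd u v(1)] v(1)] by simp
    with tr_rep_commutators[OF v(2)] show ?thesis by simp
  qed
  moreover have "u \<in> ab_class B u"
    using u P.subspace_0[OF subspace_commutators] by (auto simp: ab_rel_def)
  ultimately have "tr_rep d tr ` ab_class B u = {tr_rep d tr u}" by blast
  then show ?thesis by (simp add: tr_ab_def)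
qed

lemma tr_rep_right_act:
  assumes e: "e \<in> center_deg B i" and u: "u \<in> gEnd B"
    and X: "finite X" "X \<subseteq> Ob" "fst ` Poly_Mapping.keys u \<subseteq> X"
  shows "tr_rep d tr (right_act B i e u)
    = (\<Sum>x\<in>X. tr x (C x x x (d - i) i (Poly_Mapping.lookup u (x, d - i)) (e x)))"
proof -
  have "x \<in> X" if "Poly_Mapping.lookup (right_act B i e u) (x, n) \<noteq> 0" for x n
  proof -
    from that have "x \<in> Ob" "Poly_Mapping.lookup u (x, n - i) \<noteq> 0"
      using center_degD(1)[OF e] by (auto simp: lookup_right_act_center[OF e u] split: if_splits)
    then show ?thesis using X(3) by (force simp: in_keys_iff)
  qed
  then have "fst ` Poly_Mapping.keys (right_act B i e u) \<subseteq> X" by (auto simp: in_keys_iff)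
  from tr_rep_eq[OF right_act_in_gEnd[OF e u] X(1,2) this] X(2) show ?thesis
    by (simp add: lookup_right_act_center[OF e u] subset_iff)
qed

section \<open>Trace functionals as pairings with central elements\<close>

text \<open>At each object \<open>e x\<close> comes from the finite-dimensional pairing of degrees
  \<open>s\<close> and \<open>d - s\<close>. Centrality is tested against an arbitrary
  \<open>v\<close> of degree \<open>s - j\<close>, which makes the total degree \<open>d\<close>:
  the traces of \<open>v\<close> composed with the two sides are compared through
  \<open>\<phi>\<close>, and nondegeneracy concludes.\<close>

lemma trace_functional_represented:
  assumes \<phi>: "trace_functional \<phi>"
  shows "\<exists>e\<in>center_deg B (d - s). \<forall>x\<in>Ob. \<forall>a\<in>H s x x.
    \<phi> (Poly_Mapping.single (x, s) a) = tr x (C x x x s (d - s) a (e x))"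
proof -
  define i where "i = d - s"
  have si: "i + s = d" "s + i = d" by (simp_all add: i_def)
  have "\<exists>w\<in>H i x x. \<forall>a\<in>H s x x. \<phi> (Poly_Mapping.single (x, s) a) = tr x (C x x x s i a w)"
    if x: "x \<in> Ob" for x
  proof -
    obtain X where X: "finite X" "H s x x = V.span X" using finite_dim_gHom[OF x x] by blast
    have mem: "C x x x s i a w \<in> H d x x" if "a \<in> H s x x" "w \<in> H i x x" for a w
      using x that si by (auto intro: gComp_in)
    show ?thesis
    proof (rule V.pairing_represents[OF subspace_gHom[OF x x] subspace_gHom[OF x x] _ _ _ X])
      show "linear_between (gsmul B) (*) (H s x x) (\<lambda>v. tr x (C x x x s i v w))" if "w \<in> H i x x" for w
        using x that mem by (auto simp: linear_between_def gComp_add_left gComp_scale_left tr_add tr_scale)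
      show "linear_between (gsmul B) (*) (H i x x) (\<lambda>w. tr x (C x x x s i v w))" if "v \<in> H s x x" for v
        using x that mem by (auto simp: linear_between_def gComp_add_right gComp_scale_right tr_add tr_scale)
      \<comment> \<open>The unknown is the left factor here, whereas \<open>tr_nondegenerate\<close>
        speaks of the right one; \<open>tr_comm\<close> swaps them.\<close>
      show "v = 0" if v: "v \<in> H s x x" and 0: "\<And>w. w \<in> H i x x \<Longrightarrow> tr x (C x x x s i v w) = 0" for v
      proof (rule tr_nondegenerate[OF x x v si(2)])
        show "tr x (C x x x i s w v) = 0" if "w \<in> H i x x" for w
          using tr_comm[OF x x v that si(2)] 0[OF that] by simp
      qed
      show "linear_between (gsmul B) (*) (H s x x) (\<lambda>a. \<phi> (Poly_Mapping.single (x, s) a))"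
        unfolding linear_between_def single_gsmul single_add
        by (simp add: trace_functional_add[OF \<phi>] trace_functional_scale[OF \<phi>] del: map_single)
    qed
  qed
  then obtain w where w: "\<And>x. x \<in> Ob \<Longrightarrow> w x \<in> H i x x"
    "\<And>x a. \<lbrakk>x \<in> Ob; a \<in> H s x x\<rbrakk> \<Longrightarrow> \<phi> (Poly_Mapping.single (x, s) a) = tr x (C x x x s i a (w x))"
    by metis
  define e where "e x = (if x \<in> Ob then w x else 0)" for x
  have e: "\<And>x. x \<in> Ob \<Longrightarrow> e x \<in> H i x x"
    "\<And>x a. \<lbrakk>x \<in> Ob; a \<in> H s x x\<rbrakk> \<Longrightarrow> \<phi> (Poly_Mapping.single (x, s) a) = tr x (C x x x s i a (e x))"
    using w by (simp_all add: e_def)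
  have "C x x y j i f (e x) = gsmul B ((- 1) powi (i * j)) (C x y y i j (e y) f)"
    if xy: "x \<in> Ob" "y \<in> Ob" and f: "f \<in> H j x y" for x y j f
  proof -
    note ex = e(1)[OF xy(1)] and ey = e(1)[OF xy(2)]
    let ?l = "C x x y j i f (e x)"
    let ?r = "C x y y i j (e y) f"
    let ?s = "(- 1 :: 'k) powi (i * j)"
    have l: "?l \<in> H (j + i) x y" and r: "?r \<in> H (j + i) x y"
      using xy f ex ey by (auto intro!: gComp_in)
    have "?l - gsmul B ?s ?r = 0"
    proof (rule tr_nondegenerate[OF xy])
      show "?l - gsmul B ?s ?r \<in> H (j + i) x y"
        using xy l r by (intro gHom_diff gHom_scale)
      show "j + i + (s - j) = d" using si by simp
      fix v assume v: "v \<in> H (s - j) y x"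
      have vf: "C x y x (s - j) j v f \<in> H s x x" and fv: "C y x y j (s - j) f v \<in> H s y y"
        and ev: "C y y x (s - j) i v (e y) \<in> H (d - j) y x"
        using xy f v ey si by (auto intro!: gComp_in)
      have "d = s - j + (j + i)" using si by simp
      note mem = gComp_in[OF xy xy(1) v l this] gComp_in[OF xy xy(1) v r this]
      have "tr x (C x y x (s - j) (j + i) v ?l) = tr x (C x x x s i (C x y x (s - j) j v f) (e x))"
        using xy f v ex by (intro arg_cong[where f = "tr x"] gComp_assoc'[symmetric]) auto
      also have "\<dots> = \<phi> (Poly_Mapping.single (x, s) (C x y x (s - j) j v f))"
        by (rule e(2)[OF xy(1) vf, symmetric])
      \<comment> \<open>The symmetry of \<open>\<phi>\<close> carries the value from
        \<open>x\<close> to \<open>y\<close>; the symmetry of \<open>tr\<close> brings it back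
        below, with \<open>e y\<close> in place of \<open>e x\<close>.\<close>
      also have "\<dots> = (- 1) powi (j * (s - j)) * \<phi> (Poly_Mapping.single (y, s) (C y x y j (s - j) f v))"
        by (rule trace_functional_comm[OF \<phi> xy f v]) simp
      also have "\<phi> (Poly_Mapping.single (y, s) (C y x y j (s - j) f v))
          = tr y (C y y y s i (C y x y j (s - j) f v) (e y))"
        by (rule e(2)[OF xy(2) fv])
      also have "\<dots> = tr y (C y x y j (d - j) f (C y y x (s - j) i v (e y)))"
        using xy f v ey si by (intro arg_cong[where f = "tr y"] gComp_assoc') auto
      also have "\<dots> = (- 1) powi ((d - j) * j) * tr x (C x y x (d - j) j (C y y x (s - j) i v (e y)) f)"
        by (rule tr_comm[OF xy(2,1) ev f]) simp
      also have "C x y x (d - j) j (C y y x (s - j) i v (e y)) f = C x y x (s - j) (j + i) v ?r"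
        using xy f v ey si by (intro gComp_assoc') auto
      finally have "tr x (C x y x (s - j) (j + i) v ?l)
          = (- 1) powi (j * (s - j) + (d - j) * j) * tr x (C x y x (s - j) (j + i) v ?r)"
        by (simp add: power_int_add)
      \<comment> \<open>The exponents of the two commutations add up to \<open>i * j\<close> plus
        the even number \<open>2 * (j * (s - j))\<close>.\<close>
      also have "(- 1 :: 'k) powi (j * (s - j) + (d - j) * j) = ?s"
      proof (rule powi_minus_one_cong, rule disjI1)
        have "j * (s - j) + (d - j) * j - i * j = 2 * (j * (s - j))"
          unfolding si(1)[symmetric] by (simp add: algebra_simps)
        then show "even (j * (s - j) + (d - j) * j - i * j)" by (metis dvd_triv_left)
      qed
      finally have eq: "tr x (C x y x (s - j) (j + i) v ?l) = ?s * tr x (C x y x (s - j) (j + i) v ?r)" .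
      have "tr x (C x y x (s - j) (j + i) v (?l - gsmul B ?s ?r))
          = tr x (C x y x (s - j) (j + i) v ?l + C x y x (s - j) (j + i) v (gsmul B (- ?s) ?r))"
        using gComp_add_right[OF xy xy(1) v l gHom_scale[OF xy r, of "- ?s"]] by simp
      also have "\<dots> = tr x (C x y x (s - j) (j + i) v ?l) - ?s * tr x (C x y x (s - j) (j + i) v ?r)"
        unfolding gComp_scale_right[OF xy xy(1) v r]
          tr_add[OF xy(1) mem(1) gHom_scale[OF xy(1) xy(1) mem(2)]] tr_scale[OF xy(1) mem(2)]
        by simp
      finally show "tr x (C x y x (s - j) (j + i) v (?l - gsmul B ?s ?r)) = 0"
        using eq by simp
    qed
    then show ?thesis by simp
  qed
  with e(1) have "e \<in> center_deg B i" by (simp add: center_deg_def families_def e_def)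
  with e(2) show ?thesis unfolding i_def by blast
qed

text \<open>Central elements separate classes of degree \<open>s\<close>: in this degree every trace
  functional is the pairing with a central element of degree \<open>d - s\<close>, so all of them
  kill \<open>u\<close>.\<close>

lemma in_commutators_if_tr_rep_0:
  assumes u: "u \<in> gEnd B" and hom: "homogeneous s u"
    and 0: "\<And>e. e \<in> center_deg B (d - s) \<Longrightarrow> tr_rep d tr (right_act B (d - s) e u) = 0"
  shows "u \<in> commutators B"
  unfolding in_commutators_iff
proof (intro allI impI)
  fix \<phi> assume \<phi>: "trace_functional \<phi>"
  obtain e where e: "e \<in> center_deg B (d - s)"
    "\<And>x a. \<lbrakk>x \<in> Ob; a \<in> H s x x\<rbrakk> \<Longrightarrow> \<phi> (Poly_Mapping.single (x, s) a) = tr x (C x x x s (d - s) a (e x))"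
    using trace_functional_represented[OF \<phi>] by blast
  define X where "X = fst ` Poly_Mapping.keys u"
  have X: "finite X" "X \<subseteq> Ob" "fst ` Poly_Mapping.keys u \<subseteq> X"
    using keys_gEnd[OF u] by (auto simp: X_def)
  have "\<phi> u = \<phi> (component s u)" by (simp add: component_homogeneous[OF hom])
  also have "\<dots> = (\<Sum>x\<in>X. \<phi> (Poly_Mapping.single (x, s) (Poly_Mapping.lookup u (x, s))))"
    unfolding component_eq_sum_single[OF X(1,3)] trace_functional_sum[OF \<phi>] ..
  also have "\<dots> = (\<Sum>x\<in>X. tr x (C x x x s (d - s) (Poly_Mapping.lookup u (x, s)) (e x)))"
    using X(2) by (intro sum.cong refl e(2) lookup_gEnd u) auto
  also have "\<dots> = tr_rep d tr (right_act B (d - s) e u)"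
    using tr_rep_right_act[OF e(1) u X] by simp
  finally show "\<phi> u = 0" using 0[OF e(1)] by simp
qed

text \<open>The center is graded commutative: centrality of \<open>e\<close> is applied to the
  morphism \<open>e' x\<close>.\<close>

lemma right_act_right_act:
  assumes e: "e \<in> center_deg B i" and e': "e' \<in> center_deg B j" and u: "u \<in> gEnd B"
  shows "right_act B i e (right_act B j e' u)
    = pscale ((- 1) powi (i * j)) (right_act B j e' (right_act B i e u))"
proof (rule poly_mapping_eqI, clarify)
  fix x m
  note simps = lookup_right_act_center[OF e u] lookup_right_act_center[OF e' u] lookup_pscale
    lookup_right_act_center[OF e right_act_in_gEnd[OF e' u]]
    lookup_right_act_center[OF e' right_act_in_gEnd[OF e u]]
  show "Poly_Mapping.lookup (right_act B i e (right_act B j e' u)) (x, m)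
    = Poly_Mapping.lookup (pscale ((- 1) powi (i * j)) (right_act B j e' (right_act B i e u))) (x, m)"
  proof (cases "x \<in> Ob")
    case x: True
    define k where "k = m - i - j"
    define a where "a = Poly_Mapping.lookup u (x, k)"
    have a: "a \<in> H k x x" unfolding a_def by (rule lookup_gEnd[OF u x])
    note ex = center_degD(1)[OF e x] and ex' = center_degD(1)[OF e' x]
    have "C x x x (m - i) i (C x x x k j a (e' x)) (e x) = C x x x k (j + i) a (C x x x j i (e' x) (e x))"
      using x a ex ex' by (intro gComp_assoc') (auto simp: k_def)
    also have "\<dots> = gsmul B ((- 1) powi (i * j)) (C x x x k (j + i) a (C x x x i j (e x) (e' x)))"
      unfolding center_degD(3)[OF e x x ex'] using x a ex ex' by (intro gComp_scale_right gComp_in) auto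
    also have "C x x x k (j + i) a (C x x x i j (e x) (e' x)) = C x x x (m - j) j (C x x x k i a (e x)) (e' x)"
      using x a ex ex' by (intro gComp_assoc'[symmetric]) (auto simp: k_def)
    finally have eq: "C x x x (m - i) i (C x x x k j a (e' x)) (e x)
      = gsmul B ((- 1) powi (i * j)) (C x x x (m - j) j (C x x x k i a (e x)) (e' x))" .
    have k: "m - j - i = k" "m - i - j = k" by (simp_all add: k_def)
    show ?thesis
      unfolding simps k using x eq unfolding a_def by simp
  qed (simp add: simps)
qed

lemma homogeneous_right_act:
  assumes e: "e \<in> center_deg B i" and u: "u \<in> gEnd B" "homogeneous j u" and k: "k = i + j"
  shows "homogeneous k (right_act B i e u)"
proof -
  have "n = k" if "Poly_Mapping.lookup (right_act B i e u) (x, n) \<noteq> 0" for x n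
  proof -
    from that have "Poly_Mapping.lookup u (x, n - i) \<noteq> 0"
      using center_degD(1)[OF e] by (auto simp: lookup_right_act_center[OF e u(1)] split: if_splits)
    then have "n - i = j" using homogeneous_lookup[OF u(2)] by blast
    with k show ?thesis by simp
  qed
  then show ?thesis by (auto simp: homogeneous_def in_keys_iff)
qed

text \<open>Degree count: \<open>u\<close> has degree \<open>s - n\<close> and \<open>z\<close> has
  degree \<open>d - s\<close>, so acting with \<open>z\<close> moves \<open>u\<close> to degree
  \<open>d - n\<close>, where the hypothesis on traces applies.\<close>

lemma right_act_kernel_if_tr_rep_0:
  assumes e: "e \<in> center_deg B n"
    and 0: "\<And>u. \<lbrakk>u \<in> gEnd B; homogeneous (d - n) u; (xi_rep B p ^^ r) u \<in> commutators B\<rbrakk>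
      \<Longrightarrow> tr_rep d tr (right_act B n e u) = 0"
    and u: "u \<in> gEnd B" "homogeneous (s - n) u" "(xi_rep B p ^^ r) u \<in> commutators B"
  shows "right_act B n e u \<in> commutators B"
proof (rule in_commutators_if_tr_rep_0[OF right_act_in_gEnd[OF e u(1)]])
  show "homogeneous s (right_act B n e u)"
    by (rule homogeneous_right_act[OF e u(1,2)]) simp
  fix z assume z: "z \<in> center_deg B (d - s)"
  have zu: "right_act B (d - s) z u \<in> gEnd B" by (rule right_act_in_gEnd[OF z u(1)])
  have "tr_rep d tr (right_act B n e (right_act B (d - s) z u)) = 0"
  proof (rule 0[OF zu])
    show "homogeneous (d - n) (right_act B (d - s) z u)"
      by (rule homogeneous_right_act[OF z u(1,2)]) simp
    show "(xi_rep B p ^^ r) (right_act B (d - s) z u) \<in> commutators B"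
      using right_act_in_kernel[OF z u, of 1] by simp
  qed
  then show "tr_rep d tr (right_act B (d - s) z (right_act B n e u)) = 0"
    unfolding right_act_right_act[OF z e u(1)] tr_rep_pscale[OF right_act_in_gEnd[OF e zu]] by simp
qed

section \<open>Annihilators and orthogonality to the kernel\<close>

text \<open>On homogeneous classes the left and right actions agree up to sign, so the two
  conditions in \<open>K_deg\<close> are equivalent, and classes can be replaced by homogeneous
  representatives.\<close>

lemma K_deg_iff:
  "e \<in> K_deg B p r s n \<longleftrightarrow> e \<in> center_deg B n \<and>
    (\<forall>u\<in>gEnd B. homogeneous (s - n) u \<longrightarrow> (xi_rep B p ^^ r) u \<in> commutators B
      \<longrightarrow> right_act B n e u \<in> commutators B)"
  (is "_ \<longleftrightarrow> _ \<and> ?R")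
proof (cases "e \<in> center_deg B n")
  case e: True
  define Q where "Q X \<longleftrightarrow> ab_induced B (left_act B n e) X = ab_class B 0 \<and>
      ab_induced B (right_act B n e) X = ab_class B 0" for X
  have Q: "Q (ab_class B u) \<longleftrightarrow> right_act B n e u \<in> commutators B"
    if "u \<in> gEnd B" "homogeneous (s - n) u" for u
    unfolding Q_def ab_induced_left_act[OF e that(1)] ab_induced_right_act[OF e that(1)]
      ab_class_eq_0_iff[OF right_act_in_gEnd[OF e that(1)]] ab_class_eq_0_iff[OF left_act_in_gEnd[OF e that(1)]]
    unfolding left_act_homogeneous[OF e that]
    by (rule iffI[OF conjunct2 conjI[OF P.subspace_scale[OF subspace_commutators]]])
  define U where "U = {u \<in> gEnd B. homogeneous (s - n) u \<and> (xi_rep B p ^^ r) u \<in> commutators B}"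
  have "T_space B p r \<inter> abelianization_deg B (s - n) = (\<lambda>u. ab_class B u) ` U"
    by (auto simp: abelianization_deg_def ab_class_in_T_space_iff U_def)
  then have "(\<forall>X\<in>T_space B p r \<inter> abelianization_deg B (s - n). Q X) \<longleftrightarrow> (\<forall>u\<in>U. Q (ab_class B u))"
    by (simp only: ball_simps)
  also have "\<dots> \<longleftrightarrow> (\<forall>u\<in>U. right_act B n e u \<in> commutators B)"
    by (rule ball_cong[OF refl], rule Q) (simp_all add: U_def)
  also have "\<dots> \<longleftrightarrow> ?R" unfolding U_def by blast
  finally have "(\<forall>X\<in>T_space B p r \<inter> abelianization_deg B (s - n). Q X) \<longleftrightarrow> ?R" .
  with e show ?thesis by (simp add: K_deg_def Q_def)
qed (simp add: K_deg_def)

text \<open>For \<open>s = d\<close>, orthogonality to the kernel already forces annihilation; the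
  converse holds since commutators have trace 0.\<close>

lemma K_deg_iff_tr_rep:
  "e \<in> K_deg B p r d n \<longleftrightarrow> e \<in> center_deg B n \<and>
    (\<forall>u\<in>gEnd B. homogeneous (d - n) u \<longrightarrow> (xi_rep B p ^^ r) u \<in> commutators B
      \<longrightarrow> tr_rep d tr (right_act B n e u) = 0)"
  unfolding K_deg_iff using tr_rep_commutators right_act_kernel_if_tr_rep_0[of e n r _ d] by blast

text \<open>The trace condition involves degree \<open>d - n\<close> alone, yet it implies
  annihilation in degree \<open>s - n\<close> for every \<open>s\<close>.\<close>

lemma K_deg_subset: "K_deg B p r d n \<subseteq> K_deg B p r s n"
proof
  fix e assume "e \<in> K_deg B p r d n"
  then show "e \<in> K_deg B p r s n"
    unfolding K_deg_iff_tr_rep K_deg_iff[of e r s]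
    using right_act_kernel_if_tr_rep_0[of e n r _ s] by blast
qed

lemma K_r_eq: "K_r B p r = K_rs B p r d"
proof
  have "K_rs B p r d \<subseteq> K_rs B p r s" for s
    using subsetD[OF K_deg_subset] by (auto simp: K_rs_def graded_sum_def)
  then show "K_rs B p r d \<subseteq> K_r B p r" by (auto simp: K_r_def)
qed (auto simp: K_r_def)

lemma tr_rep_right_act_component:
  assumes e: "e \<in> center_deg B i" and u: "u \<in> gEnd B"
  shows "tr_rep d tr (right_act B i e (component (d - i) u)) = tr_rep d tr (right_act B i e u)"
proof -
  define X where "X = fst ` Poly_Mapping.keys u"
  have X: "finite X" "X \<subseteq> Ob" "fst ` Poly_Mapping.keys u \<subseteq> X"
    using keys_gEnd[OF u] by (auto simp: X_def)
  have "fst ` Poly_Mapping.keys (component (d - i) u) \<subseteq> X"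
    by (force simp: X_def in_keys_iff lookup_component split: if_splits)
  from tr_rep_right_act[OF e component_in_gEnd[OF u] X(1,2) this] tr_rep_right_act[OF e u X]
  show ?thesis by (simp add: lookup_component)
qed

text \<open>The pairing is a sum over the degrees of \<open>h\<close>, whereas \<open>K_rs\<close>
  is a condition on each degree. Gradedness of the kernel reconciles them: the summand at
  \<open>i\<close> depends only on the component of \<open>u\<close> in degree \<open>d - i\<close>,
  and a homogeneous \<open>u\<close> leaves at most one summand.\<close>

lemma K_rs_eq:
  "K_rs B p r d = {h \<in> graded_sum (center_deg B). \<forall>X\<in>T_space B p r.
    (\<Sum>i | h i \<noteq> (\<lambda>_. 0). tr_ab d tr (ab_induced B (right_act B i (h i)) X)) = 0}"
proof -
  have sum_eq: "(\<Sum>i | h i \<noteq> (\<lambda>_. 0). tr_ab d tr (ab_induced B (right_act B i (h i)) (ab_class B u)))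
      = (\<Sum>i | h i \<noteq> (\<lambda>_. 0). tr_rep d tr (right_act B i (h i) u))"
    if "h \<in> graded_sum (center_deg B)" "u \<in> gEnd B" for h u
    using that by (intro sum.cong refl)
      (auto simp: graded_sum_def ab_induced_right_act tr_ab_ab_class right_act_in_gEnd)
  show ?thesis
  proof (intro equalityI subsetI)
    fix h assume h: "h \<in> K_rs B p r d"
    then have center: "h \<in> graded_sum (center_deg B)"
      by (auto simp: K_rs_def graded_sum_def K_deg_iff)
    moreover have "(\<Sum>i | h i \<noteq> (\<lambda>_. 0). tr_ab d tr (ab_induced B (right_act B i (h i)) X)) = 0"
      if X: "X \<in> T_space B p r" for X
    proof -
      from X obtain u where u: "u \<in> gEnd B" "X = ab_class B u" "(xi_rep B p ^^ r) u \<in> commutators B"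
        by (rule T_spaceE)
      have "tr_rep d tr (right_act B i (h i) u) = 0" for i
      proof -
        have "h i \<in> K_deg B p r d i" using h by (simp add: K_rs_def graded_sum_def)
        then have K: "tr_rep d tr (right_act B i (h i) v) = 0"
          if "v \<in> gEnd B" "homogeneous (d - i) v" "(xi_rep B p ^^ r) v \<in> commutators B" for v
          using that by (simp add: K_deg_iff_tr_rep)
        have "tr_rep d tr (right_act B i (h i) (component (d - i) u)) = 0"
          by (rule K[OF component_in_gEnd[OF u(1)] homogeneous_component component_in_kernel[OF u(1,3)]])
        then show ?thesis
          using tr_rep_right_act_component[OF _ u(1)] center by (simp add: graded_sum_def)
      qed
      then show ?thesis unfolding u(2) sum_eq[OF center u(1)] by simp
    qed
    ultimately show "h \<in> {h \<in> graded_sum (center_deg B). \<forall>X\<in>T_space B p r.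
        (\<Sum>i | h i \<noteq> (\<lambda>_. 0). tr_ab d tr (ab_induced B (right_act B i (h i)) X)) = 0}"
      by blast
  next
    fix h assume "h \<in> {h \<in> graded_sum (center_deg B). \<forall>X\<in>T_space B p r.
        (\<Sum>i | h i \<noteq> (\<lambda>_. 0). tr_ab d tr (ab_induced B (right_act B i (h i)) X)) = 0}"
    then have center: "h \<in> graded_sum (center_deg B)"
      and 0: "\<And>X. X \<in> T_space B p r \<Longrightarrow>
        (\<Sum>i | h i \<noteq> (\<lambda>_. 0). tr_ab d tr (ab_induced B (right_act B i (h i)) X)) = 0"
      by auto
    have hi: "h i \<in> center_deg B i" for i using center by (simp add: graded_sum_def)
    have fin: "finite {i. h i \<noteq> (\<lambda>_. 0)}" using center by (simp add: graded_sum_def)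
    have "h n \<in> K_deg B p r d n" for n
      unfolding K_deg_iff_tr_rep
    proof (intro conjI ballI impI hi)
      fix u assume u: "u \<in> gEnd B" "homogeneous (d - n) u" "(xi_rep B p ^^ r) u \<in> commutators B"
      have zero: "tr_rep d tr (right_act B i (h i) u) = 0" if "i \<noteq> n" for i
      proof -
        have "component (d - i) u = 0"
          by (rule poly_mapping_eqI)
            (use that homogeneous_lookup[OF u(2)] in \<open>auto simp: lookup_component\<close>)
        then have "tr_rep d tr (right_act B i (h i) (component (d - i) u)) = 0"
          by (simp add: right_act_def tr_rep_def)
        then show ?thesis using tr_rep_right_act_component[OF hi u(1)] by simp
      qed
      \<comment> \<open>The sum runs over degrees with \<open>h i\<close> nonzero only, so the case
        that \<open>h n\<close> vanishes is settled separately.\<close>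
      have zero_n: "tr_rep d tr (right_act B n (h n) u) = 0" if "h n = (\<lambda>_. 0)"
      proof -
        have "right_act B n (h n) u = 0"
        proof (rule poly_mapping_eqI, clarify)
          fix x m
          show "Poly_Mapping.lookup (right_act B n (h n) u) (x, m) = Poly_Mapping.lookup 0 (x, m)"
            unfolding lookup_right_act_center[OF hi u(1)] using lookup_gEnd[OF u(1)] by (simp add: that)
        qed
        then show ?thesis by (simp add: tr_rep_def)
      qed
      have "0 = (\<Sum>i | h i \<noteq> (\<lambda>_. 0). tr_rep d tr (right_act B i (h i) u))"
        using 0[of "ab_class B u"] u sum_eq[OF center u(1)] by (simp add: ab_class_in_T_space_iff)
      also have "\<dots> = (\<Sum>i | h i \<noteq> (\<lambda>_. 0). if i = n then tr_rep d tr (right_act B n (h n) u) else 0)"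
        using zero by (intro sum.cong) auto
      also have "\<dots> = tr_rep d tr (right_act B n (h n) u)"
        using fin zero_n by auto
      finally show "tr_rep d tr (right_act B n (h n) u) = 0" by simp
    qed
    with fin show "h \<in> K_rs B p r d" by (simp add: K_rs_def graded_sum_def)
  qed
qed

end

subsection \<open>Powers of an automorphism\<close>

lemma linear_between_comp:
  assumes "linear_between s1 s2 V F" "linear_between s2 s3 W G" "F ` V \<subseteq> W"
  shows "linear_between s1 s3 V (\<lambda>v. G (F v))"
  using assms by (auto simp: linear_between_def image_subset_iff)

context linear_category
begin

sublocale Hom: vector_space "smul A" by (rule vector_space_smul)

lemma linear_automorphism_id: "linear_automorphism A id_endofun"
  by unfold_locales (auto simp: id_endofun_def linear_between_def bij_betw_def)

lemma linear_automorphism_comp: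
  assumes "linear_automorphism A S" "linear_automorphism A T"
  shows "linear_automorphism A (comp_endofun S T)"
proof -
  interpret S: linear_automorphism A S by fact
  interpret T: linear_automorphism A T by fact
  have ob: "omap T x \<in> Obj A" "omap S x \<in> Obj A" if "x \<in> Obj A" for x
    using that T.bij_omap S.bij_omap by (auto dest: bij_betwE)
  have mor: "mmap T x y f \<in> Hom A (omap T x) (omap T y)"
    if "x \<in> Obj A" "y \<in> Obj A" "f \<in> Hom A x y" for x y f
    using that T.bij_mmap by (auto dest: bij_betwE)
  show ?thesis
  proof unfold_locales
    show "bij_betw (omap (comp_endofun S T)) (Obj A) (Obj A)"
      using bij_betw_trans[OF T.bij_omap S.bij_omap] by (simp add: comp_endofun_def o_def)
    show "bij_betw (mmap (comp_endofun S T) x y) (Hom A x y)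
        (Hom A (omap (comp_endofun S T) x) (omap (comp_endofun S T) y))"
      if "x \<in> Obj A" "y \<in> Obj A" for x y
      using bij_betw_trans[OF T.bij_mmap[OF that] S.bij_mmap] ob that
      by (simp add: comp_endofun_def o_def)
    show "linear_between (smul A) (smul A) (Hom A x y) (mmap (comp_endofun S T) x y)"
      if "x \<in> Obj A" "y \<in> Obj A" for x y
      using linear_between_comp[OF T.mmap_linear[OF that] S.mmap_linear] ob mor that
      by (simp add: comp_endofun_def image_subset_iff)
  qed (simp_all add: comp_endofun_def S.mmap_Ident T.mmap_Ident S.mmap_Comp T.mmap_Comp ob mor)
qed

end

context linear_automorphism
begin

lemma omap_in: "x \<in> Obj A \<Longrightarrow> omap S x \<in> Obj A"
  using bij_omap by (auto dest: bij_betwE)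

lemma mmap_in:
  "\<lbrakk>x \<in> Obj A; y \<in> Obj A; f \<in> Hom A x y\<rbrakk> \<Longrightarrow> mmap S x y f \<in> Hom A (omap S x) (omap S y)"
  using bij_mmap by (auto dest: bij_betwE)

lemma omap_eq_iff: "\<lbrakk>x \<in> Obj A; y \<in> Obj A\<rbrakk> \<Longrightarrow> omap S x = omap S y \<longleftrightarrow> x = y"
  using bij_omap by (auto simp: bij_betw_def inj_on_eq_iff)

lemma mmap_eq_iff:
  "\<lbrakk>x \<in> Obj A; y \<in> Obj A; f \<in> Hom A x y; g \<in> Hom A x y\<rbrakk> \<Longrightarrow> mmap S x y f = mmap S x y g \<longleftrightarrow> f = g"
  using bij_mmap[of x y] by (auto simp: bij_betw_def inj_on_eq_iff)

lemma mmap_add: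
  "\<lbrakk>x \<in> Obj A; y \<in> Obj A; f \<in> Hom A x y; g \<in> Hom A x y\<rbrakk>
    \<Longrightarrow> mmap S x y (f + g) = mmap S x y f + mmap S x y g"
  using mmap_linear[of x y] by (simp add: linear_between_def)

lemma mmap_smul:
  "\<lbrakk>x \<in> Obj A; y \<in> Obj A; f \<in> Hom A x y\<rbrakk> \<Longrightarrow> mmap S x y (smul A c f) = smul A c (mmap S x y f)"
  using mmap_linear[of x y] by (simp add: linear_between_def)

lemma
  assumes "x \<in> Obj A"
  shows omap_inv_in: "omap (inv_endofun A S) x \<in> Obj A"
    and omap_omap_inv: "omap S (omap (inv_endofun A S) x) = x"
  using assms bij_omap
  by (auto simp: inv_endofun_def Let_def bij_betw_def inv_into_into f_inv_into_f)

lemma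
  assumes "x \<in> Obj A" "y \<in> Obj A" "f \<in> Hom A x y"
  shows mmap_inv_in: "mmap (inv_endofun A S) x y f
      \<in> Hom A (omap (inv_endofun A S) x) (omap (inv_endofun A S) y)"
    and mmap_mmap_inv: "mmap S (omap (inv_endofun A S) x) (omap (inv_endofun A S) y)
      (mmap (inv_endofun A S) x y f) = f"
proof -
  let ?h = "omap (inv_endofun A S)"
  have "mmap S (?h x) (?h y) ` Hom A (?h x) (?h y) = Hom A x y"
    using bij_mmap[of "?h x" "?h y"] assms by (simp add: omap_inv_in omap_omap_inv bij_betw_def)
  moreover have "mmap (inv_endofun A S) x y = inv_into (Hom A (?h x) (?h y)) (mmap S (?h x) (?h y))"
    by (simp add: inv_endofun_def Let_def)
  ultimately show "mmap (inv_endofun A S) x y f \<in> Hom A (?h x) (?h y)"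
    "mmap S (?h x) (?h y) (mmap (inv_endofun A S) x y f) = f"
    using assms(3) by (simp_all add: inv_into_into f_inv_into_f)
qed

text \<open>The algebraic identities are checked after applying \<open>S\<close>, which undoes the
  inverse and is injective on Hom spaces.\<close>

lemma linear_automorphism_inv: "linear_automorphism A (inv_endofun A S)"
proof unfold_locales
  let ?I = "inv_endofun A S"
  have om: "omap ?I = inv_into (Obj A) (omap S)" by (simp add: inv_endofun_def Let_def)
  show "bij_betw (omap ?I) (Obj A) (Obj A)"
    unfolding om by (rule bij_betw_inv_into[OF bij_omap])
  show "bij_betw (mmap ?I x y) (Hom A x y) (Hom A (omap ?I x) (omap ?I y))"
    if "x \<in> Obj A" "y \<in> Obj A" for x y
    using bij_betw_inv_into[OF bij_mmap[of "omap ?I x" "omap ?I y"]] that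
    by (simp add: omap_inv_in omap_omap_inv) (simp add: inv_endofun_def Let_def)
  show "linear_between (smul A) (smul A) (Hom A x y) (mmap ?I x y)"
    if xy: "x \<in> Obj A" "y \<in> Obj A" for x y
  proof -
    note ob = omap_inv_in[OF xy(1)] omap_inv_in[OF xy(2)]
    have add: "f + g \<in> Hom A x y" if "x \<in> Obj A" "y \<in> Obj A" "f \<in> Hom A x y" "g \<in> Hom A x y" for x y f g
      using Hom.subspace_add[OF subspace_Hom] that by blast
    have scale: "smul A c f \<in> Hom A x y" if "f \<in> Hom A x y" "x \<in> Obj A" "y \<in> Obj A" for x y f c
      using Hom.subspace_scale[OF subspace_Hom] that by blast
    have "mmap ?I x y (f + g) = mmap ?I x y f + mmap ?I x y g"
      if fg: "f \<in> Hom A x y" "g \<in> Hom A x y" for f g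
    proof -
      note mem = mmap_inv_in[OF xy fg(1)] mmap_inv_in[OF xy fg(2)] mmap_inv_in[OF xy add[OF xy fg]]
      show ?thesis
        using mmap_eq_iff[OF ob mem(3) add[OF ob mem(1,2)]]
        by (simp add: mmap_add[OF ob mem(1,2)] mmap_mmap_inv xy fg add)
    qed
    moreover have "mmap ?I x y (smul A c f) = smul A c (mmap ?I x y f)" if f: "f \<in> Hom A x y" for c f
    proof -
      note mem = mmap_inv_in[OF xy f] mmap_inv_in[OF xy scale[OF f xy]]
      show ?thesis
        using mmap_eq_iff[OF ob mem(2)[of c] scale[OF mem(1) ob, of c]]
        by (simp add: mmap_smul[OF ob mem(1)] mmap_mmap_inv xy f scale)
    qed
    ultimately show ?thesis by (simp add: linear_between_def)
  qed
  show "mmap ?I x x (Ident A x) = Ident A (omap ?I x)" if x: "x \<in> Obj A" for x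
  proof -
    note ob = omap_inv_in[OF x]
    show ?thesis
      using mmap_eq_iff[OF ob ob mmap_inv_in[OF x x Ident_in_Hom[OF x]] Ident_in_Hom[OF ob]]
      by (simp add: mmap_Ident[OF ob] omap_omap_inv[OF x] mmap_mmap_inv[OF x x Ident_in_Hom[OF x]])
  qed
  show "mmap ?I x z (Comp A x y z g f)
      = Comp A (omap ?I x) (omap ?I y) (omap ?I z) (mmap ?I y z g) (mmap ?I x y f)"
    if xyz: "x \<in> Obj A" "y \<in> Obj A" "z \<in> Obj A" and fg: "f \<in> Hom A x y" "g \<in> Hom A y z" for x y z f g
  proof -
    note ob = omap_inv_in[OF xyz(1)] omap_inv_in[OF xyz(2)] omap_inv_in[OF xyz(3)]
    note mem = mmap_inv_in[OF xyz(1,2) fg(1)] mmap_inv_in[OF xyz(2,3) fg(2)]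
    note gf = Comp_in_Hom[OF xyz fg]
    show ?thesis
      using mmap_eq_iff[OF ob(1,3) mmap_inv_in[OF xyz(1,3) gf] Comp_in_Hom[OF ob mem]]
      by (simp add: mmap_Comp[OF ob mem] omap_omap_inv xyz mmap_mmap_inv[OF xyz(1,3) gf]
          mmap_mmap_inv[OF xyz(1,2) fg(1)] mmap_mmap_inv[OF xyz(2,3) fg(2)])
  qed
qed

lemma linear_automorphism_power: "linear_automorphism A (aut_power A S n)"
proof -
  have "linear_automorphism A ((comp_endofun T ^^ k) id_endofun)" if "linear_automorphism A T" for T k
    by (induction k) (auto intro: linear_automorphism_id linear_automorphism_comp that)
  then show ?thesis
    using linear_automorphism_axioms linear_automorphism_inv by (auto simp: aut_power_def)
qed

abbreviation "sob n x \<equiv> shift_obj A S n x"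
abbreviation "smor n x y f \<equiv> shift_mor A S n x y f"

interpretation P: linear_automorphism A "aut_power A S n" for n
  by (rule linear_automorphism_power)

lemma aut_power_0: "aut_power A S 0 = id_endofun"
  by (simp add: aut_power_def)

text \<open>\<open>aut_power\<close> iterates \<open>S\<close> or its inverse according to the sign
  of \<open>n\<close>. The step from \<open>n\<close> to \<open>n + 1\<close> has one form for both,
  as \<open>S\<close> cancels one inverse when \<open>n < 0\<close>; additivity of the exponent is
  derived from it.\<close>

lemma
  assumes "x \<in> Obj A"
  shows shift_obj_Suc: "sob (n + 1) x = omap S (sob n x)"
    and shift_mor_Suc: "\<lbrakk>y \<in> Obj A; f \<in> Hom A x y\<rbrakk> \<Longrightarrow>
      smor (n + 1) x y f = mmap S (sob n x) (sob n y) (smor n x y f)"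
proof -
  have pos: "aut_power A S (n + 1) = comp_endofun S (aut_power A S n)" if "n \<ge> 0"
    using that by (simp add: aut_power_def nat_add_distrib)
  have neg: "aut_power A S n = comp_endofun (inv_endofun A S) (aut_power A S (n + 1))" if "n < 0"
  proof -
    have "nat (- n) = Suc (nat (- (n + 1)))" using that by simp
    \<comment> \<open>For \<open>n = - 1\<close> the definition takes the nonnegative branch, but
      zero iterations give the identity in either branch.\<close>
    moreover have "aut_power A S (n + 1) = (comp_endofun (inv_endofun A S) ^^ nat (- (n + 1))) id_endofun"
      by (cases "n = - 1") (use that in \<open>auto simp: aut_power_def\<close>)
    ultimately show ?thesis using that by (simp add: aut_power_def)
  qed
  show "sob (n + 1) x = omap S (sob n x)"
  proof (cases "n \<ge> 0")
    case True
    then show ?thesis by (simp add: pos comp_endofun_def)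
  next
    case False
    have "omap S (sob n x) = omap S (omap (inv_endofun A S) (sob (n + 1) x))"
      using neg False by (simp add: comp_endofun_def)
    then show ?thesis using omap_omap_inv[OF P.omap_in[OF assms]] by simp
  qed
  show "smor (n + 1) x y f = mmap S (sob n x) (sob n y) (smor n x y f)"
    if y: "y \<in> Obj A" and f: "f \<in> Hom A x y"
  proof (cases "n \<ge> 0")
    case True
    then show ?thesis by (simp add: pos comp_endofun_def)
  next
    case False
    have "mmap S (sob n x) (sob n y) (smor n x y f)
      = mmap S (omap (inv_endofun A S) (sob (n + 1) x)) (omap (inv_endofun A S) (sob (n + 1) y))
          (mmap (inv_endofun A S) (sob (n + 1) x) (sob (n + 1) y) (smor (n + 1) x y f))"
      using neg False by (simp add: comp_endofun_def)
    then show ?thesis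
      using mmap_mmap_inv[OF P.omap_in[OF assms] P.omap_in[OF y] P.mmap_in[OF assms y f]] by simp
  qed
qed

text \<open>Two-sided induction from 0; the downward step compares both sides after applying
  \<open>S\<close>, which is injective on objects.\<close>

lemma shift_obj_add:
  assumes x: "x \<in> Obj A"
  shows "sob n (sob m x) = sob (n + m) x"
proof (induction n rule: int_induct[where k = 0])
  case base
  then show ?case by (simp add: aut_power_0 id_endofun_def)
next
  case (step1 i)
  then show ?case
    using shift_obj_Suc[OF P.omap_in[OF x, of m], of i] shift_obj_Suc[OF x, of "i + m"] by (simp add: add_ac)
next
  case (step2 i)
  have "omap S (sob (i - 1) (sob m x)) = omap S (sob (i - 1 + m) x)"
    using shift_obj_Suc[OF P.omap_in[OF x, of m], of "i - 1"] shift_obj_Suc[OF x, of "i - 1 + m"] step2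
    by (simp add: algebra_simps)
  then show ?case using omap_eq_iff P.omap_in x by metis
qed

lemma shift_mor_add:
  assumes x: "x \<in> Obj A" and y: "y \<in> Obj A" and f: "f \<in> Hom A x y"
  shows "smor n (sob m x) (sob m y) (smor m x y f) = smor (n + m) x y f"
proof -
  note xm = P.omap_in[OF x, of m] and ym = P.omap_in[OF y, of m] and fm = P.mmap_in[OF x y f, of m]
  note add = shift_obj_add[OF x] shift_obj_add[OF y]
  show ?thesis
  proof (induction n rule: int_induct[where k = 0])
    case base
    then show ?case by (simp add: aut_power_0 id_endofun_def)
  next
    case (step1 i)
    then show ?case
      using shift_mor_Suc[OF xm ym fm, of i] shift_mor_Suc[OF x y f, of "i + m"]
      by (simp add: add ac_simps)
  next
    case (step2 i)
    have "mmap S (sob (i - 1 + m) x) (sob (i - 1 + m) y) (smor (i - 1) (sob m x) (sob m y) (smor m x y f))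
        = mmap S (sob (i - 1 + m) x) (sob (i - 1 + m) y) (smor (i - 1 + m) x y f)"
      using shift_mor_Suc[OF xm ym fm, of "i - 1"] shift_mor_Suc[OF x y f, of "i - 1 + m"] step2
      by (simp add: add algebra_simps)
    then show ?case
      using mmap_eq_iff[OF P.omap_in[OF x] P.omap_in[OF y]] P.mmap_in[OF xm ym fm, of "i - 1"]
        P.mmap_in[OF x y f, of "i - 1 + m"] by (simp add: add)
  qed
qed

lemma shift_1: "x \<in> Obj A \<Longrightarrow> sob 1 x = omap S x"
  "\<lbrakk>x \<in> Obj A; y \<in> Obj A; f \<in> Hom A x y\<rbrakk> \<Longrightarrow> smor 1 x y f = mmap S x y f"
  using shift_obj_Suc[of x 0] shift_mor_Suc[of x y f 0] by (simp_all add: aut_power_0 id_endofun_def)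

end

subsection \<open>The orbit category\<close>

context linear_automorphism
begin

interpretation P: linear_automorphism A "aut_power A S n" for n
  by (rule linear_automorphism_power)

lemma orbit_category_simps [simp]:
  "gObj (orbit_category A S) = Obj A"
  "gHom (orbit_category A S) n x y = Hom A x (sob n y)"
  "gsmul (orbit_category A S) = smul A"
  "gComp (orbit_category A S) x y z m n g f
    = Comp A x (sob n y) (sob (n + m) z) (smor n y (sob m z) g) f"
  by (simp_all add: orbit_category_def)

lemma shift_mor_in:
  "\<lbrakk>y \<in> Obj A; z \<in> Obj A; g \<in> Hom A y (sob m z)\<rbrakk> \<Longrightarrow> smor n y (sob m z) g \<in> Hom A (sob n y) (sob (n + m) z)"
  using P.mmap_in[OF _ P.omap_in, of y z g m n] by (simp add: shift_obj_add)

text \<open>Associativity is \<open>\<Sigma>^n (\<Sigma>^m (h) g) f = \<Sigma>^(n + m) (h)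
  (\<Sigma>^n (g) f)\<close>, which combines functoriality of the powers with additivity of
  exponents.\<close>

lemma graded_semicategory_orbit: "graded_semicategory (orbit_category A S)"
proof (rule graded_semicategory.intro, goal_cases)
  case 1
  show ?case using vector_space_smul by simp
next
  case (2 x y n)
  then show ?case by (simp add: subspace_Hom P.omap_in)
next
  case (3 x y z f n g m)
  then have ob: "x \<in> Obj A" "y \<in> Obj A" "z \<in> Obj A"
    and f: "f \<in> Hom A x (sob n y)" and g: "g \<in> Hom A y (sob m z)"
    by simp_all
  show ?case
    using Comp_in_Hom[OF ob(1) P.omap_in[OF ob(2)] P.omap_in[OF ob(3)] f shift_mor_in[OF ob(2,3) g]]
    by (simp add: add.commute)
next
  case (4 w x y z f n g m h l)
  then have ob: "w \<in> Obj A" "x \<in> Obj A" "y \<in> Obj A" "z \<in> Obj A"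
    and f: "f \<in> Hom A w (sob n x)" and g: "g \<in> Hom A x (sob m y)" and h: "h \<in> Hom A y (sob l z)"
    by simp_all
  have h': "smor m y (sob l z) h \<in> Hom A (sob m y) (sob (m + l) z)"
    by (rule shift_mor_in[OF ob(3,4) h])
  have add: "sob n (sob m y) = sob (n + m) y" "sob n (sob (m + l) z) = sob (n + m + l) z"
    "sob m (sob l z) = sob (m + l) z"
    using ob by (simp_all add: shift_obj_add add.assoc)
  have hh: "smor n (sob m y) (sob (m + l) z) (smor m y (sob l z) h) = smor (n + m) y (sob l z) h"
    using shift_mor_add[OF ob(3) P.omap_in[OF ob(4)] h, of n m] add(3) by simp
  have "smor n x (sob (m + l) z) (Comp A x (sob m y) (sob (m + l) z) (smor m y (sob l z) h) g)
    = Comp A (sob n x) (sob (n + m) y) (sob (n + m + l) z) (smor (n + m) y (sob l z) h) (smor n x (sob m y) g)"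
    using P.mmap_Comp[OF ob(2) P.omap_in[OF ob(3)] P.omap_in[OF ob(4)] g h', of n] by (simp add: add hh)
  moreover have "Comp A w (sob n x) (sob (n + m + l) z)
      (Comp A (sob n x) (sob (n + m) y) (sob (n + m + l) z) (smor (n + m) y (sob l z) h) (smor n x (sob m y) g)) f
    = Comp A w (sob (n + m) y) (sob (n + m + l) z) (smor (n + m) y (sob l z) h)
        (Comp A w (sob n x) (sob (n + m) y) (smor n x (sob m y) g) f)"
    by (rule Comp_assoc[OF ob(1) P.omap_in[OF ob(2)] P.omap_in[OF ob(3)] P.omap_in[OF ob(4)] f
          shift_mor_in[OF ob(2,3) g] shift_mor_in[OF ob(3,4) h]])
  \<comment> \<open>The orbit category adds the degree of the inner morphism first, so its shifts
    carry the sums of degrees in the opposite order.\<close>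
  moreover have "n + (l + m) = n + m + l" "l + m = m + l" "m + n = n + m" by simp_all
  ultimately show ?case unfolding orbit_category_simps by metis
next
  case (5 x y z f n m)
  then have ob: "x \<in> Obj A" "y \<in> Obj A" "z \<in> Obj A" and f: "f \<in> Hom A x (sob n y)" by simp_all
  have "linear_between (smul A) (smul A) (Hom A y (sob m z)) (\<lambda>g. Comp A x (sob n y) (sob (n + m) z)
    (smor n y (sob m z) g) f)"
    by (rule linear_between_comp[OF P.mmap_linear[OF ob(2) P.omap_in[OF ob(3)]]
          Comp_linear_left[OF ob(1) P.omap_in[OF ob(2)] P.omap_in[OF ob(3)] f]])
      (use shift_mor_in[OF ob(2,3)] in blast)
  then show ?case by simp
next
  case (6 x y z g m n)
  then show ?case
    using Comp_linear_right[OF _ P.omap_in P.omap_in shift_mor_in] by simp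
qed

section \<open>The center of the orbit category and the graded center of \<open>A\<close>\<close>

text \<open>Compatibility with \<open>S\<close> is given for one shift and is iterated upwards and
  downwards; each step contributes \<open>(- 1) powi i\<close>.\<close>

lemma shift_natural:
  assumes e: "e \<in> natural_deg A S i" and x: "x \<in> Obj A"
  shows "e (sob j x) = smul A ((- 1) powi (i * j)) (smor j x (sob i x) (e x))"
proof -
  have ex: "e y \<in> Hom A y (sob i y)" if "y \<in> Obj A" for y
    using e that by (simp add: natural_deg_def families_def)
  have eS: "e (omap S y) = smul A ((- 1) powi i) (mmap S y (sob i y) (e y))" if "y \<in> Obj A" for y
    using e that by (simp add: natural_deg_def)
  have comm: "sob i (sob j x) = sob j (sob i x)" for j
    by (simp add: shift_obj_add[OF x] add.commute)
  have mem: "smor j x (sob i x) (e x) \<in> Hom A (sob j x) (sob i (sob j x))" for j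
    unfolding comm by (rule P.mmap_in[OF x P.omap_in[OF x] ex[OF x]])
  note scale = Hom.subspace_scale[OF subspace_Hom[OF P.omap_in[OF x] P.omap_in[OF P.omap_in[OF x]]] mem]
  note Suc = shift_obj_Suc[OF x] shift_mor_Suc[OF x P.omap_in[OF x] ex[OF x]]
  show ?thesis
  proof (induction j rule: int_induct[where k = 0])
    case base
    then show ?case by (simp add: aut_power_0 id_endofun_def)
  next
    case (step1 j)
    have "e (sob (j + 1) x) = smul A ((- 1) powi i) (mmap S (sob j x) (sob i (sob j x)) (e (sob j x)))"
      unfolding Suc by (rule eS[OF P.omap_in[OF x]])
    also have "mmap S (sob j x) (sob i (sob j x)) (e (sob j x))
      = smul A ((- 1) powi (i * j)) (mmap S (sob j x) (sob i (sob j x)) (smor j x (sob i x) (e x)))"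
      unfolding step1.IH by (rule mmap_smul[OF P.omap_in[OF x] P.omap_in[OF P.omap_in[OF x]] mem])
    also have "mmap S (sob j x) (sob i (sob j x)) (smor j x (sob i x) (e x)) = smor (j + 1) x (sob i x) (e x)"
      unfolding Suc comm ..
    finally show ?case by (simp add: power_int_add distrib_left mult.commute)
  next
    case (step2 j)
    define y where "y = sob (j - 1) x"
    have y: "y \<in> Obj A" unfolding y_def by (rule P.omap_in[OF x])
    have "smul A ((- 1) powi i) (mmap S y (sob i y) (e y)) = e (sob (j - 1 + 1) x)"
      unfolding Suc y_def[symmetric] by (rule eS[OF y, symmetric])
    also have "\<dots> = smul A ((- 1) powi (i * j)) (smor (j - 1 + 1) x (sob i x) (e x))"
      using step2.IH by simp
    also have "smor (j - 1 + 1) x (sob i x) (e x) = mmap S y (sob i y) (smor (j - 1) x (sob i x) (e x))"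
      unfolding Suc comm y_def ..
    finally have eq: "smul A ((- 1) powi i) (mmap S y (sob i y) (e y))
        = smul A ((- 1) powi (i * j)) (mmap S y (sob i y) (smor (j - 1) x (sob i x) (e x)))" .
    have "smul A ((- 1) powi i * (- 1) powi i) (mmap S y (sob i y) (e y))
        = smul A ((- 1) powi i * (- 1) powi (i * j)) (mmap S y (sob i y) (smor (j - 1) x (sob i x) (e x)))"
      by (simp only: Hom.scale_scale[symmetric] eq)
    \<comment> \<open>A sign is its own inverse: the exponents \<open>i + i * j\<close> and
      \<open>i * (j - 1)\<close> differ by \<open>2 * i\<close>.\<close>
    moreover have "(- 1 :: 'k) powi i * (- 1) powi (i * j) = (- 1) powi (i * (j - 1))"
    proof -
      have "(- 1 :: 'k) powi i * (- 1) powi (i * j) = (- 1) powi (i + i * j)"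
        by (simp add: power_int_add)
      also have "\<dots> = (- 1) powi (i * (j - 1))"
        by (rule powi_minus_one_cong) (simp add: algebra_simps)
      finally show ?thesis .
    qed
    ultimately have "mmap S y (sob i y) (e y)
        = smul A ((- 1) powi (i * (j - 1))) (mmap S y (sob i y) (smor (j - 1) x (sob i x) (e x)))"
      by (simp only: powi_minus_one_square Hom.scale_one)
    also have "\<dots> = mmap S y (sob i y) (smul A ((- 1) powi (i * (j - 1))) (smor (j - 1) x (sob i x) (e x)))"
      unfolding y_def by (rule mmap_smul[OF P.omap_in[OF x] P.omap_in[OF P.omap_in[OF x]] mem, symmetric])
    finally have "mmap S y (sob i y) (e y)
        = mmap S y (sob i y) (smul A ((- 1) powi (i * (j - 1))) (smor (j - 1) x (sob i x) (e x)))" .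
    from iffD1[OF mmap_eq_iff[OF y P.omap_in[OF y] ex[OF y] scale[of _ "j - 1", folded y_def]] this]
    show ?case unfolding y_def .
  qed
qed

text \<open>Morphisms of degree 0 give naturality, and the identity of \<open>omap S x\<close>, read
  as a morphism of degree 1 to \<open>x\<close>, gives compatibility with \<open>S\<close>.
  Conversely, a morphism of degree \<open>j\<close> to \<open>y\<close> is a morphism of
  \<open>A\<close> to the \<open>j\<close>-th shift of \<open>y\<close>; naturality produces the
  value of \<open>e\<close> there, and \<open>shift_natural\<close> rewrites it.\<close>

lemma center_deg_orbit: "center_deg (orbit_category A S) i = natural_deg A S i"
proof (intro equalityI subsetI)
  fix e assume e: "e \<in> center_deg (orbit_category A S) i"
  then have fam: "e \<in> families (Obj A) (\<lambda>x. Hom A x (sob i x))"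
    and comm: "\<And>x y j f. \<lbrakk>x \<in> Obj A; y \<in> Obj A; f \<in> Hom A x (sob j y)\<rbrakk> \<Longrightarrow>
      Comp A x (sob i x) (sob (i + j) y) (smor i x (sob j y) f) (e x)
        = smul A ((- 1) powi (i * j)) (Comp A x (sob j y) (sob (j + i) y) (smor j y (sob i y) (e y)) f)"
    by (auto simp: center_deg_def)
  from fam have ex: "e x \<in> Hom A x (sob i x)" if "x \<in> Obj A" for x
    using that by (simp add: families_def)
  have "Comp A x (sob i x) (sob i y) (smor i x y f) (e x) = Comp A x y (sob i y) (e y) f"
    if "x \<in> Obj A" "y \<in> Obj A" "f \<in> Hom A x y" for x y f
    using comm[of x y f 0] that by (simp add: aut_power_0 id_endofun_def)
  moreover have "e (omap S x) = smul A ((- 1) powi i) (mmap S x (sob i x) (e x))" if x: "x \<in> Obj A" for x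
  proof -
    note Sx = omap_in[OF x]
    have ob: "sob (i + 1) x = sob i (omap S x)" "sob (1 + i) x = sob i (omap S x)"
      using shift_obj_add[OF x, of i 1] by (simp_all add: shift_1(1)[OF x] add.commute)
    have ob': "omap S (sob i x) = sob i (omap S x)"
      using shift_obj_Suc[OF x, of i] ob by simp
    have "smor i (omap S x) (omap S x) (Ident A (omap S x)) = Ident A (sob i (omap S x))"
      by (rule P.mmap_Ident[OF Sx])
    moreover have "smor 1 x (sob i x) (e x) = mmap S x (sob i x) (e x)"
      by (rule shift_1(2)[OF x P.omap_in[OF x] ex[OF x]])
    moreover have "mmap S x (sob i x) (e x) \<in> Hom A (omap S x) (sob i (omap S x))"
      using mmap_in[OF x P.omap_in[OF x] ex[OF x]] ob' by simp
    ultimately show ?thesis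
      using comm[OF Sx x, of "Ident A (omap S x)" 1] Ident_in_Hom[OF Sx] ex[OF Sx]
      by (simp add: shift_1(1)[OF x] ob Comp_Ident_left Comp_Ident_right Sx P.omap_in)
  qed
  ultimately show "e \<in> natural_deg A S i" using fam by (simp add: natural_deg_def)
next
  fix e assume e: "e \<in> natural_deg A S i"
  then have fam: "e \<in> families (Obj A) (\<lambda>x. Hom A x (sob i x))"
    and nat: "\<And>x y f. \<lbrakk>x \<in> Obj A; y \<in> Obj A; f \<in> Hom A x y\<rbrakk> \<Longrightarrow>
      Comp A x (sob i x) (sob i y) (smor i x y f) (e x) = Comp A x y (sob i y) (e y) f"
    by (auto simp: natural_deg_def)
  have "Comp A x (sob i x) (sob (i + j) y) (smor i x (sob j y) f) (e x)
      = smul A ((- 1) powi (i * j)) (Comp A x (sob j y) (sob (j + i) y) (smor j y (sob i y) (e y)) f)"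
    if xy: "x \<in> Obj A" "y \<in> Obj A" and f: "f \<in> Hom A x (sob j y)" for x y j f
  proof -
    have ey: "e y \<in> Hom A y (sob i y)" using fam xy by (simp add: families_def)
    have ob: "sob i (sob j y) = sob (j + i) y" "sob (i + j) y = sob (j + i) y"
      by (simp_all add: shift_obj_add[OF xy(2)] add.commute)
    have "Comp A x (sob i x) (sob (i + j) y) (smor i x (sob j y) f) (e x)
        = Comp A x (sob j y) (sob (j + i) y) (e (sob j y)) f"
      using nat[OF xy(1) P.omap_in[OF xy(2)] f] by (simp add: ob)
    also have "\<dots> = smul A ((- 1) powi (i * j)) (Comp A x (sob j y) (sob (j + i) y) (smor j y (sob i y) (e y)) f)"
      unfolding shift_natural[OF e xy(2)]
      using Comp_linear_left[OF xy(1) P.omap_in[OF xy(2)] P.omap_in[OF xy(2)] f, of "j + i"]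
        shift_mor_in[OF xy(2,2) ey, of j]
      by (simp add: linear_between_def)
    finally show ?thesis .
  qed
  with fam show "e \<in> center_deg (orbit_category A S) i" by (simp add: center_deg_def)
qed

end

text \<open>\<open>tr_symmetric\<close> is \<open>tr_comm\<close> written out in \<open>A\<close>.
  For nondegeneracy, \<open>A\<close> tests against morphisms from the \<open>i\<close>-th shift of
  \<open>y\<close> to the \<open>d\<close>-th shift of \<open>x\<close>; the \<open>i\<close>-th
  power of \<open>S\<close> identifies these with the morphisms of degree \<open>j = d - i\<close>
  from \<open>y\<close> to \<open>x\<close>.\<close>

lemma (in calabi_yau_category) traced_graded_semicategory_orbit:
  assumes "CHAR('k) = p" "p > 0"
  shows "traced_graded_semicategory (orbit_category A S) p d tr"
proof -
  interpret shift: linear_automorphism A "aut_power A S n" for n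
    by (rule linear_automorphism_power)
  interpret graded_semicategory "orbit_category A S" by (rule graded_semicategory_orbit)
  show ?thesis
  proof (unfold_locales, goal_cases)
    case (3 x y n)
    then show ?case using finite_dim_Hom[OF _ shift.omap_in] by simp
  next
    case (4 x)
    then show ?case using tr_linear by simp
  next
    case (5 x y u i f j)
    then have "j = d - i" by simp
    with 5 tr_symmetric[of x y u i f] show ?case by simp
  next
    case (6 x y g i j)
    then have ob: "x \<in> Obj A" "y \<in> Obj A" and g: "g \<in> Hom A x (sob i y)" and ij: "i + j = d"
      and zero: "\<And>f. f \<in> Hom A y (sob j x) \<Longrightarrow>
        tr x (Comp A x (sob i y) (sob d x) (smor i y (sob j x) f) g) = 0"
      by simp_all
    show ?case
    proof (rule nondegenerate_right[OF ob(1) shift.omap_in[OF ob(2)] g])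
      fix F assume "F \<in> Hom A (sob i y) (sob d x)"
      moreover have "smor i y (sob j x) ` Hom A y (sob j x) = Hom A (sob i y) (sob d x)"
        using shift.bij_mmap[OF ob(2) shift.omap_in[OF ob(1)], of i j] shift_obj_add[OF ob(1), of i j] ij
        by (simp add: bij_betw_def)
      ultimately show "tr x (Comp A x (sob i y) (sob d x) F g) = 0" using zero by force
    qed
  qed (use assms in auto)
qed

theorem lemma4p6:
  fixes A :: "('k::field, 'o, 'm::ab_group_add) lin_cat"
    and S :: "('o, 'm) endofun"
    and tr :: "'o \<Rightarrow> 'm \<Rightarrow> 'k"
    and d :: int
    and p r :: nat
  assumes "CHAR('k) = p" and "p > 0"
    and "calabi_yau_category A S d tr"
  shows "K_r (orbit_category A S) p r = K_rs (orbit_category A S) p r d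
    \<and> K_rs (orbit_category A S) p r d = perp A S d tr (T_space (orbit_category A S) p r)"
proof -
  interpret calabi_yau_category A S d tr by (rule assms(3))
  interpret traced_graded_semicategory "orbit_category A S" p d tr
    by (rule traced_graded_semicategory_orbit[OF assms(1,2)])
  have "graded_center A S = graded_sum (center_deg (orbit_category A S))"
    by (simp add: graded_center_def graded_sum_def center_deg_orbit)
  then show ?thesis
    unfolding perp_def pairing_def using K_r_eq K_rs_eq by simp
qed

end
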